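(* For a positive integer $d$, let $M(d)$ denote the maximum size of a set of mutually unbiased weighing matrices of order $d$ and weight $4$ (with $M(d)=0$ if no such set exists). Then: (i) $M(5)=0$, $M(8)=14$, $M(9)=0$, $M(11)=2$, $M(13)=4$; (ii) $M(d)=d-2$ for every even $d\geq 4$ with $d\neq 8$; (iii) $M(d)=8$ for $d=7$ and for every odd $d\geq 15$. Moreover, among root lattices of rank $d$, the maximum number of pairwise disjoint $2$-frames is attained by: $E_8$ for $d=8$; $D_4\perp E_7$ for $d=11$; $D_6\perp E_7$ for $d=13$; $D_d$ for even $d\geq 4$, $d\neq 8$ (and also $E_8\perp E_8$ for $d=16$); and, for $d=7$ or odd $d\geq 15$, any lattice of the form $(\perp_{a\text{ copies}}E_7)\perp(\perp_{b\text{ copies}}E_8)\perp(\perp_i(\perp_{t_i\text{ copies}}D_{d_i}))$ with $a\neq 0$, each $d_i\geq 10$ even, and $d=7a+8b+\sum_i t_id_i$. In particular, for odd $d\geq 17$, the lattice $E_7\perp D_{d-7}$ attains $M(d)=8$.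
   Context: A weighing matrix of order $d$ and weight $k$ is a $d\times d$ matrix $W$ with entries in $\{0,\pm1\}$ with $WW^T=kI$. Two weighing matrices $W_1,W_2$ of order $d$ and weight $k$ are unbiased if $\frac{1}{\sqrt{k}}W_1W_2^T$ is also a weighing matrix of weight $k$; a set of weighing matrices is a set of mutually unbiased weighing matrices (MUWM) if any two distinct members are unbiased. A root lattice is an integral lattice generated by roots, i.e. vectors $v$ with $(v,v)=2$; $A_n,D_n,E_6,E_7,E_8$ denote the standard irreducible root lattices, and $\perp$ denotes orthogonal direct sum. For a lattice of rank $d$, a $2$-frame is a set $\{\pm v_1,\ldots,\pm v_d\}$ of lattice vectors with $(v_i,v_j)=2\delta_{ij}$; $2$-frames are disjoint if they have no common vectors. *)

theory Defs
  imports "Jordan_Normal_Form.VS_Connect"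
begin

definition weighing_matrix :: "nat \<Rightarrow> nat \<Rightarrow> real mat \<Rightarrow> bool" where
  "weighing_matrix d k W \<longleftrightarrow>
     W \<in> carrier_mat d d \<and> elements_mat W \<subseteq> {-1, 0, 1} \<and>
     W * W\<^sup>T = of_nat k \<cdot>\<^sub>m 1\<^sub>m d"

definition unbiased :: "nat \<Rightarrow> nat \<Rightarrow> real mat \<Rightarrow> real mat \<Rightarrow> bool" where
  "unbiased d k W\<^sub>1 W\<^sub>2 \<longleftrightarrow> weighing_matrix d k ((1 / sqrt (real k)) \<cdot>\<^sub>m (W\<^sub>1 * W\<^sub>2\<^sup>T))"

definition MUWM :: "nat \<Rightarrow> nat \<Rightarrow> real mat set \<Rightarrow> bool" where
  "MUWM d k S \<longleftrightarrow> (\<forall>W\<in>S. weighing_matrix d k W) \<and> pairwise (unbiased d k) S"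

text \<open>The set of sizes is finite, since there are only finitely many matrices over
  \<open>{-1, 0, 1}\<close>, and it contains \<open>0\<close> (the empty set), so the value is \<open>0\<close> if there is no
  weighing matrix at all.\<close>

definition max_MUWM :: "nat \<Rightarrow> nat" where
  "max_MUWM d = Max {card S | S. finite S \<and> MUWM d 4 S}"

definition int_span :: "nat \<Rightarrow> real vec set \<Rightarrow> real vec set" where
  "int_span n S =
     {module.lincomb (module_vec TYPE(real) n) (\<lambda>u. of_int (c u)) A | (c :: real vec \<Rightarrow> int) A.
        finite A \<and> A \<subseteq> S}"

definition lattice_of_rank :: "nat \<Rightarrow> nat \<Rightarrow> real vec set \<Rightarrow> bool" where
  "lattice_of_rank n d L \<longleftrightarrow>
     (\<exists>B. B \<subseteq> carrier_vec n \<and> finite B \<and> card B = d \<and>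
          module.lin_indpt class_ring (module_vec TYPE(real) n) B \<and> L = int_span n B)"

definition integral_lattice :: "real vec set \<Rightarrow> bool" where
  "integral_lattice L \<longleftrightarrow> (\<forall>x\<in>L. \<forall>y\<in>L. x \<bullet> y \<in> \<int>)"

definition roots :: "real vec set \<Rightarrow> real vec set" where
  "roots L = {v \<in> L. v \<bullet> v = 2}"

text \<open>The dimension \<open>n\<close> of the ambient Euclidean space may exceed the rank \<open>d\<close>.\<close>

definition root_lattice :: "nat \<Rightarrow> real vec set \<Rightarrow> bool" where
  "root_lattice d L \<longleftrightarrow>
     (\<exists>n. lattice_of_rank n d L \<and> integral_lattice L \<and> L = int_span n (roots L))"

definition frame_vectors :: "nat \<Rightarrow> real vec set \<Rightarrow> (nat \<Rightarrow> real vec) \<Rightarrow> bool" where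
  "frame_vectors d L v \<longleftrightarrow>
     (\<forall>i<d. v i \<in> L) \<and> (\<forall>i<d. \<forall>j<d. v i \<bullet> v j = (if i = j then 2 else 0))"

definition two_frame :: "nat \<Rightarrow> real vec set \<Rightarrow> real vec set \<Rightarrow> bool" where
  "two_frame d L F \<longleftrightarrow> (\<exists>v. frame_vectors d L v \<and> F = (\<Union>i<d. {v i, - v i}))"

text \<open>For a lattice of rank \<open>d\<close> the set of sizes is finite, since a lattice has only finitely
  many roots.\<close>

definition max_disjoint_frames :: "nat \<Rightarrow> real vec set \<Rightarrow> nat" where
  "max_disjoint_frames d L =
     Max {card \<F> | \<F>. finite \<F> \<and> (\<forall>F\<in>\<F>. two_frame d L F) \<and> pairwise disjnt \<F>}"

definition attains_max_frames :: "nat \<Rightarrow> real vec set \<Rightarrow> bool" where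
  "attains_max_frames d L \<longleftrightarrow>
     root_lattice d L \<and>
     (\<forall>L'. root_lattice d L' \<longrightarrow> max_disjoint_frames d L' \<le> max_disjoint_frames d L)"

text \<open>If \<open>v\<close> and \<open>w\<close> span disjoint 2-frames of an integral lattice of rank \<open>d\<close>, then
  \<open>w i = (\<Sum>j<d. (w i \<bullet> v j / 2) \<cdot> v j)\<close>, so the matrix of inner products is a weighing matrix
  of weight 4; this is how sets of 2-frames give rise to mutually unbiased weighing matrices,
  one fewer than there are frames.\<close>

definition frame_matrix :: "nat \<Rightarrow> (nat \<Rightarrow> real vec) \<Rightarrow> (nat \<Rightarrow> real vec) \<Rightarrow> real mat" where
  "frame_matrix d v w = mat d d (\<lambda>(i, j). w i \<bullet> v j)"

definition MUWM_from_frames :: "nat \<Rightarrow> real vec set \<Rightarrow> real mat set \<Rightarrow> bool" where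
  "MUWM_from_frames d L S \<longleftrightarrow>
     MUWM d 4 S \<and>
     (\<exists>v. frame_vectors d L v \<and> (\<forall>W\<in>S. \<exists>w. frame_vectors d L w \<and> W = frame_matrix d v w))"

definition D_lattice :: "nat \<Rightarrow> real vec set" where
  "D_lattice n = {x \<in> carrier_vec n.
     (\<forall>i<n. x $ i \<in> \<int>) \<and> (\<exists>m::int. (\<Sum>i<n. x $ i) = 2 * of_int m)}"

definition E8_lattice :: "real vec set" where
  "E8_lattice = {x \<in> carrier_vec 8.
     ((\<forall>i<8. x $ i \<in> \<int>) \<or> (\<forall>i<8. x $ i + 1/2 \<in> \<int>)) \<and>
     (\<exists>m::int. (\<Sum>i<8. x $ i) = 2 * of_int m)}"

text \<open>The orthogonal complement in \<open>E\<^sub>8\<close> of the root \<open>(1/2, \<dots>, 1/2)\<close>; it has rank 7 and lies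
  in the 8-dimensional space.\<close>

definition E7_lattice :: "real vec set" where
  "E7_lattice = {x \<in> E8_lattice. x \<bullet> vec 8 (\<lambda>_. 1/2) = 0}"

definition orth_sum :: "real vec set \<Rightarrow> real vec set \<Rightarrow> real vec set" (infixr "\<bottom>\<^sub>L" 65) where
  "L\<^sub>1 \<bottom>\<^sub>L L\<^sub>2 = {x @\<^sub>v y | x y. x \<in> L\<^sub>1 \<and> y \<in> L\<^sub>2}"

definition orth_sums :: "real vec set list \<Rightarrow> real vec set" where
  "orth_sums Ls = foldr (\<bottom>\<^sub>L) Ls {0\<^sub>v 0}"

end

theory Submission
  imports Defs
begin

text \<open>
  Relative to a fixed 2-frame, the vectors of the other frames of an integral lattice become rows
  with four entries \<open>\<plusminus>1\<close>, so that \<open>k + 1\<close> disjoint frames amount to \<open>k\<close> mutually unbiased weighing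
  matrices of weight 4.

  Upper bounds. The supports of all rows of such matrices are 4-subsets of the \<open>d\<close> columns with
  pairwise even intersections. Every column \<open>x\<close> lies in four rows of each matrix, and a given
  4-set through \<open>x\<close> supports at most eight rows up to sign, so there are at most \<open>2 deg x\<close>
  matrices, where \<open>deg x\<close> counts 4-sets through \<open>x\<close>. After closing the family under symmetric
  differences, either \<open>x\<close> has a twin contained in the same 4-sets, and then \<open>deg x \<le> (d - 2) / 2\<close>,
  or \<open>x\<close> lies in a component with 7 or 8 columns (the supports of the Hamming codes \<open>e\<^sub>7\<close> and \<open>e\<^sub>8\<close>),
  where the degrees are at most 4 and 7. If \<open>d\<close> is odd, then a component with 7 columns exists,
  since twin classes and components with 8 columns are even; a column outside of it gives the
  sharper bounds for \<open>d = 9, 11, 13\<close>.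

  Lower bounds. A one-factorization of the complete graph gives \<open>n - 1\<close> disjoint frames of \<open>D\<^sub>n\<close>,
  explicit tables give 9 for \<open>E\<^sub>7\<close> and 15 for \<open>E\<^sub>8\<close>, and an orthogonal sum has at least as many
  as the worst of its summands.
\<close>

section \<open>Families of 4-sets with even intersections\<close>

text \<open>The 4-sets are treated as the words of weight 4 in a self-orthogonal binary code; the
  sum of two of them has weight 4 again exactly when they meet in two points, which is the closure
  condition of \<open>even_quads\<close>. This closure makes "every 4-set through x contains y" a
  symmetric relation. The bound 2 deg x comes from counting pairs of a matrix and one of its rows
  that is nonzero at x: four per matrix, because the columns have norm 4 as well, against 2^3 = 8
  sign patterns per 4-set once the sign at x is normalized. A repeated pattern would mean two rows
  with inner product 4 or -4, which neither distinct rows of one matrix nor rows of two unbiased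
  ones can have. In even order, 8 is exceptional because e_8 has degree 7 and 2 * 7 > 8 - 2. From 16
  on such a component satisfies the general bound, and in between so few columns remain beside it
  that one of them has a twin. At 16 both bounds equal 14, hence the second extremal lattice there.
  Frames of an arbitrary root lattice are bounded through their matrices of inner products, so one
  estimate for matrices settles both maxima.\<close>

locale even_quads =
  fixes V :: "'a set" and Q :: "'a set set"
  assumes finite_V: "finite V"
    and quad_subset: "q \<in> Q \<Longrightarrow> q \<subseteq> V"
    and card_quad: "q \<in> Q \<Longrightarrow> card q = 4"
    and even_Int: "q \<in> Q \<Longrightarrow> r \<in> Q \<Longrightarrow> even (card (q \<inter> r))"
    and sym_diff_quad: "q \<in> Q \<Longrightarrow> r \<in> Q \<Longrightarrow> card (q \<inter> r) = 2 \<Longrightarrow> sym_diff q r \<in> Q"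
    and covered: "x \<in> V \<Longrightarrow> \<exists>q\<in>Q. x \<in> q"
begin

definition degree :: "'a \<Rightarrow> nat" where
  "degree x = card {q \<in> Q. x \<in> q}"

definition has_twin :: "'a \<Rightarrow> bool" where
  "has_twin x \<longleftrightarrow> (\<exists>y\<in>V. y \<noteq> x \<and> (\<forall>q\<in>Q. x \<in> q \<longleftrightarrow> y \<in> q))"

text \<open>A union of connected components of the hypergraph of 4-sets, possibly with several
  components.\<close>

definition closed_set :: "'a set \<Rightarrow> bool" where
  "closed_set C \<longleftrightarrow> C \<subseteq> V \<and> (\<forall>q\<in>Q. q \<subseteq> C \<or> q \<inter> C = {})"

section \<open>Counting 4-sets through one or two points\<close>

lemma finite_Q: "finite Q"
  using finite_V quad_subset by (meson PowI finite_Pow_iff finite_subset subsetI)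

lemma finite_quad: "q \<in> Q \<Longrightarrow> finite q"
  using card_quad card.infinite by fastforce

lemma card_Int_quads:
  assumes "q \<in> Q" "r \<in> Q" "q \<noteq> r" "q \<inter> r \<noteq> {}"
  shows "card (q \<inter> r) = 2"
proof -
  have fin: "finite q" "finite r" using assms finite_quad by auto
  have "card (q \<inter> r) \<le> 4" using card_mono[of q "q \<inter> r"] fin card_quad assms by auto
  moreover have "card (q \<inter> r) \<noteq> 4"
  proof
    assume "card (q \<inter> r) = 4"
    then have "q \<inter> r = q" "q \<inter> r = r"
      using fin card_quad assms by (metis card_subset_eq inf_le1 inf_le2)+
    then show False using assms by auto
  qed
  moreover have "card (q \<inter> r) \<noteq> 0" using fin assms by auto
  moreover have "even (card (q \<inter> r))" using even_Int assms by auto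
  ultimately show ?thesis by presburger
qed

text \<open>Two different 4-sets through x and y meet in exactly these two points, so what is left
  of them forms disjoint pairs in \<open>C - {x, y}\<close>.\<close>

lemma pair_degree_le:
  assumes C: "closed_set C" and x: "x \<in> C" and xy: "x \<noteq> y"
  shows "2 * card {q \<in> Q. x \<in> q \<and> y \<in> q} \<le> card C - 2"
proof (cases "y \<in> C")
  case False
  then have "{q \<in> Q. x \<in> q \<and> y \<in> q} = {}" using C x unfolding closed_set_def by blast
  then show ?thesis by (simp only: card.empty)
next
  case y: True
  let ?P = "{q \<in> Q. x \<in> q \<and> y \<in> q}"
  have fC: "finite C" using C finite_V finite_subset unfolding closed_set_def by auto
  have inter: "q \<inter> r = {x, y}" if "q \<in> ?P" "r \<in> ?P" "q \<noteq> r" for q r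
  proof -
    have "card (q \<inter> r) = 2" using card_Int_quads that by auto
    moreover have "{x, y} \<subseteq> q \<inter> r" using that by auto
    moreover have "finite (q \<inter> r)" using finite_quad that by auto
    ultimately show ?thesis using xy by (metis card_2_iff card_subset_eq)
  qed
  have "card (\<Union>q\<in>?P. q - {x, y}) = (\<Sum>q\<in>?P. card (q - {x, y}))"
  proof (rule card_UN_disjoint)
    show "finite ?P" using finite_Q by auto
    show "\<forall>q\<in>?P. finite (q - {x, y})" using finite_quad by auto
    show "\<forall>q\<in>?P. \<forall>r\<in>?P. q \<noteq> r \<longrightarrow> (q - {x, y}) \<inter> (r - {x, y}) = {}"
      using inter by blast
  qed
  also have "\<dots> = (\<Sum>q\<in>?P. 2)"
    by (rule sum.cong) (use card_quad finite_quad xy in \<open>auto simp: card_Diff_subset\<close>)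
  finally have "2 * card ?P = card (\<Union>q\<in>?P. q - {x, y})" by simp
  also have "\<dots> \<le> card (C - {x, y})"
    by (rule card_mono) (use fC C x in \<open>auto simp: closed_set_def\<close>)
  also have "\<dots> = card C - 2" using x y xy fC by (simp add: card_Diff_subset)
  finally show ?thesis .
qed

text \<open>Double counting of the incidences of a 4-set through x with a second point y: each 4-set
  gives 3, each y at most half of \<open>card C - 2\<close>, rounded down. For 7 and 8 points this
  yields degrees 4 and 7, the values for the complements of the Fano lines and for the Steiner
  system S(3,4,8).\<close>

lemma degree_le_closed:
  assumes C: "closed_set C" and x: "x \<in> C"
  shows "3 * degree x \<le> (card C - 1) * ((card C - 2) div 2)"
proof -
  let ?D = "{q \<in> Q. x \<in> q}"
  have fC: "finite C" using C finite_V finite_subset unfolding closed_set_def by auto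
  have "(\<Sum>q\<in>?D. card {y \<in> C - {x}. y \<in> q}) = (\<Sum>y\<in>C - {x}. card {q \<in> ?D. y \<in> q})"
    by (rule sum_multicount_gen) (use fC finite_Q in auto)
  moreover have "(\<Sum>q\<in>?D. card {y \<in> C - {x}. y \<in> q}) = (\<Sum>q\<in>?D. 3)"
  proof (rule sum.cong)
    fix q assume q: "q \<in> ?D"
    then have "q \<subseteq> C" using C x unfolding closed_set_def by auto
    then have "{y \<in> C - {x}. y \<in> q} = q - {x}" by auto
    then show "card {y \<in> C - {x}. y \<in> q} = 3" using q card_quad by auto
  qed simp
  moreover have "(\<Sum>y\<in>C - {x}. card {q \<in> ?D. y \<in> q}) \<le> (\<Sum>y\<in>C - {x}. (card C - 2) div 2)"
  proof (rule sum_mono)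
    fix y assume "y \<in> C - {x}"
    then have "2 * card {q \<in> Q. x \<in> q \<and> y \<in> q} \<le> card C - 2"
      using pair_degree_le[OF C x] by auto
    moreover have "{q \<in> ?D. y \<in> q} = {q \<in> Q. x \<in> q \<and> y \<in> q}" by auto
    ultimately show "card {q \<in> ?D. y \<in> q} \<le> (card C - 2) div 2" by simp
  qed
  ultimately show ?thesis using x fC by (simp add: degree_def)
qed

lemma closed_V: "closed_set V"
  using quad_subset by (auto simp: closed_set_def)

lemma degree_le_twin:
  assumes "x \<in> V" "has_twin x"
  shows "2 * degree x \<le> card V - 2"
proof -
  obtain y where y: "y \<noteq> x" "\<forall>q\<in>Q. x \<in> q \<longleftrightarrow> y \<in> q" using assms has_twin_def by auto
  then have "{q \<in> Q. x \<in> q} = {q \<in> Q. x \<in> q \<and> y \<in> q}" by auto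
  then show ?thesis using pair_degree_le[OF closed_V assms(1), of y] y by (simp add: degree_def)
qed

text \<open>If r contained y but not x, then a 4-set q through x would meet r in two points, and the
  symmetric difference would be a 4-set through x that misses y.\<close>

lemma twin_of_dominates:
  assumes x: "x \<in> V" and dom: "\<And>q. q \<in> Q \<Longrightarrow> x \<in> q \<Longrightarrow> y \<in> q"
    and r: "r \<in> Q" "y \<in> r"
  shows "x \<in> r"
proof (rule ccontr)
  assume xr: "x \<notin> r"
  obtain q where q: "q \<in> Q" "x \<in> q" using covered x by auto
  then have "y \<in> q" using dom by auto
  then have "card (q \<inter> r) = 2" using card_Int_quads[of q r] q r xr by auto
  then have "sym_diff q r \<in> Q" using sym_diff_quad q r by auto
  moreover have "x \<in> sym_diff q r" using q xr by auto
  ultimately have "y \<in> sym_diff q r" using dom by blast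
  then show False using \<open>y \<in> q\<close> r by auto
qed

text \<open>Twin classes have 2 or 4 points. If two different 4-sets contain x, the class lies in
  their intersection, which has two points; if only one does, then all its points are twins of
  x.\<close>

lemma even_card_if_all_twins:
  assumes twins: "\<And>x. x \<in> V \<Longrightarrow> has_twin x"
  shows "even (card V)"
proof -
  define R where "R = {(x, y). x \<in> V \<and> y \<in> V \<and> (\<forall>q\<in>Q. x \<in> q \<longleftrightarrow> y \<in> q)}"
  have eq: "equiv V R"
    by (rule equivI) (auto simp: R_def refl_on_def sym_def trans_def)
  have "even (card X)" if "X \<in> V // R" for X
  proof -
    obtain x where x: "x \<in> V" and X: "X = R `` {x}" using \<open>X \<in> V // R\<close> by (auto elim: quotientE)
    obtain q where q: "q \<in> Q" "x \<in> q" using covered x by auto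
    have Xq: "X \<subseteq> q" using q X by (auto simp: R_def)
    show ?thesis
    proof (cases "\<exists>r\<in>Q. x \<in> r \<and> r \<noteq> q")
      case True
      then obtain r where r: "r \<in> Q" "x \<in> r" "r \<noteq> q" by auto
      have c2: "card (q \<inter> r) = 2" using card_Int_quads q r by auto
      have "X \<subseteq> q \<inter> r" using r q X by (auto simp: R_def)
      then have "card X \<le> 2" using c2 card_mono[of "q \<inter> r" X] finite_quad q by auto
      moreover obtain y where "y \<in> V" "y \<noteq> x" "\<forall>q\<in>Q. x \<in> q \<longleftrightarrow> y \<in> q"
        using twins[OF x] unfolding has_twin_def by auto
      then have "{x, y} \<subseteq> X" "card {x, y} = 2" using x by (auto simp: X R_def)
      then have "2 \<le> card X" using card_mono[of X "{x, y}"] Xq finite_quad q finite_subset by metis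
      ultimately show ?thesis by simp
    next
      case False
      have "y \<in> X" if "y \<in> q" for y
      proof -
        have "x \<in> r \<longleftrightarrow> y \<in> r" if "r \<in> Q" for r
          using False twin_of_dominates[OF x, of y r] \<open>y \<in> q\<close> that by blast
        then show ?thesis using x q quad_subset \<open>y \<in> q\<close> by (auto simp: X R_def)
      qed
      then have "X = q" using Xq by auto
      then show ?thesis using card_quad q by auto
    qed
  qed
  then show ?thesis using equiv_imp_dvd_card[OF finite_V eq, of 2] by (simp add: dvd_def)
qed

end

section \<open>Parities of words on seven points\<close>

lemma even_card_Int4:
  assumes "distinct [a, b, c, e]"
  shows "even (card (T \<inter> {a, b, c, e})) \<longleftrightarrow> ((a \<in> T \<longleftrightarrow> b \<in> T) \<longleftrightarrow> (c \<in> T \<longleftrightarrow> e \<in> T))"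
  using assms by (auto simp: Int_insert_right)

text \<open>The six parities say that both words are orthogonal to three generators of the [7,3]
  simplex code, so they belong to its dual, the [7,4] Hamming code. Odd Hamming words are
  complements of simplex words u and v, which are even and mutually orthogonal; hence the product of
  the complements has parity 7 + |u| + |v| + u.v, which is odd.\<close>

lemma odd_product_hamming:
  assumes par: "(x1 \<longleftrightarrow> a1) \<longleftrightarrow> (b1 \<longleftrightarrow> c1)"
    "(x1 \<longleftrightarrow> a1) \<longleftrightarrow> (e1 \<longleftrightarrow> f1)"
    "(x1 \<longleftrightarrow> b1) \<longleftrightarrow> (e1 \<longleftrightarrow> g1)"
    "(x2 \<longleftrightarrow> a2) \<longleftrightarrow> (b2 \<longleftrightarrow> c2)"
    "(x2 \<longleftrightarrow> a2) \<longleftrightarrow> (e2 \<longleftrightarrow> f2)"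
    "(x2 \<longleftrightarrow> b2) \<longleftrightarrow> (e2 \<longleftrightarrow> g2)"
    and o1: "odd (of_bool x1 + of_bool a1 + of_bool b1 + of_bool c1 + of_bool e1 + of_bool f1 + of_bool g1 :: nat)"
    and o2: "odd (of_bool x2 + of_bool a2 + of_bool b2 + of_bool c2 + of_bool e2 + of_bool f2 + of_bool g2 :: nat)"
  shows "odd (of_bool (x1\<and>x2) + of_bool (a1\<and>a2) + of_bool (b1\<and>b2) + of_bool (c1\<and>c2) + of_bool (e1\<and>e2) + of_bool (f1\<and>f2) + of_bool (g1\<and>g2) :: nat)"
proof -
  have c: "c1 = (x1 = (a1 = b1))" "f1 = (x1 = (a1 = e1))" "g1 = (x1 = (b1 = e1))"
          "c2 = (x2 = (a2 = b2))" "f2 = (x2 = (a2 = e2))" "g2 = (x2 = (b2 = e2))" using par by blast+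
  have ev: "even (of_bool p :: nat) \<longleftrightarrow> \<not> p" for p by simp
  \<comment> \<open>With c, f and g eliminated, the weight is congruent to a + b + e modulo 2, so
    oddness determines e.\<close>
  have e: "e1 = (a1 = b1)" "e2 = (a2 = b2)"
    using o1 o2 unfolding c even_add ev by blast+
  show ?thesis
    unfolding even_add ev c e
    by (cases a1; cases b1; cases x1; simp only: simp_thms; cases a2; cases b2; cases x2; simp only: simp_thms)
qed
lemma card_Int7:
  assumes "distinct [x, a, b, c, e, f, g]"
  shows "card (T \<inter> {x, a, b, c, e, f, g}) = of_bool (x \<in> T) + of_bool (a \<in> T) + of_bool (b \<in> T)
    + of_bool (c \<in> T) + of_bool (e \<in> T) + of_bool (f \<in> T) + of_bool (g \<in> T)"
proof -
  have "card (T \<inter> {x, a, b, c, e, f, g}) = (\<Sum>y\<in>{x, a, b, c, e, f, g}. of_bool (y \<in> T))"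
    by (subst card_eq_sum, rule sum.mono_neutral_cong_left) auto
  then show ?thesis using assms by simp
qed

section \<open>Components of points without twin\<close>

context even_quads
begin

text \<open>A point x without twin is missed together with no other point: for each y some 4-set
  through x avoids y. Choosing q2 to avoid a point of q1, and q3 to avoid the second common point a
  of q1 and q2, gives three 4-sets whose pairwise intersections are {x, a}, {x, b} and {x, e}; each
  of them has one further point c, f or g.\<close>

lemma non_twin_heptad:
  assumes x: "x \<in> V" "\<not> has_twin x"
  obtains a b c e f g where "distinct [x, a, b, c, e, f, g]"
    "{x, a, b, c} \<in> Q" "{x, a, e, f} \<in> Q" "{x, b, e, g} \<in> Q"
proof -
  have miss: "\<exists>q\<in>Q. x \<in> q \<and> y \<notin> q" if "y \<in> V" "y \<noteq> x" for y
    using x that twin_of_dominates[OF x(1), of y] unfolding has_twin_def by blast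
  obtain q1 where q1: "q1 \<in> Q" "x \<in> q1" using covered x by auto
  obtain y where y: "y \<in> q1" "y \<noteq> x"
  proof -
    have "card (q1 - {x}) = 3" using card_quad q1 by auto
    then have "q1 - {x} \<noteq> {}" by (metis card.empty zero_neq_numeral)
    then show ?thesis using that by auto
  qed
  obtain q2 where q2: "q2 \<in> Q" "x \<in> q2" "y \<notin> q2" using miss y q1 quad_subset by blast
  have "card (q1 \<inter> q2) = 2" using card_Int_quads q1 q2 y by auto
  then have "card (q1 \<inter> q2 - {x}) = 1" using q1 q2 by auto
  then obtain a where a: "q1 \<inter> q2 - {x} = {a}" by (auto simp: card_1_singleton_iff)
  obtain q3 where q3: "q3 \<in> Q" "x \<in> q3" "a \<notin> q3" using miss[of a] a q1 quad_subset by blast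
  have "card (q1 \<inter> q3) = 2" using card_Int_quads[of q1 q3] q1 q3 a by auto
  then have "card (q1 \<inter> q3 - {x}) = 1" using q1 q3 by auto
  then obtain b where b: "q1 \<inter> q3 - {x} = {b}" by (auto simp: card_1_singleton_iff)
  have "card (q2 \<inter> q3) = 2" using card_Int_quads[of q2 q3] q2 q3 a by auto
  then have "card (q2 \<inter> q3 - {x}) = 1" using q2 q3 by auto
  then obtain e where e: "q2 \<inter> q3 - {x} = {e}" by (auto simp: card_1_singleton_iff)
  have a': "a \<in> q1" "a \<in> q2" "a \<noteq> x" "\<And>y. y \<in> q1 \<Longrightarrow> y \<in> q2 \<Longrightarrow> y = x \<or> y = a"
    using a by blast+
  have b': "b \<in> q1" "b \<in> q3" "b \<noteq> x" "\<And>y. y \<in> q1 \<Longrightarrow> y \<in> q3 \<Longrightarrow> y = x \<or> y = b"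
    using b by blast+
  have e': "e \<in> q2" "e \<in> q3" "e \<noteq> x" "\<And>y. y \<in> q2 \<Longrightarrow> y \<in> q3 \<Longrightarrow> y = x \<or> y = e"
    using e by blast+
  have ab: "a \<noteq> b" "a \<noteq> e" using q3(3) b'(2) e'(2) by metis+
  have be: "b \<noteq> e" using a'(4)[of b] b' e' ab by metis
  have "card (q1 - {x, a, b}) = 1"
    using card_quad[OF q1(1)] q1(2) a'(1) b'(1) a'(3) b'(3) e'(3) ab be
    by (subst card_Diff_subset) auto
  then obtain c where c: "q1 - {x, a, b} = {c}" by (auto simp: card_1_singleton_iff)
  have "card (q2 - {x, a, e}) = 1"
    using card_quad[OF q2(1)] q2(2) a'(2) e'(1) a'(3) b'(3) e'(3) ab be
    by (subst card_Diff_subset) auto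
  then obtain f where f: "q2 - {x, a, e} = {f}" by (auto simp: card_1_singleton_iff)
  have "card (q3 - {x, b, e}) = 1"
    using card_quad[OF q3(1)] q3(2) b'(2) e'(2) a'(3) b'(3) e'(3) ab be
    by (subst card_Diff_subset) auto
  then obtain g where g: "q3 - {x, b, e} = {g}" by (auto simp: card_1_singleton_iff)
  have c': "c \<in> q1" "c \<notin> {x, a, b}" and f': "f \<in> q2" "f \<notin> {x, a, e}" and g': "g \<in> q3" "g \<notin> {x, b, e}"
    using c f g by blast+
  have "q1 = {x, a, b, c}" "q2 = {x, a, e, f}" "q3 = {x, b, e, g}"
    using c f g q1(2) q2(2) q3(2) a'(1,2) b'(1,2) e'(1,2) by blast+
  moreover have n: "c \<noteq> x" "c \<noteq> a" "c \<noteq> b" "f \<noteq> x" "f \<noteq> a" "f \<noteq> e" "g \<noteq> x" "g \<noteq> b" "g \<noteq> e"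
    using c'(2) f'(2) g'(2) by simp_all
  moreover have "c \<noteq> e" using a'(4)[of e] c'(1) e'(1,3) ab(2) by metis
  moreover have "c \<noteq> f" using a'(4)[of f] c'(1) f'(1) n by metis
  moreover have "b \<noteq> f" using a'(4)[of b] b'(1,3) f'(1) ab(1) by metis
  moreover have "c \<noteq> g" using b'(4)[of c] c'(1) g'(1) n by metis
  moreover have "a \<noteq> g" using q3(3) g'(1) by metis
  moreover have "f \<noteq> g" using e'(4)[of f] f'(1) g'(1) n by metis
  ultimately show ?thesis using that[of a b c e f g] q1(1) q2(1) q3(1) ab be a'(3) b'(3) e'(3) by simp
qed

text \<open>Let S be the heptad. Every 4-set meets S in a Hamming word of weight at most 4. If
  weight 3 never occurs, S is closed. Otherwise some T0 leaves S in a single point z, and S with z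
  is closed: a 4-set through z disjoint from S would meet T0 in one point, and one leaving S in
  another point would meet T0 in a product of two odd Hamming words, again an odd number.\<close>

lemma non_twin_component:
  assumes x: "x \<in> V" "\<not> has_twin x"
  obtains C where "closed_set C" "x \<in> C" "card C = 7 \<or> card C = 8"
proof -
  obtain a b c e f g where d: "distinct [x, a, b, c, e, f, g]"
    and q1: "{x, a, b, c} \<in> Q" and q2: "{x, a, e, f} \<in> Q" and q3: "{x, b, e, g} \<in> Q"
    using non_twin_heptad[OF x] by blast
  define S where "S = {x, a, b, c, e, f, g}"
  have cS: "card S = 7" and fS: "finite S" using d by (auto simp: S_def)
  have SV: "S \<subseteq> V" using q1 q2 q3 quad_subset by (auto simp: S_def)
  have par: "(x \<in> T \<longleftrightarrow> a \<in> T) \<longleftrightarrow> (b \<in> T \<longleftrightarrow> c \<in> T)"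
    "(x \<in> T \<longleftrightarrow> a \<in> T) \<longleftrightarrow> (e \<in> T \<longleftrightarrow> f \<in> T)"
    "(x \<in> T \<longleftrightarrow> b \<in> T) \<longleftrightarrow> (e \<in> T \<longleftrightarrow> g \<in> T)"
    if T: "T \<in> Q" for T
    using even_Int[OF T q1] even_Int[OF T q2] even_Int[OF T q3] d
    by (simp_all add: even_card_Int4)
  have card_S: "card (T \<inter> S) = of_bool (x \<in> T) + of_bool (a \<in> T) + of_bool (b \<in> T) + of_bool (c \<in> T)
      + of_bool (e \<in> T) + of_bool (f \<in> T) + of_bool (g \<in> T)" for T
    unfolding S_def by (rule card_Int7[OF d])
  \<comment> \<open>The Hamming weights are 0, 3, 4 and 7, and 7 exceeds the size of a
    4-set.\<close>
  have weights: "card (T \<inter> S) \<in> {0, 3, 4}" if T: "T \<in> Q" for T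
  proof -
    have "card (T \<inter> S) \<le> 4"
      using card_mono[of T "T \<inter> S"] finite_quad[OF T] card_quad[OF T] by auto
    then show ?thesis using par[OF T] unfolding card_S
      by (cases "x \<in> T"; cases "a \<in> T"; cases "b \<in> T"; cases "e \<in> T") simp_all
  qed
  have odd_Int: "odd (card (T \<inter> U \<inter> S))"
    if T: "T \<in> Q" "card (T \<inter> S) = 3" and U: "U \<in> Q" "card (U \<inter> S) = 3" for T U
  proof -
    have "odd (card (T \<inter> S))" "odd (card (U \<inter> S))" using T U by auto
    then show ?thesis
      using odd_product_hamming[OF par[OF T(1)] par[OF U(1)]] unfolding card_S Int_iff by blast
  qed
  have trichotomy: "T \<inter> S = {} \<or> T \<subseteq> S \<or> card (T \<inter> S) = 3" if T: "T \<in> Q" for T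
  proof -
    have "T \<subseteq> S" if "card (T \<inter> S) = 4"
      using that card_quad[OF T] finite_quad[OF T] by (metis card_subset_eq inf.absorb_iff1 inf_le1)
    moreover have "T \<inter> S = {}" if "card (T \<inter> S) = 0" using that fS by simp
    ultimately show ?thesis using weights[OF T] by auto
  qed
  show ?thesis
  proof (cases "closed_set S")
    case True
    then show ?thesis using that[of S] cS by (auto simp: S_def)
  next
    case False
    then obtain T0 where T0: "T0 \<in> Q" "\<not> T0 \<subseteq> S" "T0 \<inter> S \<noteq> {}"
      using SV unfolding closed_set_def by auto
    then have l0: "card (T0 \<inter> S) = 3"
      using trichotomy by blast
    have one_out: "\<exists>z. T - S = {z}"
      if "T \<in> Q" "card (T \<inter> S) = 3" for T
    proof -
      have "card (T - S) = 1"
        using that(2) card_quad[OF that(1)] finite_quad[OF that(1)] by (simp add: card_Diff_subset_Int)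
      then show ?thesis by (auto simp: card_1_singleton_iff)
    qed
    obtain z where z: "T0 - S = {z}" using one_out T0 l0 by blast
    have "T \<subseteq> insert z S" if T: "T \<in> Q" "T \<inter> insert z S \<noteq> {}" for T
    proof (rule ccontr)
      assume nsub: "\<not> T \<subseteq> insert z S"
      have ev: "even (card (T \<inter> T0))" using even_Int T T0 by auto
      consider "T \<inter> S = {}"
        | "card (T \<inter> S) = 3"
        using trichotomy[OF T(1)] nsub by blast
      then show False
      proof cases
        case 1
        then have "T \<inter> T0 = {z}" using T(2) z by blast
        then show False using ev by simp
      next
        case 2
        obtain w where w: "T - S = {w}" using one_out T 2 by blast
        then have "w \<noteq> z" using nsub by auto
        then have "T \<inter> T0 = T \<inter> T0 \<inter> S" using w z by auto
        then show False using ev odd_Int[OF T(1) 2 T0(1) l0] by simp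
      qed
    qed
    moreover have "z \<in> V" "z \<notin> S" using z T0 quad_subset by auto
    ultimately have "closed_set (insert z S)" "card (insert z S) = 8"
      using SV cS fS by (auto simp: closed_set_def)
    then show ?thesis using that[of "insert z S"] by (auto simp: S_def)
  qed
qed

section \<open>Removing components and choosing a point of small degree\<close>

lemma even_quads_restrict:
  assumes C: "closed_set C"
  shows "even_quads (V - C) {q \<in> Q. q \<inter> C = {}}"
proof
  fix x assume "x \<in> V - C"
  then obtain q where q: "q \<in> Q" "x \<in> q" using covered by auto
  then have "q \<subseteq> C \<or> q \<inter> C = {}" using C by (simp add: closed_set_def)
  then show "\<exists>q\<in>{q \<in> Q. q \<inter> C = {}}. x \<in> q" using q \<open>x \<in> V - C\<close> by auto
next
  fix q r assume "q \<in> {q \<in> Q. q \<inter> C = {}}" "r \<in> {q \<in> Q. q \<inter> C = {}}" "card (q \<inter> r) = 2"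
  then show "sym_diff q r \<in> {q \<in> Q. q \<inter> C = {}}" using sym_diff_quad[of q r] by auto
qed (use finite_V quad_subset card_quad even_Int in auto)

lemma degree_restrict:
  assumes C: "closed_set C" and x: "x \<in> V - C"
  shows "even_quads.degree {q \<in> Q. q \<inter> C = {}} x = degree x"
proof -
  have "{q \<in> {q \<in> Q. q \<inter> C = {}}. x \<in> q} = {q \<in> Q. x \<in> q}"
    using C x by (auto simp: closed_set_def)
  then show ?thesis
    using even_quads.degree_def[OF even_quads_restrict[OF C]] by (simp add: degree_def)
qed

lemma card_closed_Diff:
  assumes "closed_set C"
  shows "card (V - C) = card V - card C" "card C \<le> card V"
proof -
  have "C \<subseteq> V" using assms by (simp add: closed_set_def)
  then show "card (V - C) = card V - card C" "card C \<le> card V"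
    using finite_V by (auto simp: card_Diff_subset finite_subset card_mono)
qed

text \<open>A twin gives the bound at once, so only the case without any twin in V needs an
  argument; there a component with 7 or 8 points is available.\<close>

lemma exists_small_degree_even:
  assumes ev: "even (card V)" and n: "4 \<le> card V" "card V \<noteq> 8"
  shows "\<exists>x\<in>V. 2 * degree x \<le> card V - 2"
proof (cases "\<exists>x\<in>V. has_twin x")
  case True
  then show ?thesis using degree_le_twin by auto
next
  case False
  obtain x where x: "x \<in> V" using n by fastforce
  then obtain C where C: "closed_set C" "x \<in> C" "card C = 7 \<or> card C = 8"
    using non_twin_component False by metis
  note D = card_closed_Diff[OF C(1)] degree_le_closed[OF C(1,2)]
  show ?thesis
  \<comment> \<open>Degree 4 suffices as soon as \<open>card V\<close> is at least 10, and degree 7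
    as soon as it is at least 16.\<close>
  proof (cases "card C = 7 \<or> card V \<ge> 16")
    case True
    have "card V \<ge> 10"
    proof -
      have "card V \<ge> 7" using D C by auto
      then show ?thesis using ev n by presburger
    qed
    then have "2 * degree x \<le> card V - 2" using True C(3) D(3) by auto
    then show ?thesis using x by auto
  next
    case F: False
    then have C8: "card C = 8" using C by auto
    then have n6: "card (V - C) \<le> 6" "card (V - C) > 0"
    proof -
      have "card V \<le> 14" using F ev by presburger
      then show "card (V - C) \<le> 6" using D C8 by simp
      show "card (V - C) > 0" using D C8 n by simp
    qed
    then obtain y where y: "y \<in> V - C" by (metis all_not_in_conv card.empty less_irrefl)
    interpret R: even_quads "V - C" "{q \<in> Q. q \<inter> C = {}}" by (rule even_quads_restrict[OF C(1)])
    \<comment> \<open>At most six points remain beside the component with 8 points, too few for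
      another component without twins.\<close>
    have "R.has_twin y"
    proof (rule ccontr)
      assume "\<not> R.has_twin y"
      then obtain C' where "R.closed_set C'" "card C' = 7 \<or> card C' = 8"
        using R.non_twin_component[OF y] by blast
      then show False using R.card_closed_Diff(2)[of C'] n6 by auto
    qed
    then have "2 * R.degree y \<le> card (V - C) - 2" using R.degree_le_twin y by auto
    then have "2 * degree y \<le> card V - 2" using degree_restrict[OF C(1) y] D by simp
    then show ?thesis using y by auto
  qed
qed

end

text \<open>An odd V has a point without twin. If its component has 8 points, deleting it keeps the
  number of points odd, and a component of the remainder is closed in V as well.\<close>

lemma exists_heptad_component:
  assumes "even_quads V Q" "odd (card V)"
  shows "\<exists>C. even_quads.closed_set V Q C \<and> card C = 7"
  using assms
proof (induction "card V" arbitrary: V Q rule: less_induct)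
  case less
  interpret even_quads V Q by fact
  obtain x where x: "x \<in> V" "\<not> has_twin x" using even_card_if_all_twins less by blast
  then obtain C where C: "closed_set C" "x \<in> C" "card C = 7 \<or> card C = 8"
    using non_twin_component by metis
  show ?case
  proof (cases "card C = 7")
    case True
    then show ?thesis using C by auto
  next
    case False
    then have C8: "card C = 8" using C by auto
    note D = card_closed_Diff[OF C(1)]
    interpret R: even_quads "V - C" "{q \<in> Q. q \<inter> C = {}}" by (rule even_quads_restrict[OF C(1)])
    have "card (V - C) < card V" "odd (card (V - C))" using D C8 less.prems by auto
    then obtain C' where C': "R.closed_set C'" "card C' = 7"
      using less.hyps R.even_quads_axioms by blast
    have C'V: "C' \<subseteq> V - C" using C'(1) by (simp add: R.closed_set_def)
    have "q \<subseteq> C' \<or> q \<inter> C' = {}" if q: "q \<in> Q" for q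
    proof (cases "q \<inter> C = {}")
      case True
      then show ?thesis using C'(1) q by (simp add: R.closed_set_def)
    next
      case False
      then have "q \<subseteq> C" using C(1) q by (auto simp: closed_set_def)
      then show ?thesis using C'V by auto
    qed
    then have "closed_set C'" using C'V by (auto simp: closed_set_def)
    then show ?thesis using C' by auto
  qed
qed

section \<open>Upper bounds for unbiased weighing matrices\<close>

lemma weighing_matrix_iff:
  "weighing_matrix d k W \<longleftrightarrow> W \<in> carrier_mat d d \<and> (\<forall>i<d. \<forall>j<d. W $$ (i, j) \<in> {-1, 0, 1}) \<and>
     (\<forall>i<d. \<forall>j<d. (\<Sum>l<d. W $$ (i, l) * W $$ (j, l)) = (if i = j then real k else 0))"
proof (cases "W \<in> carrier_mat d d")
  case True
  have "elements_mat W \<subseteq> {-1, 0, 1} \<longleftrightarrow> (\<forall>i<d. \<forall>j<d. W $$ (i, j) \<in> {-1, 0, 1})"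
  proof
    assume sub: "elements_mat W \<subseteq> {-1, 0, 1}"
    show "\<forall>i<d. \<forall>j<d. W $$ (i, j) \<in> {-1, 0, 1}"
    proof (intro allI impI)
      fix i j assume "i < d" "j < d"
      then have "W $$ (i, j) \<in> elements_mat W" using True by (intro elements_matI) auto
      then show "W $$ (i, j) \<in> {-1, 0, 1}" using sub by blast
    qed
  qed (use True in \<open>auto dest!: elements_matD\<close>)
  moreover have "W * W\<^sup>T = of_nat k \<cdot>\<^sub>m 1\<^sub>m d \<longleftrightarrow>
     (\<forall>i<d. \<forall>j<d. (\<Sum>l<d. W $$ (i, l) * W $$ (j, l)) = (if i = j then real k else 0))"
    using True by (auto simp: mat_eq_iff scalar_prod_def atLeast0LessThan)
  ultimately show ?thesis using True by (simp add: weighing_matrix_def)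
qed (simp add: weighing_matrix_def)

text \<open>For a square matrix the right inverse
  \<open>(1 / real k) \<cdot>\<^sub>m W\<^sup>T\<close> is also a left inverse, so the norms of the
  rows carry over to the columns.\<close>

lemma weighing_matrix_column:
  assumes W: "weighing_matrix d k W" and "k > 0" and x: "x < d"
  shows "(\<Sum>l<d. W $$ (l, x) * W $$ (l, x)) = real k"
proof -
  have Wc: "W \<in> carrier_mat d d" and "W * W\<^sup>T = of_nat k \<cdot>\<^sub>m 1\<^sub>m d"
    using W by (auto simp: weighing_matrix_def)
  then have "W * ((1 / real k) \<cdot>\<^sub>m W\<^sup>T) = (1 / real k) \<cdot>\<^sub>m (real k \<cdot>\<^sub>m 1\<^sub>m d)"
    by (subst mult_smult_distrib[of _ d d _ d]) auto
  also have "\<dots> = 1\<^sub>m d" using \<open>k > 0\<close> by (intro eq_matI) auto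
  finally have "((1 / real k) \<cdot>\<^sub>m W\<^sup>T) * W = 1\<^sub>m d"
    by (intro mat_mult_left_right_inverse[of W]) (use Wc in auto)
  then have "(((1 / real k) \<cdot>\<^sub>m W\<^sup>T) * W) $$ (x, x) = 1" using x by simp
  then have "(\<Sum>l<d. 1 / real k * W $$ (l, x) * W $$ (l, x)) = 1"
    using Wc x by (simp add: scalar_prod_def atLeast0LessThan)
  then have "1 / real k * (\<Sum>l<d. W $$ (l, x) * W $$ (l, x)) = 1"
    by (simp add: sum_distrib_left mult.assoc)
  then show ?thesis using \<open>k > 0\<close> by (simp add: field_simps)
qed

lemma unbiased_weight4_entries:
  assumes "unbiased d 4 W W'" "W \<in> carrier_mat d d" "W' \<in> carrier_mat d d" "i < d" "j < d"
  shows "(\<Sum>l<d. W $$ (i, l) * W' $$ (j, l)) \<in> {-2, 0, 2}"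
proof -
  have "((1 / sqrt (real 4)) \<cdot>\<^sub>m (W * W'\<^sup>T)) $$ (i, j) \<in> {-1, 0, 1}"
    using assms unfolding unbiased_def weighing_matrix_iff by blast
  then show ?thesis using assms by (auto simp: scalar_prod_def atLeast0LessThan)
qed

text \<open>Modulo 2 every entry 1 or -1 counts as 1: f is the indicator of its support minus twice
  the indicator of the value -1.\<close>

lemma even_card_nonzero:
  fixes f :: "'a \<Rightarrow> real"
  assumes A: "finite A" and f: "\<And>l. l \<in> A \<Longrightarrow> f l \<in> {-1, 0, 1}" and s: "sum f A = 2 * of_int m"
  shows "even (card {l \<in> A. f l \<noteq> 0})"
proof -
  have "sum f A = (\<Sum>l\<in>A. of_bool (f l \<noteq> 0) - 2 * of_bool (f l = -1))"
    by (rule sum.cong) (use f in auto)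
  also have "\<dots> = (\<Sum>l\<in>A. of_bool (f l \<noteq> 0)) - 2 * (\<Sum>l\<in>A. of_bool (f l = -1))"
    by (simp only: sum_subtractf sum_distrib_left)
  also have "\<dots> = real (card {l \<in> A. f l \<noteq> 0}) - 2 * real (card {l \<in> A. f l = -1})"
    using A by (simp add: sum.If_cases of_bool_def Int_def)
  finally have "of_int (int (card {l \<in> A. f l \<noteq> 0})) =
      (of_int (2 * m + 2 * int (card {l \<in> A. f l = -1})) :: real)"
    using s by simp
  then have "int (card {l \<in> A. f l \<noteq> 0}) = 2 * m + 2 * int (card {l \<in> A. f l = -1})"
    by (simp only: of_int_eq_iff)
  then show ?thesis by presburger
qed

lemma card_sym_diff:
  assumes "finite A" "finite B"
  shows "card (sym_diff A B) + 2 * card (A \<inter> B) = card A + card B"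
proof -
  have "card (sym_diff A B) = card (A - B) + card (B - A)"
    by (rule card_Un_disjoint) (use assms in auto)
  moreover have "card A = card (A - B) + card (A \<inter> B)" "card B = card (B - A) + card (A \<inter> B)"
    using assms by (metis card_Int_Diff add.commute Int_commute)+
  ultimately show ?thesis by simp
qed

text \<open>Passing to the double dual with respect to even intersection closes a family of 4-sets
  under symmetric differences without losing pairwise even intersections.\<close>

lemma even_quads_double_dual:
  fixes V :: "'a set"
  assumes V: "finite V" and sub: "\<And>q. q \<in> F \<Longrightarrow> q \<subseteq> V" and card4: "\<And>q. q \<in> F \<Longrightarrow> card q = 4"
    and ev: "\<And>q r. q \<in> F \<Longrightarrow> r \<in> F \<Longrightarrow> even (card (q \<inter> r))"
    and cov: "\<And>x. x \<in> V \<Longrightarrow> \<exists>q\<in>F. x \<in> q"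
  obtains Q where "F \<subseteq> Q" "even_quads V Q"
proof
  \<comment> \<open>P is the dual code of F inside V, and Q consists of the words of weight 4 in the
    double dual. Linearity of the double dual gives closure under symmetric differences.\<close>
  define P where "P = {p. p \<subseteq> V \<and> (\<forall>q\<in>F. even (card (p \<inter> q)))}"
  define Q where "Q = {q. q \<subseteq> V \<and> card q = 4 \<and> (\<forall>p\<in>P. even (card (p \<inter> q)))}"
  show FQ: "F \<subseteq> Q" using sub card4 by (auto simp: Q_def P_def)
  have FP: "F \<subseteq> P" using sub ev by (auto simp: P_def)
  \<comment> \<open>Self-orthogonality of F puts F into its dual; dualizing puts the double dual
    into the dual, so words of Q are orthogonal to one another.\<close>
  have QP: "Q \<subseteq> P"
  proof
    fix q assume "q \<in> Q"
    then have "q \<subseteq> V" "\<And>r. r \<in> F \<Longrightarrow> even (card (r \<inter> q))" using FP by (auto simp: Q_def)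
    then show "q \<in> P" by (auto simp: P_def Int_commute)
  qed
  show "even_quads V Q"
  proof
    fix q r assume q: "q \<in> Q" and r: "r \<in> Q" and c: "card (q \<inter> r) = 2"
    have fin: "finite q" "finite r" using q r V finite_subset by (auto simp: Q_def)
    have "card (sym_diff q r) = 4" using card_sym_diff[OF fin] c q r by (simp add: Q_def)
    moreover have "even (card (p \<inter> sym_diff q r))" if "p \<in> P" for p
    proof -
      have "p \<inter> sym_diff q r = sym_diff (p \<inter> q) (p \<inter> r)" by auto
      moreover have "even (card (p \<inter> q) + card (p \<inter> r))" using q r that by (auto simp: Q_def)
      ultimately show ?thesis using card_sym_diff[of "p \<inter> q" "p \<inter> r"] fin
        by (metis dvd_add_left_iff dvd_triv_left finite_Int)
    qed
    moreover have "sym_diff q r \<subseteq> V" using q r by (auto simp: Q_def)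
    ultimately show "sym_diff q r \<in> Q" by (simp add: Q_def)
  next
    fix q r assume "q \<in> Q" "r \<in> Q"
    then show "even (card (q \<inter> r))" using QP by (auto simp: Q_def)
  next
    fix x assume "x \<in> V"
    then show "\<exists>q\<in>Q. x \<in> q" using cov FQ by blast
  qed (use V in \<open>auto simp: Q_def\<close>)
qed

definition row_support :: "nat \<Rightarrow> real mat \<Rightarrow> nat \<Rightarrow> nat set" where
  "row_support d W i = {l. l < d \<and> W $$ (i, l) \<noteq> 0}"

lemma card_nonzero_eq_sum_squares:
  fixes f :: "'a \<Rightarrow> real"
  assumes "finite A" "\<And>l. l \<in> A \<Longrightarrow> f l \<in> {-1, 0, 1}"
  shows "real (card {l \<in> A. f l \<noteq> 0}) = (\<Sum>l\<in>A. f l * f l)"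
proof -
  have "f l * f l = of_bool (f l \<noteq> 0)" if "l \<in> A" for l using assms(2)[OF that] by auto
  then have "(\<Sum>l\<in>A. f l * f l) = (\<Sum>l\<in>A. of_bool (f l \<noteq> 0))" by (rule sum.cong[OF refl])
  then show ?thesis using assms(1) by (simp add: of_bool_def sum.If_cases Int_def)
qed

text \<open>This is the bridge from matrices to 4-sets: supports meet evenly because every inner
  product of two rows is an even integer, and the number of matrices is bounded by counting the rows
  that are nonzero in a fixed column.\<close>

lemma MUWM_weight4_quads:
  assumes S: "finite S" "S \<noteq> {}" "MUWM d 4 S"
  obtains Q where "even_quads {..<d} Q" "\<And>x. x < d \<Longrightarrow> card S \<le> 2 * card {q \<in> Q. x \<in> q}"
proof -
  have wm: "weighing_matrix d 4 W" if "W \<in> S" for W using S that by (auto simp: MUWM_def)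
  have ub: "unbiased d 4 W W'" if "W \<in> S" "W' \<in> S" "W \<noteq> W'" for W W'
    using S that by (auto simp: MUWM_def pairwise_def)
  have ent: "W $$ (i, l) \<in> {-1, 0, 1}" if "W \<in> S" "i < d" "l < d" for W i l
    using wm[OF that(1)] that(2,3) unfolding weighing_matrix_iff by blast
  have dot: "(\<Sum>l<d. W $$ (i, l) * W $$ (j, l)) = (if i = j then 4 else 0)"
    if "W \<in> S" "i < d" "j < d" for W i j
    using wm[OF that(1)] that(2,3) unfolding weighing_matrix_iff by simp
  have dot': "(\<Sum>l<d. W $$ (i, l) * W' $$ (j, l)) \<in> {-2, 0, 2}"
    if "W \<in> S" "W' \<in> S" "W \<noteq> W'" "i < d" "j < d" for W W' i j
    using unbiased_weight4_entries[OF ub] that wm by (auto simp: weighing_matrix_iff)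
  have supp4: "card (row_support d W i) = 4" if "W \<in> S" "i < d" for W i
  proof -
    have "real (card {l \<in> {..<d}. W $$ (i, l) \<noteq> 0}) = 4"
      using card_nonzero_eq_sum_squares[of "{..<d}" "\<lambda>l. W $$ (i, l)"] ent[OF that] dot[of W i i] that
      by simp
    then show ?thesis by (simp add: row_support_def)
  qed
  have col4: "card {i. i < d \<and> W $$ (i, x) \<noteq> 0} = 4" if "W \<in> S" "x < d" for W x
  proof -
    have "real (card {i \<in> {..<d}. W $$ (i, x) \<noteq> 0}) = 4"
      using card_nonzero_eq_sum_squares[of "{..<d}" "\<lambda>i. W $$ (i, x)"] ent[of W _ x]
        weighing_matrix_column[OF wm, of W x] that by simp
    then show ?thesis by simp
  qed
  define F where "F = {row_support d W i | W i. W \<in> S \<and> i < d}"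
  have evF: "even (card (q \<inter> r))" if q: "q \<in> F" and r: "r \<in> F" for q r
  proof -
    obtain W i W' j where W: "W \<in> S" "i < d" "q = row_support d W i"
      and W': "W' \<in> S" "j < d" "r = row_support d W' j"
      using q r by (auto simp: F_def)
    \<comment> \<open>Within one matrix the inner product is 0 or 4; between two unbiased ones it is
      0, 2 or -2.\<close>
    have "\<exists>m::int. (\<Sum>l<d. W $$ (i, l) * W' $$ (j, l)) = 2 * of_int m"
    proof (cases "W = W'")
      case True
      then show ?thesis using dot[OF W(1,2) W'(2)] by (intro exI[of _ "if i = j then 2 else 0"]) simp
    next
      case False
      then have "(\<Sum>l<d. W $$ (i, l) * W' $$ (j, l)) \<in> {-2, 0, 2}" using dot' W W' by blast
      then show ?thesis
        by (intro exI[of _ "\<lfloor>(\<Sum>l<d. W $$ (i, l) * W' $$ (j, l)) / 2\<rfloor>"]) auto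
    qed
    then obtain m :: int where "(\<Sum>l<d. W $$ (i, l) * W' $$ (j, l)) = 2 * of_int m" by blast
    moreover have "W $$ (i, l) * W' $$ (j, l) \<in> {-1, 0, 1}" if "l \<in> {..<d}" for l
      using ent[OF W(1,2), of l] ent[OF W'(1,2), of l] that by auto
    ultimately have "even (card {l \<in> {..<d}. W $$ (i, l) * W' $$ (j, l) \<noteq> 0})"
      by (intro even_card_nonzero) auto
    moreover have "{l \<in> {..<d}. W $$ (i, l) * W' $$ (j, l) \<noteq> 0} = q \<inter> r"
      by (auto simp: W W' row_support_def)
    ultimately show ?thesis by simp
  qed
  have covF: "\<exists>q\<in>F. x \<in> q" if "x \<in> {..<d}" for x
  proof -
    obtain W where W: "W \<in> S" using S by auto
    have "card {i. i < d \<and> W $$ (i, x) \<noteq> 0} \<noteq> 0" using col4 W that by simp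
    then have "{i. i < d \<and> W $$ (i, x) \<noteq> 0} \<noteq> {}" by (metis card.empty)
    then obtain i where "i < d" "W $$ (i, x) \<noteq> 0" by blast
    then have "row_support d W i \<in> F" "x \<in> row_support d W i"
      using W that unfolding F_def by (blast, simp add: row_support_def)
    then show ?thesis by blast
  qed
  obtain Q where Q: "F \<subseteq> Q" "even_quads {..<d} Q"
  proof (rule even_quads_double_dual[of "{..<d}" F])
    show "q \<subseteq> {..<d}" if "q \<in> F" for q using that by (auto simp: F_def row_support_def)
    show "card q = 4" if "q \<in> F" for q using that supp4 by (auto simp: F_def)
  qed (use evF covF in auto)
  interpret even_quads "{..<d}" Q by (rule Q)
  have "card S \<le> 2 * card {q \<in> Q. x \<in> q}" if x: "x < d" for x
  proof -
    define N where "N = (SIGMA W:S. {i. i < d \<and> W $$ (i, x) \<noteq> 0})"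
    define T where "T = (SIGMA q:{q \<in> Q. x \<in> q}. Pow (q - {x}))"
    \<comment> \<open>A row is recorded up to sign by its support and by the other columns in which
      its entry agrees with the entry at x. For a given support there are at most 2^3 such
      records.\<close>
    define h where "h = (\<lambda>(W :: real mat, i). (row_support d W i, {l \<in> row_support d W i. W $$ (i, l) = W $$ (i, x)} - {x}))"
    have "card N = 4 * card S"
      using S col4 x by (simp add: N_def)
    moreover have "card T = 8 * card {q \<in> Q. x \<in> q}"
    proof -
      have "card T = (\<Sum>q\<in>{q \<in> Q. x \<in> q}. card (Pow (q - {x})))"
        unfolding T_def by (rule card_SigmaI) (use finite_Q finite_quad in auto)
      also have "\<dots> = (\<Sum>q\<in>{q \<in> Q. x \<in> q}. 8)"
        by (rule sum.cong) (use card_quad finite_quad in \<open>auto simp: card_Pow\<close>)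
      finally show ?thesis by simp
    qed
    moreover have "card N \<le> card T"
    proof (rule card_inj_on_le)
      show "finite T" using finite_Q finite_quad by (auto simp: T_def)
      have "row_support d W i \<in> Q" if "W \<in> S" "i < d" for W i using Q that by (auto simp: F_def)
      then show "h ` N \<subseteq> T" using x by (auto simp: N_def T_def h_def row_support_def)
      show "inj_on h N"
      proof (rule inj_onI)
        fix p p' assume p: "p \<in> N" "p' \<in> N" "h p = h p'"
        obtain W i W' j where pW: "p = (W, i)" "p' = (W', j)" by fastforce
        have W: "W \<in> S" "i < d" "W $$ (i, x) \<noteq> 0" and W': "W' \<in> S" "j < d" "W' $$ (j, x) \<noteq> 0"
          using p pW by (auto simp: N_def)
        define s where "s = W $$ (i, x) * W' $$ (j, x)"
        have s: "s \<in> {-1, 1}" unfolding s_def using ent[OF W(1,2) x] ent[OF W'(1,2) x] W(3) W'(3) by auto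
        have supp: "row_support d W i = row_support d W' j"
          and same: "{l \<in> row_support d W i. W $$ (i, l) = W $$ (i, x)} - {x} =
             {l \<in> row_support d W' j. W' $$ (j, l) = W' $$ (j, x)} - {x}"
          using p pW by (auto simp: h_def)
        \<comment> \<open>Equal records force the two rows to agree up to the global sign s, so that
          their inner product is 4 or -4.\<close>
        have prod: "W $$ (i, l) * W' $$ (j, l) = s * (W $$ (i, l) * W $$ (i, l))" if l: "l < d" for l
        proof (cases "W $$ (i, l) = 0")
          case False
          then have "W' $$ (j, l) \<noteq> 0" using supp l by (auto simp: row_support_def set_eq_iff)
          moreover have "W $$ (i, l) = W $$ (i, x) \<longleftrightarrow> W' $$ (j, l) = W' $$ (j, x)"
          proof (cases "l = x")
            case lx: False
            have "l \<in> row_support d W i" "l \<in> row_support d W' j"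
              using False \<open>W' $$ (j, l) \<noteq> 0\<close> l by (auto simp: row_support_def)
            then show ?thesis using same lx by blast
          qed simp
          ultimately show ?thesis
            using False ent[OF W(1,2) l] ent[OF W'(1,2) l] ent[OF W(1,2) x] ent[OF W'(1,2) x] W(3) W'(3)
            by (auto simp: s_def)
        qed simp
        have "(\<Sum>l<d. W $$ (i, l) * W' $$ (j, l)) = (\<Sum>l<d. s * (W $$ (i, l) * W $$ (i, l)))"
          by (rule sum.cong) (use prod in auto)
        also have "\<dots> = s * 4" using dot[OF W(1,2,2)] by (simp flip: sum_distrib_left)
        finally have sum4: "(\<Sum>l<d. W $$ (i, l) * W' $$ (j, l)) \<in> {-4, 4}" using s by auto
        have "W = W'"
        proof (rule ccontr)
          assume "W \<noteq> W'"
          then show False using dot'[OF W(1) W'(1) _ W(2) W'(2)] sum4 by auto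
        qed
        moreover have "i = j"
        proof (rule ccontr)
          assume "i \<noteq> j"
          then show False using dot[OF W(1,2) W'(2)] sum4 \<open>W = W'\<close> by auto
        qed
        ultimately show "p = p'" using pW by simp
      qed
    qed
    ultimately show ?thesis by simp
  qed
  then show ?thesis using that Q by blast
qed

section \<open>Bounds by order: even, 8, odd\<close>

lemma card_MUWM_even:
  assumes S: "finite S" "MUWM d 4 S" and d: "even d" "4 \<le> d" "d \<noteq> 8"
  shows "card S \<le> d - 2"
proof (cases "S = {}")
  case False
  obtain Q where Q: "even_quads {..<d} Q" "\<And>x. x < d \<Longrightarrow> card S \<le> 2 * card {q \<in> Q. x \<in> q}"
    using MUWM_weight4_quads[OF S(1) False S(2)] by blast
  interpret even_quads "{..<d}" Q by (rule Q)
  obtain x where "x < d" "2 * degree x \<le> d - 2" using exists_small_degree_even d by auto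
  then show ?thesis using Q(2)[of x] by (simp add: degree_def)
qed simp

lemma card_MUWM_8:
  assumes S: "finite S" "MUWM 8 4 S"
  shows "card S \<le> 14"
proof (cases "S = {}")
  case False
  obtain Q where Q: "even_quads {..<8 :: nat} Q" "\<And>x. x < 8 \<Longrightarrow> card S \<le> 2 * card {q \<in> Q. x \<in> q}"
    using MUWM_weight4_quads[OF S(1) False S(2)] by blast
  interpret even_quads "{..<8 :: nat}" Q by (rule Q)
  have "3 * degree 0 \<le> 21" using degree_le_closed[OF closed_V, of 0] by simp
  then show ?thesis using Q(2)[of 0] by (simp add: degree_def)
qed simp

text \<open>A point of a component with 7 columns has degree at most 4, hence at most 8 matrices.
  The other d - 7 columns again carry an even family: for d = 9 the two columns left cannot hold a
  4-set, while for d = 11 and 13 the even bound applies to 4 and 6 columns and gives d - 7 -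
  2.\<close>

lemma card_MUWM_odd:
  assumes S: "finite S" "MUWM d 4 S" "S \<noteq> {}" and d: "odd d"
  shows "7 \<le> d" "d \<noteq> 9" "card S \<le> 8" "d = 11 \<or> d = 13 \<Longrightarrow> card S \<le> d - 9"
proof -
  obtain Q where Q: "even_quads {..<d} Q" "\<And>x. x < d \<Longrightarrow> card S \<le> 2 * card {q \<in> Q. x \<in> q}"
    using MUWM_weight4_quads[OF S(1,3,2)] by blast
  interpret even_quads "{..<d}" Q by (rule Q)
  obtain C where C: "closed_set C" "card C = 7"
    using exists_heptad_component[OF Q(1)] d by auto
  note D = card_closed_Diff[OF C(1)]
  show "7 \<le> d" using D C by simp
  have CV: "C \<subseteq> {..<d}" using C by (simp add: closed_set_def)
  obtain x where x: "x \<in> C" using C by fastforce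
  have "3 * degree x \<le> 12" using degree_le_closed[OF C(1) x] C by simp
  then show "card S \<le> 8" using Q(2)[of x] x CV by (auto simp: degree_def)
  interpret R: even_quads "{..<d} - C" "{q \<in> Q. q \<inter> C = {}}" by (rule even_quads_restrict[OF C(1)])
  have cR: "card ({..<d} - C) = d - 7" using D C by simp
  show "d \<noteq> 9"
  proof
    assume "d = 9"
    then have c2: "card ({..<d} - C) = 2" using cR by simp
    then obtain y where "y \<in> {..<d} - C" by (metis all_not_in_conv card.empty zero_neq_numeral)
    then obtain q where "q \<subseteq> {..<d} - C" "card q = 4"
      using R.covered R.quad_subset R.card_quad by meson
    then show False using c2 card_mono[of "{..<d} - C" q] by simp
  qed
  show "card S \<le> d - 9" if d': "d = 11 \<or> d = 13"
  proof -
    have "even (d - 7)" "4 \<le> d - 7" "d - 7 \<noteq> 8" using d' by auto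
    then obtain y where y: "y \<in> {..<d} - C" "2 * R.degree y \<le> d - 7 - 2"
      using R.exists_small_degree_even unfolding cR by blast
    then have "2 * degree y \<le> d - 9" using degree_restrict[OF C(1) y(1)] by simp
    then show ?thesis using Q(2)[of y] y by (simp add: degree_def)
  qed
qed

section \<open>Lattice bases and frames\<close>

lemma int_span_iff:
  assumes S: "S \<subseteq> carrier_vec n"
  shows "x \<in> int_span n S \<longleftrightarrow> x \<in> carrier_vec n \<and>
    (\<exists>(c :: real vec \<Rightarrow> int) A. finite A \<and> A \<subseteq> S \<and> (\<forall>i<n. x $ i = (\<Sum>u\<in>A. of_int (c u) * u $ i)))"
    (is "?l \<longleftrightarrow> ?r")
proof -
  interpret vec_space "TYPE(real)" n .
  show ?thesis
  proof
    assume ?l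
    then obtain c :: "real vec \<Rightarrow> int" and A where A: "finite A" "A \<subseteq> S" "x = lincomb (\<lambda>u. of_int (c u)) A"
      by (auto simp: int_span_def)
    then have "x $ i = (\<Sum>u\<in>A. of_int (c u) * u $ i)" if "i < n" for i
      using lincomb_index[OF that, of A] S by auto
    moreover have "x \<in> carrier_vec n" using A S lincomb_dim[of A "\<lambda>u. of_int (c u)"] by auto
    ultimately show ?r using A by blast
  next
    assume ?r
    then obtain c :: "real vec \<Rightarrow> int" and A where x: "x \<in> carrier_vec n" and A: "finite A" "A \<subseteq> S"
      "\<forall>i<n. x $ i = (\<Sum>u\<in>A. of_int (c u) * u $ i)" by blast
    have AC: "A \<subseteq> carrier_vec n" using A S by auto
    have "x = lincomb (\<lambda>u. of_int (c u)) A"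
      by (rule eq_vecI) (use x A lincomb_index[OF _ AC] lincomb_dim[OF A(1) AC] in auto)
    then show ?l using A unfolding int_span_def by blast
  qed
qed

definition additive_subgroup :: "nat \<Rightarrow> real vec set \<Rightarrow> bool" where
  "additive_subgroup n L \<longleftrightarrow> L \<subseteq> carrier_vec n \<and> 0\<^sub>v n \<in> L \<and> (\<forall>x\<in>L. \<forall>y\<in>L. x + y \<in> L) \<and>
     (\<forall>x\<in>L. \<forall>c::int. of_int c \<cdot>\<^sub>v x \<in> L)"

lemma int_span_least:
  assumes L: "additive_subgroup n L" and S: "S \<subseteq> L"
  shows "int_span n S \<subseteq> L"
proof
  fix x assume x: "x \<in> int_span n S"
  have SC: "S \<subseteq> carrier_vec n" using assms by (auto simp: additive_subgroup_def)
  obtain c :: "real vec \<Rightarrow> int" and A where xc: "x \<in> carrier_vec n" and A: "finite A" "A \<subseteq> S"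
    "\<forall>i<n. x $ i = (\<Sum>u\<in>A. of_int (c u) * u $ i)" using x unfolding int_span_iff[OF SC] by blast
  have "vec n (\<lambda>i. \<Sum>u\<in>A. of_int (c u) * u $ i) \<in> L" using A(1,2)
  proof (induction A rule: finite_induct)
    case empty
    have "vec n (\<lambda>i. \<Sum>u\<in>{}. of_int (c u) * u $ i) = (0\<^sub>v n :: real vec)" by (rule eq_vecI) auto
    then show ?case using L by (simp add: additive_subgroup_def)
  next
    case (insert u A)
    have "vec n (\<lambda>i. \<Sum>u\<in>insert u A. of_int (c u) * u $ i) =
      of_int (c u) \<cdot>\<^sub>v u + vec n (\<lambda>i. \<Sum>u\<in>A. of_int (c u) * u $ i)"
      by (rule eq_vecI) (use insert SC in auto)
    then show ?case using L S insert by (auto simp: additive_subgroup_def)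
  qed
  moreover have "x = vec n (\<lambda>i. \<Sum>u\<in>A. of_int (c u) * u $ i)"
    by (rule eq_vecI) (use xc A in auto)
  ultimately show "x \<in> L" by simp
qed

lemma int_span_superset:
  assumes S: "S \<subseteq> carrier_vec n"
  shows "S \<subseteq> int_span n S"
proof
  fix x assume "x \<in> S"
  then show "x \<in> int_span n S" unfolding int_span_iff[OF S]
    using S by (intro conjI exI[of _ "\<lambda>_. 1"] exI[of _ "{x}"]) auto
qed

lemma additive_subgroup_int_span:
  assumes S: "S \<subseteq> carrier_vec n"
  shows "additive_subgroup n (int_span n S)"
  unfolding additive_subgroup_def
proof (intro conjI ballI allI)
  show "int_span n S \<subseteq> carrier_vec n" using int_span_iff[OF S] by auto
  show "0\<^sub>v n \<in> int_span n S" unfolding int_span_iff[OF S]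
    by (intro conjI exI[of _ "\<lambda>_. 0"] exI[of _ "{}"]) auto
next
  fix x y assume "x \<in> int_span n S" "y \<in> int_span n S"
  then obtain c A e B where xc: "x \<in> carrier_vec n" and A: "finite A" "A \<subseteq> S"
    "\<forall>i<n. x $ i = (\<Sum>u\<in>A. of_int (c u) * u $ i)" and
    yc: "y \<in> carrier_vec n" and B: "finite B" "B \<subseteq> S"
    "\<forall>i<n. y $ i = (\<Sum>u\<in>B. of_int (e u) * u $ i)" unfolding int_span_iff[OF S] by blast
  define c' where "c' = (\<lambda>u. if u \<in> A then c u else 0)"
  define e' where "e' = (\<lambda>u. if u \<in> B then e u else 0)"
  have "x $ i = (\<Sum>u\<in>A \<union> B. of_int (c' u) * u $ i)" if "i < n" for i
    using A B that by (auto simp: c'_def intro!: sum.mono_neutral_cong_left)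
  moreover have "y $ i = (\<Sum>u\<in>A \<union> B. of_int (e' u) * u $ i)" if "i < n" for i
    using A B that by (auto simp: e'_def intro!: sum.mono_neutral_cong_left)
  ultimately have "(x + y) $ i = (\<Sum>u\<in>A \<union> B. of_int (c' u + e' u) * u $ i)" if "i < n" for i
    using that xc yc by (simp add: sum.distrib algebra_simps)
  then show "x + y \<in> int_span n S" unfolding int_span_iff[OF S]
    using A B xc yc by (intro conjI exI[of _ "\<lambda>u. c' u + e' u"] exI[of _ "A \<union> B"]) auto
next
  fix x and k :: int assume "x \<in> int_span n S"
  then obtain c A where xc: "x \<in> carrier_vec n" and A: "finite A" "A \<subseteq> S"
    "\<forall>i<n. x $ i = (\<Sum>u\<in>A. of_int (c u) * u $ i)" unfolding int_span_iff[OF S] by blast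
  then show "of_int k \<cdot>\<^sub>v x \<in> int_span n S" unfolding int_span_iff[OF S]
    by (intro conjI exI[of _ "\<lambda>u. k * c u"] exI[of _ A]) (auto simp: sum_distrib_left mult.assoc)
qed

text \<open>Bases as sequences with coordinatewise sums, so that changes of basis and orthogonal
  sums become computations with indices. The ambient dimension n is kept apart from the rank d
  because E_7 is given in dimension 8.\<close>

definition lattice_basis :: "nat \<Rightarrow> nat \<Rightarrow> real vec set \<Rightarrow> (nat \<Rightarrow> real vec) \<Rightarrow> bool" where
  "lattice_basis n d L b \<longleftrightarrow> (\<forall>k<d. b k \<in> carrier_vec n) \<and>
     (\<forall>r :: nat \<Rightarrow> real. (\<forall>i<n. (\<Sum>k<d. r k * b k $ i) = 0) \<longrightarrow> (\<forall>k<d. r k = 0)) \<and>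
     L = {x \<in> carrier_vec n. \<exists>c :: nat \<Rightarrow> int. \<forall>i<n. x $ i = (\<Sum>k<d. of_int (c k) * b k $ i)}"

lemma lattice_basis_carrier: "lattice_basis n d L b \<Longrightarrow> k < d \<Longrightarrow> b k \<in> carrier_vec n"
  unfolding lattice_basis_def by blast

lemma lattice_basis_eq:
  "lattice_basis n d L b \<Longrightarrow>
    L = {x \<in> carrier_vec n. \<exists>c :: nat \<Rightarrow> int. \<forall>i<n. x $ i = (\<Sum>k<d. of_int (c k) * b k $ i)}"
  unfolding lattice_basis_def by (elim conjE)

lemma lattice_basis_indep:
  assumes "lattice_basis n d L b" "\<And>i. i < n \<Longrightarrow> (\<Sum>k<d. r k * b k $ i) = 0" "k < d"
  shows "r k = (0 :: real)"
proof -
  have "(\<forall>i<n. (\<Sum>k<d. r k * b k $ i) = 0) \<longrightarrow> (\<forall>k<d. r k = 0)"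
    using assms(1) unfolding lattice_basis_def by (elim conjE allE)
  then show ?thesis using assms(2,3) by simp
qed

lemma int_span_indexed:
  assumes b: "bij_betw b {..<d} B" and B: "B \<subseteq> carrier_vec n"
  shows "int_span n B = {x \<in> carrier_vec n. \<exists>c :: nat \<Rightarrow> int. \<forall>i<n. x $ i = (\<Sum>k<d. of_int (c k) * b k $ i)}"
proof (intro Set.set_eqI iffI)
  fix x assume "x \<in> int_span n B"
  then obtain c A where xc: "x \<in> carrier_vec n" and A: "finite A" "A \<subseteq> B"
    "\<forall>i<n. x $ i = (\<Sum>u\<in>A. of_int (c u) * u $ i)" unfolding int_span_iff[OF B] by blast
  define c' where "c' = (\<lambda>u. if u \<in> A then c u else 0)"
  have fB: "finite B" using b bij_betw_finite by blast
  have "x $ i = (\<Sum>k<d. of_int (c' (b k)) * b k $ i)" if "i < n" for i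
  proof -
    have "x $ i = (\<Sum>u\<in>B. of_int (c' u) * u $ i)"
      using A that fB by (auto simp: c'_def intro!: sum.mono_neutral_cong_left)
    also have "\<dots> = (\<Sum>k<d. of_int (c' (b k)) * b k $ i)"
      by (rule sum.reindex_bij_betw[OF b, symmetric])
    finally show ?thesis .
  qed
  then show "x \<in> {x \<in> carrier_vec n. \<exists>c :: nat \<Rightarrow> int. \<forall>i<n. x $ i = (\<Sum>k<d. of_int (c k) * b k $ i)}"
    using xc by (intro CollectI conjI exI[of _ "\<lambda>k. c' (b k)"]) auto
next
  fix x assume "x \<in> {x \<in> carrier_vec n. \<exists>c :: nat \<Rightarrow> int. \<forall>i<n. x $ i = (\<Sum>k<d. of_int (c k) * b k $ i)}"
  then obtain c :: "nat \<Rightarrow> int" where xc: "x \<in> carrier_vec n"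
    and c: "\<forall>i<n. x $ i = (\<Sum>k<d. of_int (c k) * b k $ i)" by blast
  have inj: "inj_on b {..<d}" and im: "b ` {..<d} = B" using b by (auto simp: bij_betw_def)
  define c' where "c' = (\<lambda>u. c (the_inv_into {..<d} b u))"
  have "x $ i = (\<Sum>u\<in>B. of_int (c' u) * u $ i)" if "i < n" for i
  proof -
    have "(\<Sum>u\<in>B. of_int (c' u) * u $ i) = (\<Sum>k<d. of_int (c' (b k)) * b k $ i)"
      by (rule sum.reindex_bij_betw[OF b, symmetric])
    also have "\<dots> = (\<Sum>k<d. of_int (c k) * b k $ i)"
      by (rule sum.cong) (use inj in \<open>auto simp: c'_def the_inv_into_f_f\<close>)
    finally show ?thesis using c that by simp
  qed
  then show "x \<in> int_span n B" unfolding int_span_iff[OF B]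
    using xc b bij_betw_finite by (intro conjI exI[of _ c'] exI[of _ B]) auto
qed

lemma lattice_of_rank_basisD:
  assumes "lattice_of_rank n d L"
  obtains b where "lattice_basis n d L b"
proof -
  interpret vec_space "TYPE(real)" n .
  obtain B where B: "B \<subseteq> carrier_vec n" "finite B" "card B = d" "lin_indpt B" "L = int_span n B"
    using assms unfolding lattice_of_rank_def by blast
  obtain b where b: "bij_betw b {..<d} B" using B ex_bij_betw_nat_finite[of B] by (auto simp: atLeast0LessThan)
  have inj: "inj_on b {..<d}" and im: "b ` {..<d} = B" using b by (auto simp: bij_betw_def)
  have "r k = 0" if r: "\<forall>i<n. (\<Sum>k<d. r k * b k $ i) = 0" and k: "k < d" for r :: "nat \<Rightarrow> real" and k
  proof (rule ccontr)
    assume rk: "r k \<noteq> 0"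
    define a where "a = (\<lambda>u. r (the_inv_into {..<d} b u))"
    have ab: "a (b j) = r j" if "j < d" for j using inj that by (simp add: a_def the_inv_into_f_f)
    have "lincomb a B = 0\<^sub>v n"
    proof (rule eq_vecI)
      fix i assume "i < dim_vec (0\<^sub>v n :: real vec)"
      then have i: "i < n" by simp
      have "lincomb a B $ i = (\<Sum>u\<in>B. a u * u $ i)" using lincomb_index[OF i B(1)] .
      also have "\<dots> = (\<Sum>k<d. a (b k) * b k $ i)" by (rule sum.reindex_bij_betw[OF b, symmetric])
      also have "\<dots> = (\<Sum>k<d. r k * b k $ i)" by (rule sum.cong) (use ab in auto)
      finally show "lincomb a B $ i = 0\<^sub>v n $ i" using r i by simp
    qed (use lincomb_dim[OF B(2,1)] in simp)
    moreover have "b k \<in> B" "a (b k) \<noteq> 0" using im k ab rk by auto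
    ultimately have "lin_dep B" using B(2) unfolding lin_dep_def by blast
    then show False using B(4) by blast
  qed
  then have "lattice_basis n d L b"
    unfolding lattice_basis_def using int_span_indexed[OF b B(1)] B(1,5) im by blast
  then show ?thesis using that by blast
qed

lemma lattice_basis_inj:
  assumes b: "lattice_basis n d L b"
  shows "inj_on b {..<d}"
proof (rule inj_onI, rule ccontr)
  fix k l assume kl: "k \<in> {..<d}" "l \<in> {..<d}" "b k = b l" "k \<noteq> l"
  define r :: "nat \<Rightarrow> real" where "r = (\<lambda>j. if j = k then 1 else if j = l then -1 else 0)"
  have "(\<Sum>j<d. r j * b j $ i) = 0" for i
  proof -
    have "(\<Sum>j<d. r j * b j $ i) = (\<Sum>j\<in>{k, l}. r j * b j $ i)"
      by (rule sum.mono_neutral_right) (use kl in \<open>auto simp: r_def\<close>)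
    also have "\<dots> = 0" using kl(3,4) by (simp add: r_def)
    finally show ?thesis .
  qed
  then have "r k = 0" using kl(1) lattice_basis_indep[OF b, of r k] by blast
  then show False by (simp add: r_def)
qed

lemma lattice_basis_imp_rank:
  assumes b: "lattice_basis n d L b"
  shows "lattice_of_rank n d L"
proof -
  interpret vec_space "TYPE(real)" n .
  define B where "B = b ` {..<d}"
  have inj: "inj_on b {..<d}" using lattice_basis_inj b by blast
  have bb: "bij_betw b {..<d} B" using inj by (simp add: B_def bij_betw_def)
  have BC: "B \<subseteq> carrier_vec n" using lattice_basis_carrier[OF b] by (auto simp: B_def)
  have fB: "finite B" by (simp add: B_def)
  have "lin_indpt B"
  proof (rule finite_lin_indpt2[OF fB BC])
    fix a assume a: "lincomb a B = 0\<^sub>v n"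
    have "(\<Sum>k<d. a (b k) * b k $ i) = 0" if i: "i < n" for i
    proof -
      have "(\<Sum>k<d. a (b k) * b k $ i) = (\<Sum>u\<in>B. a u * u $ i)" by (rule sum.reindex_bij_betw[OF bb])
      also have "\<dots> = lincomb a B $ i" using lincomb_index[OF i BC] by simp
      finally show ?thesis using a i by simp
    qed
    then have "a (b k) = 0" if "k < d" for k
      by (rule lattice_basis_indep[OF b, of "\<lambda>k. a (b k)", OF _ that])
    then show "\<forall>v\<in>B. a v = 0" by (auto simp: B_def)
  qed
  moreover have "L = int_span n B" using lattice_basis_eq[OF b] int_span_indexed[OF bb BC] by (rule trans[OF _ sym])
  moreover have "card B = d" using inj by (simp add: B_def card_image)
  ultimately show ?thesis unfolding lattice_of_rank_def using BC fB by blast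
qed

lemma lattice_basis_subgroup:
  assumes b: "lattice_basis n d L b"
  shows "additive_subgroup n L" "\<And>k. k < d \<Longrightarrow> b k \<in> L"
proof -
  define B where "B = b ` {..<d}"
  have bb: "bij_betw b {..<d} B" using lattice_basis_inj[OF b] by (simp add: B_def bij_betw_def)
  have BC: "B \<subseteq> carrier_vec n" using lattice_basis_carrier[OF b] by (auto simp: B_def)
  have L: "L = int_span n B" using lattice_basis_eq[OF b] int_span_indexed[OF bb BC] by (rule trans[OF _ sym])
  show "additive_subgroup n L" unfolding L by (rule additive_subgroup_int_span[OF BC])
  show "b k \<in> L" if "k < d" for k
    using int_span_superset[OF BC] that unfolding L by (auto simp: B_def)
qed

lemma lattice_basis_subset_subgroup:
  assumes b: "lattice_basis n d L b" and M: "additive_subgroup n M" "\<And>k. k < d \<Longrightarrow> b k \<in> M"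
  shows "L \<subseteq> M"
proof -
  define B where "B = b ` {..<d}"
  have bb: "bij_betw b {..<d} B" using lattice_basis_inj[OF b] by (simp add: B_def bij_betw_def)
  have BC: "B \<subseteq> carrier_vec n" using lattice_basis_carrier[OF b] by (auto simp: B_def)
  have L: "L = int_span n B" using lattice_basis_eq[OF b] int_span_indexed[OF bb BC] by (rule trans[OF _ sym])
  show ?thesis unfolding L by (rule int_span_least[OF M(1)]) (use M(2) in \<open>auto simp: B_def\<close>)
qed

text \<open>As the span of the roots is an additive subgroup, generation by roots has to be checked
  for the basis vectors only.\<close>

lemma root_latticeI:
  assumes b: "lattice_basis n d L b" and int: "integral_lattice L"
    and gen: "\<And>k. k < d \<Longrightarrow> b k \<in> int_span n (roots L)"
  shows "root_lattice d L"
proof -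
  have L: "additive_subgroup n L" using lattice_basis_subgroup[OF b] by blast
  have RL: "roots L \<subseteq> L" by (auto simp: roots_def)
  then have RC: "roots L \<subseteq> carrier_vec n" using L by (auto simp: additive_subgroup_def)
  have "int_span n (roots L) \<subseteq> L" by (rule int_span_least[OF L RL])
  moreover have "L \<subseteq> int_span n (roots L)"
    by (rule lattice_basis_subset_subgroup[OF b additive_subgroup_int_span[OF RC] gen])
  ultimately show ?thesis
    unfolding root_lattice_def using lattice_basis_imp_rank[OF b] int by blast
qed

section \<open>Expansion in a frame and inner products of roots\<close>

lemma scalar_prod_sum_left:
  assumes "x \<in> carrier_vec n" "y \<in> carrier_vec n" "\<And>k. k < d \<Longrightarrow> b k \<in> carrier_vec n"
    and "\<And>i. i < n \<Longrightarrow> x $ i = (\<Sum>k<d. c k * b k $ i)"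
  shows "x \<bullet> y = (\<Sum>k<d. c k * (b k \<bullet> y :: real))"
proof -
  have "x \<bullet> y = (\<Sum>i<n. \<Sum>k<d. c k * b k $ i * y $ i)"
    using assms by (simp add: scalar_prod_def atLeast0LessThan sum_distrib_right)
  also have "\<dots> = (\<Sum>k<d. \<Sum>i<n. c k * b k $ i * y $ i)" by (rule sum.swap)
  also have "\<dots> = (\<Sum>k<d. c k * (b k \<bullet> y))"
    using assms by (simp add: scalar_prod_def atLeast0LessThan sum_distrib_left mult.assoc)
  finally show ?thesis .
qed

lemma mat_mult_entry:
  assumes "A \<in> carrier_mat m n" "B \<in> carrier_mat n p" "i < m" "j < p"
  shows "(A * B) $$ (i, j) = (\<Sum>k<n. A $$ (i, k) * B $$ (k, j))"
  using assms by (simp add: scalar_prod_def atLeast0LessThan)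

text \<open>A frame consists of d orthogonal vectors in a real span of dimension d, so it is a basis
  of that span. As the ambient dimension may be larger, the argument runs in lattice coordinates,
  where the matrices involved are square.\<close>

lemma frame_expansion:
  assumes b: "lattice_basis n d L b" and v: "frame_vectors d L v"
    and x: "x \<in> L" and y: "y \<in> carrier_vec n"
  shows "x \<bullet> y = (\<Sum>j<d. (x \<bullet> v j) / 2 * (v j \<bullet> y))"
proof -
  have LC: "L \<subseteq> carrier_vec n" using lattice_basis_subgroup(1)[OF b] by (simp add: additive_subgroup_def)
  have bC: "b k \<in> carrier_vec n" if "k < d" for k using lattice_basis_carrier[OF b] that by blast
  have coords: "\<exists>c :: nat \<Rightarrow> real. \<forall>i<n. z $ i = (\<Sum>k<d. c k * b k $ i)" if z: "z \<in> L" for z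
  proof -
    have "z \<in> {x \<in> carrier_vec n. \<exists>c :: nat \<Rightarrow> int. \<forall>i<n. x $ i = (\<Sum>k<d. of_int (c k) * b k $ i)}"
      using z lattice_basis_eq[OF b] by (rule subst[rotated])
    then obtain c :: "nat \<Rightarrow> int" where "\<forall>i<n. z $ i = (\<Sum>k<d. of_int (c k) * b k $ i)"
      by blast
    then show ?thesis by (intro exI[of _ "\<lambda>k. of_int (c k)"])
  qed
  have vL: "v j \<in> L" if "j < d" for j using v that by (simp add: frame_vectors_def)
  have vC: "v j \<in> carrier_vec n" if "j < d" for j using vL[OF that] LC by auto
  obtain c where c: "\<And>j i. j < d \<Longrightarrow> i < n \<Longrightarrow> v j $ i = (\<Sum>k<d. c j k * b k $ i)"
  proof -
    have "\<forall>j. \<exists>c. j < d \<longrightarrow> (\<forall>i<n. v j $ i = (\<Sum>k<d. c k * b k $ i))" using coords[OF vL] by simp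
    then obtain c where "\<forall>j. j < d \<longrightarrow> (\<forall>i<n. v j $ i = (\<Sum>k<d. c j k * b k $ i))" by (rule choice[THEN exE])
    then show ?thesis using that by simp
  qed
  have vy: "v j \<bullet> z = (\<Sum>k<d. c j k * (b k \<bullet> z))" if "j < d" "z \<in> carrier_vec n" for j z
    by (rule scalar_prod_sum_left) (use that vC bC c in auto)
  define C where "C = mat d d (\<lambda>(j, k). c j k)"
  define G where "G = mat d d (\<lambda>(k, j). (b k \<bullet> v j) / 2)"
  have Cc: "C \<in> carrier_mat d d" and Gc: "G \<in> carrier_mat d d" by (simp_all add: C_def G_def)
  have "C * G = 1\<^sub>m d"
  proof (rule eq_matI)
    fix i j assume "i < dim_row (1\<^sub>m d :: real mat)" "j < dim_col (1\<^sub>m d :: real mat)"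
    then have ij: "i < d" "j < d" by auto
    have "(C * G) $$ (i, j) = (\<Sum>k<d. c i k * (b k \<bullet> v j)) / 2"
      unfolding mat_mult_entry[OF Cc Gc ij] using ij by (simp add: C_def G_def sum_divide_distrib)
    also have "\<dots> = (v i \<bullet> v j) / 2" using vy[OF ij(1) vC[OF ij(2)]] by simp
    also have "\<dots> = 1\<^sub>m d $$ (i, j)" using v ij by (simp add: frame_vectors_def)
    finally show "(C * G) $$ (i, j) = 1\<^sub>m d $$ (i, j)" .
  qed (auto simp: C_def G_def)
  \<comment> \<open>\<open>C * G = 1\<close> is the orthogonality of the frame; the reversed product
    is the expansion of each basis vector b k in the frame.\<close>
  then have GC: "G * C = 1\<^sub>m d"
    by (intro mat_mult_left_right_inverse[of C]) (auto simp: C_def G_def)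
  have delta: "(\<Sum>j<d. (b k \<bullet> v j) / 2 * c j l) = (if k = l then 1 else 0)" if "k < d" "l < d" for k l
  proof -
    have "(G * C) $$ (k, l) = (\<Sum>j<d. (b k \<bullet> v j) / 2 * c j l)"
      unfolding mat_mult_entry[OF Gc Cc that] using that by (simp add: C_def G_def)
    then show ?thesis using GC that by simp
  qed
  have bexp: "b k \<bullet> y = (\<Sum>j<d. (b k \<bullet> v j) / 2 * (v j \<bullet> y))" if k: "k < d" for k
  proof -
    have "(\<Sum>j<d. (b k \<bullet> v j) / 2 * (v j \<bullet> y)) = (\<Sum>j<d. \<Sum>l<d. (b k \<bullet> v j) / 2 * c j l * (b l \<bullet> y))"
      using vy[OF _ y] by (simp add: sum_distrib_left mult.assoc)
    also have "\<dots> = (\<Sum>l<d. \<Sum>j<d. (b k \<bullet> v j) / 2 * c j l * (b l \<bullet> y))" by (rule sum.swap)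
    also have "\<dots> = (\<Sum>l<d. (if k = l then 1 else 0) * (b l \<bullet> y))"
      by (rule sum.cong[OF refl], subst delta[OF k, symmetric]) (auto simp: sum_distrib_right)
    also have "\<dots> = b k \<bullet> y" using k by (simp add: if_distrib[of "\<lambda>t. t * _"] cong: if_cong)
    finally show ?thesis by simp
  qed
  obtain e where e: "\<And>i. i < n \<Longrightarrow> x $ i = (\<Sum>k<d. e k * b k $ i)" using coords[OF x] by auto
  have xz: "x \<bullet> z = (\<Sum>k<d. e k * (b k \<bullet> z))" if "z \<in> carrier_vec n" for z
    by (rule scalar_prod_sum_left) (use that x LC bC e in auto)
  have "x \<bullet> y = (\<Sum>k<d. \<Sum>j<d. e k * (b k \<bullet> v j) / 2 * (v j \<bullet> y))"
    using xz[OF y] by (simp add: bexp sum_distrib_left mult.assoc)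
  also have "\<dots> = (\<Sum>j<d. \<Sum>k<d. e k * (b k \<bullet> v j) / 2 * (v j \<bullet> y))" by (rule sum.swap)
  also have "\<dots> = (\<Sum>j<d. (x \<bullet> v j) / 2 * (v j \<bullet> y))"
    by (rule sum.cong) (use xz vC in \<open>auto simp: sum_distrib_right sum_divide_distrib\<close>)
  finally show ?thesis .
qed

text \<open>Both x - y and x + y are nonzero, and their norms 4 - 2 (x, y) and 4 + 2 (x, y) are
  therefore positive; so the integer (x, y) has absolute value less than 2.\<close>

lemma roots_scalar_prod_trichotomy:
  fixes x y :: "real vec"
  assumes c: "x \<in> carrier_vec n" "y \<in> carrier_vec n" and int: "x \<bullet> y \<in> \<int>"
    and norm: "x \<bullet> x = 2" "y \<bullet> y = 2" and ne: "x \<noteq> y" "x \<noteq> - y"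
  shows "x \<bullet> y \<in> {-1, 0, 1}"
proof -
  have xy: "x \<bullet> x = (\<Sum>i<n. x $ i * x $ i)" "x \<bullet> y = (\<Sum>i<n. x $ i * y $ i)" "y \<bullet> y = (\<Sum>i<n. y $ i * y $ i)"
    using c by (simp_all add: scalar_prod_def atLeast0LessThan)
  have "(x - y) \<bullet> (x - y) = (\<Sum>i<n. x $ i * x $ i - 2 * (x $ i * y $ i) + y $ i * y $ i)"
    using c by (simp add: scalar_prod_def atLeast0LessThan algebra_simps)
  then have minus: "(x - y) \<bullet> (x - y) = 4 - 2 * (x \<bullet> y)"
    using norm unfolding xy by (simp add: sum.distrib sum_subtractf sum_distrib_left)
  have "(x + y) \<bullet> (x + y) = (\<Sum>i<n. x $ i * x $ i + 2 * (x $ i * y $ i) + y $ i * y $ i)"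
    using c by (simp add: scalar_prod_def atLeast0LessThan algebra_simps)
  then have plus: "(x + y) \<bullet> (x + y) = 4 + 2 * (x \<bullet> y)"
    using norm unfolding xy by (simp add: sum.distrib sum_distrib_left)
  have sq: "z \<bullet> z = (\<Sum>i<n. (z $ i)\<^sup>2)" if "z \<in> carrier_vec n" for z :: "real vec"
    using that by (simp add: scalar_prod_def atLeast0LessThan power2_eq_square)
  have pos: "z \<bullet> z > 0" if z: "z \<in> carrier_vec n" "z \<noteq> 0\<^sub>v n" for z :: "real vec"
  proof -
    obtain i where i: "i < n" "z $ i \<noteq> 0" using z by (metis eq_vecI index_zero_vec carrier_vecD)
    have "0 < (\<Sum>i<n. (z $ i)\<^sup>2)" by (rule sum_pos2[of _ i]) (use i in auto)
    then show ?thesis using sq z by simp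
  qed
  have "x - y \<noteq> 0\<^sub>v n"
  proof
    assume "x - y = 0\<^sub>v n"
    then have "x $ i = y $ i" if "i < n" for i using c that
      by (metis carrier_vecD eq_iff_diff_eq_0 index_minus_vec(1) index_zero_vec(1))
    then have "x = y" using c by (intro eq_vecI) auto
    then show False using ne by blast
  qed
  moreover have "x + y \<noteq> 0\<^sub>v n"
  proof
    assume "x + y = 0\<^sub>v n"
    then have "x $ i = (- y) $ i" if "i < n" for i using c that
      by (metis carrier_vecD eq_neg_iff_add_eq_0 index_add_vec(1) index_uminus_vec(1) index_zero_vec(1))
    then have "x = - y" using c by (intro eq_vecI) auto
    then show False using ne by blast
  qed
  ultimately have "\<bar>x \<bullet> y\<bar> < 2" using pos[of "x - y"] pos[of "x + y"] minus plus c by auto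
  moreover obtain k where k: "x \<bullet> y = of_int k" using int by (auto elim: Ints_cases)
  ultimately have "\<bar>k\<bar> < 2" by linarith
  then have "k \<in> {-1, 0, 1}" by auto
  then show ?thesis using k by auto
qed

section \<open>From disjoint frames to unbiased matrices\<close>

definition disjoint_frame_vectors :: "nat \<Rightarrow> real vec set \<Rightarrow> 'i set \<Rightarrow> ('i \<Rightarrow> nat \<Rightarrow> real vec) \<Rightarrow> bool" where
  "disjoint_frame_vectors d L I v \<longleftrightarrow> (\<forall>a\<in>I. frame_vectors d L (v a)) \<and>
     (\<forall>a\<in>I. \<forall>b\<in>I. a \<noteq> b \<longrightarrow> (\<forall>i<d. \<forall>j<d. v a i \<noteq> v b j \<and> v a i \<noteq> - v b j))"

text \<open>Everything follows from the Parseval identity for a frame with vectors of norm 2. It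
  makes the matrix of one frame relative to another a weighing matrix of weight 4, and it turns half
  of the product of two such matrices, taken relative to the reference frame \<open>a0\<close>, into
  the matrix of the first frame relative to the second.\<close>

lemma MUWM_of_disjoint_frames:
  assumes b: "lattice_of_rank n d L" and int: "integral_lattice L"
    and v: "disjoint_frame_vectors d L I v" and a0: "a0 \<in> I" and d: "d > 0"
  defines "S \<equiv> (\<lambda>a. frame_matrix d (v a0) (v a)) ` (I - {a0})"
  shows "MUWM d 4 S" "card S = card (I - {a0})" "MUWM_from_frames d L S"
proof -
  obtain bb where bb: "lattice_basis n d L bb" using lattice_of_rank_basisD[OF b] .
  have LC: "L \<subseteq> carrier_vec n" using lattice_basis_subgroup(1)[OF bb] by (simp add: additive_subgroup_def)
  have fr: "frame_vectors d L (v a)" if "a \<in> I" for a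
    using v that by (simp add: disjoint_frame_vectors_def)
  have vL: "v a i \<in> L" if "a \<in> I" "i < d" for a i
    using fr[OF that(1)] that(2) by (simp add: frame_vectors_def)
  have vC: "v a i \<in> carrier_vec n" if "a \<in> I" "i < d" for a i using vL[OF that] LC by auto
  have ne: "v a i \<noteq> v b j" "v a i \<noteq> - v b j" if "a \<in> I" "b \<in> I" "a \<noteq> b" "i < d" "j < d" for a b i j
    using v that by (auto simp: disjoint_frame_vectors_def)
  have parseval: "(\<Sum>j<d. (x \<bullet> v a j) * (y \<bullet> v a j)) = 2 * (x \<bullet> y)"
    if "x \<in> L" "y \<in> L" "a \<in> I" for x y a
  proof -
    have "x \<bullet> y = (\<Sum>j<d. (x \<bullet> v a j) / 2 * (v a j \<bullet> y))"
      using frame_expansion[OF bb fr[OF that(3)] that(1)] that(2) LC by blast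
    also have "\<dots> = (\<Sum>j<d. (x \<bullet> v a j) * (y \<bullet> v a j) / 2)"
      by (rule sum.cong) (use that LC vC comm_scalar_prod[of y n] in auto)
    finally show ?thesis by (simp flip: sum_divide_distrib)
  qed
  have fm: "weighing_matrix d 4 (frame_matrix d (v a) (v c))" if ac: "a \<in> I" "c \<in> I" "a \<noteq> c" for a c
    unfolding weighing_matrix_iff
  proof (intro conjI allI impI)
    fix i j assume ij: "i < d" "j < d"
    have "v c i \<bullet> v a j \<in> {-1, 0, 1}"
    proof (rule roots_scalar_prod_trichotomy)
      show "v c i \<bullet> v a j \<in> \<int>" using int vL ac ij by (simp add: integral_lattice_def)
      show "v c i \<bullet> v c i = 2" "v a j \<bullet> v a j = 2" using fr ac ij by (simp_all add: frame_vectors_def)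
    qed (use vC ne ac ij in auto)
    then show "frame_matrix d (v a) (v c) $$ (i, j) \<in> {-1, 0, 1}" using ij by (simp add: frame_matrix_def)
    have "(\<Sum>l<d. (v c i \<bullet> v a l) * (v c j \<bullet> v a l)) = 2 * (v c i \<bullet> v c j)"
      by (rule parseval[OF vL vL]) (use ac ij in auto)
    also have "\<dots> = (if i = j then 4 else 0)" using fr[OF ac(2)] ij by (simp add: frame_vectors_def)
    finally show "(\<Sum>l<d. frame_matrix d (v a) (v c) $$ (i, l) * frame_matrix d (v a) (v c) $$ (j, l)) =
       (if i = j then real 4 else 0)" using ij by (simp add: frame_matrix_def)
  qed (simp add: frame_matrix_def)
  have ub: "unbiased d 4 (frame_matrix d (v a0) (v a)) (frame_matrix d (v a0) (v c))"
    if ac: "a \<in> I" "c \<in> I" "a \<noteq> c" for a c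
  proof -
    have "(1 / sqrt (real 4)) \<cdot>\<^sub>m (frame_matrix d (v a0) (v a) * (frame_matrix d (v a0) (v c))\<^sup>T) =
      frame_matrix d (v c) (v a)"
    proof (rule eq_matI)
      fix i j assume "i < dim_row (frame_matrix d (v c) (v a))" "j < dim_col (frame_matrix d (v c) (v a))"
      then have ij: "i < d" "j < d" by (auto simp: frame_matrix_def)
      have Fc: "frame_matrix d (v a0) (v a) \<in> carrier_mat d d" "(frame_matrix d (v a0) (v c))\<^sup>T \<in> carrier_mat d d"
        by (simp_all add: frame_matrix_def)
      have "(frame_matrix d (v a0) (v a) * (frame_matrix d (v a0) (v c))\<^sup>T) $$ (i, j) =
        (\<Sum>l<d. (v a i \<bullet> v a0 l) * (v c j \<bullet> v a0 l))"
        unfolding mat_mult_entry[OF Fc ij] using ij by (simp add: frame_matrix_def)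
      also have "\<dots> = 2 * (v a i \<bullet> v c j)" by (rule parseval[OF vL vL a0]) (use ac ij in auto)
      finally have "(frame_matrix d (v a0) (v a) * (frame_matrix d (v a0) (v c))\<^sup>T) $$ (i, j) = 2 * (v a i \<bullet> v c j)" .
      moreover have "dim_row (frame_matrix d (v a0) (v a)) = d" "dim_row (frame_matrix d (v a0) (v c)) = d"
        by (simp_all add: frame_matrix_def)
      ultimately show "((1 / sqrt (real 4)) \<cdot>\<^sub>m (frame_matrix d (v a0) (v a) * (frame_matrix d (v a0) (v c))\<^sup>T)) $$ (i, j) =
        frame_matrix d (v c) (v a) $$ (i, j)"
        using ij by (simp add: frame_matrix_def del: index_mult_mat(1))
    qed (auto simp: frame_matrix_def)
    then show ?thesis using fm ac by (simp add: unbiased_def)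
  qed
  show M: "MUWM d 4 S"
    unfolding MUWM_def pairwise_def
  proof (intro conjI ballI impI)
    fix W assume "W \<in> S"
    then show "weighing_matrix d 4 W" using fm a0 by (auto simp: S_def)
  next
    fix W W' assume "W \<in> S" "W' \<in> S" "W \<noteq> W'"
    then obtain a c where "a \<in> I" "c \<in> I" "W = frame_matrix d (v a0) (v a)" "W' = frame_matrix d (v a0) (v c)" "a \<noteq> c"
      by (auto simp: S_def)
    then show "unbiased d 4 W W'" using ub by simp
  qed
  show "card S = card (I - {a0})" unfolding S_def
  proof (rule card_image, rule inj_onI, rule ccontr)
    fix a c assume ac: "a \<in> I - {a0}" "c \<in> I - {a0}" "frame_matrix d (v a0) (v a) = frame_matrix d (v a0) (v c)"
      "a \<noteq> c"
    have eq: "v a 0 \<bullet> v a0 l = v c 0 \<bullet> v a0 l" if "l < d" for l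
    proof -
      have "frame_matrix d (v a0) (v a) $$ (0, l) = frame_matrix d (v a0) (v c) $$ (0, l)" using ac(3) by simp
      then show ?thesis using that d by (simp add: frame_matrix_def)
    qed
    \<comment> \<open>Equal matrices have equal rows 0, and Parseval then gives inner product 2
      between roots of disjoint frames.\<close>
    have "2 * (v a 0 \<bullet> v c 0) = (\<Sum>l<d. (v a 0 \<bullet> v a0 l) * (v c 0 \<bullet> v a0 l))"
      using parseval[OF vL vL a0, of a 0 c 0] ac d by simp
    also have "\<dots> = (\<Sum>l<d. (v a 0 \<bullet> v a0 l) * (v a 0 \<bullet> v a0 l))"
      by (rule sum.cong) (use eq in auto)
    also have "\<dots> = 4" using parseval[OF vL vL a0, of a 0 a 0] ac d fr[of a] by (simp add: frame_vectors_def)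
    finally have "v a 0 \<bullet> v c 0 = 2" by simp
    moreover have "v a 0 \<bullet> v c 0 \<in> {-1, 0, 1}"
    proof (rule roots_scalar_prod_trichotomy)
      show "v a 0 \<bullet> v c 0 \<in> \<int>" using int vL ac d by (simp add: integral_lattice_def)
      show "v a 0 \<bullet> v a 0 = 2" "v c 0 \<bullet> v c 0 = 2" using fr ac d by (simp_all add: frame_vectors_def)
    qed (use vC ne ac d in auto)
    ultimately show False by simp
  qed
  have "\<exists>w. frame_vectors d L w \<and> W = frame_matrix d (v a0) w" if "W \<in> S" for W
    using that fr by (auto simp: S_def)
  then show "MUWM_from_frames d L S"
    unfolding MUWM_from_frames_def using M fr[OF a0] by blast
qed

text \<open>One frame serves as the reference and the others become matrices, which accounts for the
  extra 1.\<close>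

lemma card_frames_le:
  assumes L: "root_lattice d L" and d: "d > 0"
    and M: "\<And>S. finite S \<Longrightarrow> MUWM d 4 S \<Longrightarrow> card S \<le> M"
    and F: "finite \<F>" "\<forall>F\<in>\<F>. two_frame d L F" "pairwise disjnt \<F>"
  shows "card \<F> \<le> M + 1"
proof (cases "\<F> = {}")
  case False
  then obtain F0 where F0: "F0 \<in> \<F>" by blast
  obtain n where n: "lattice_of_rank n d L" "integral_lattice L" using L by (auto simp: root_lattice_def)
  obtain v where v: "\<And>F. F \<in> \<F> \<Longrightarrow> frame_vectors d L (v F) \<and> F = (\<Union>i<d. {v F i, - v F i})"
  proof -
    have "\<forall>F\<in>\<F>. \<exists>v. frame_vectors d L v \<and> F = (\<Union>i<d. {v i, - v i})"
      using F(2) by (simp add: two_frame_def)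
    then show ?thesis using that by (metis (no_types))
  qed
  have "disjoint_frame_vectors d L \<F> v"
    unfolding disjoint_frame_vectors_def
  proof (intro conjI ballI impI allI)
    fix F F' i j assume FF: "F \<in> \<F>" "F' \<in> \<F>" "F \<noteq> F'" and ij: "i < d" "j < d"
    have "v F i \<in> (\<Union>i<d. {v F i, - v F i})" using ij by blast
    then have "v F i \<in> F" using v[OF FF(1)] by simp
    moreover have "v F' j \<in> (\<Union>i<d. {v F' i, - v F' i})" "- v F' j \<in> (\<Union>i<d. {v F' i, - v F' i})"
      using ij by blast+
    then have "v F' j \<in> F'" "- v F' j \<in> F'" using v[OF FF(2)] by simp_all
    moreover have "F \<inter> F' = {}" using F(3) FF by (auto simp: pairwise_def disjnt_def)
    ultimately show "v F i \<noteq> v F' j" "v F i \<noteq> - v F' j" by auto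
  qed (use v in blast)
  from MUWM_of_disjoint_frames[OF n this F0 d]
  have "card (\<F> - {F0}) \<le> M" using M[of "(\<lambda>a. frame_matrix d (v F0) (v a)) ` (\<F> - {F0})"] F(1) by simp
  then show ?thesis using F0 F(1) by (simp add: card_Diff_singleton)
qed simp

lemma disjoint_frame_vectors_family:
  assumes v: "disjoint_frame_vectors d L {..<k} v" and d: "d > 0"
  shows "\<exists>\<F>. card \<F> = k \<and> finite \<F> \<and> (\<forall>F\<in>\<F>. two_frame d L F) \<and> pairwise disjnt \<F>"
proof -
  define f where "f = (\<lambda>a. \<Union>i<d. {v a i, - v a i})"
  have ne: "v a i \<noteq> v b j" "v a i \<noteq> - v b j" if "a < k" "b < k" "a \<noteq> b" "i < d" "j < d" for a b i j
    using v that by (auto simp: disjoint_frame_vectors_def)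
  have disj: "f a \<inter> f b = {}" if "a < k" "b < k" "a \<noteq> b" for a b
  proof (rule ccontr)
    assume "f a \<inter> f b \<noteq> {}"
    then obtain x i j where ij: "i < d" "j < d" and x: "x = v a i \<or> x = - v a i" "x = v b j \<or> x = - v b j"
      unfolding f_def by blast
    have "v a i = v b j \<or> v a i = - v b j" using x uminus_uminus_vec by metis
    then show False using ne[OF that ij] by blast
  qed
  have nonempty: "f a \<noteq> {}" for a using d by (auto simp: f_def)
  have "inj_on f {..<k}"
  proof (rule inj_onI, rule ccontr)
    fix a b assume "a \<in> {..<k}" "b \<in> {..<k}" "f a = f b" "a \<noteq> b"
    then show False using disj[of a b] nonempty[of a] by auto
  qed
  then have "card (f ` {..<k}) = k" by (simp add: card_image)
  moreover have "two_frame d L F" if "F \<in> f ` {..<k}" for F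
    using that v by (auto simp: two_frame_def disjoint_frame_vectors_def f_def)
  moreover have "pairwise disjnt (f ` {..<k})"
    using disj unfolding pairwise_def disjnt_def by blast
  ultimately show ?thesis by (intro exI[of _ "f ` {..<k}"]) simp
qed

text \<open>The upper bound M for matrices bounds the frames of every root lattice by M + 1; a
  single lattice with that many frames therefore makes both estimates sharp at once.\<close>

lemma max_frames_and_max_MUWM:
  assumes L: "root_lattice d L" and d: "d > 0"
    and M: "\<And>S. finite S \<Longrightarrow> MUWM d 4 S \<Longrightarrow> card S \<le> M"
    and v: "disjoint_frame_vectors d L {..<M + 1} v"
  shows "attains_max_frames d L" "max_disjoint_frames d L = M + 1" "max_MUWM d = M"
    "\<exists>S. finite S \<and> MUWM_from_frames d L S \<and> card S = M"
proof -
  have le: "max_disjoint_frames d L' \<le> M + 1" if "root_lattice d L'" for L'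
    unfolding max_disjoint_frames_def
  proof (rule Max.boundedI)
    let ?A = "{card \<F> |\<F>. finite \<F> \<and> (\<forall>F\<in>\<F>. two_frame d L' F) \<and> pairwise disjnt \<F>}"
    have "?A \<subseteq> {..M + 1}" using card_frames_le[OF that d M] by blast
    then show "finite ?A" using finite_subset by blast
    show "?A \<noteq> {}" by (auto intro!: exI[of _ "{}"])
    show "a \<le> M + 1" if "a \<in> ?A" for a using \<open>?A \<subseteq> {..M + 1}\<close> that by blast
  qed
  obtain \<F> where F: "card \<F> = M + 1" "finite \<F>" "\<forall>F\<in>\<F>. two_frame d L F" "pairwise disjnt \<F>"
    using disjoint_frame_vectors_family[OF v d] by blast
  show mx: "max_disjoint_frames d L = M + 1"
    unfolding max_disjoint_frames_def
  proof (rule Max_eqI)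
    let ?A = "{card \<F> |\<F>. finite \<F> \<and> (\<forall>F\<in>\<F>. two_frame d L F) \<and> pairwise disjnt \<F>}"
    have "?A \<subseteq> {..M + 1}" using card_frames_le[OF L d M] by blast
    then show "finite ?A" using finite_subset by blast
    show "a \<le> M + 1" if "a \<in> ?A" for a using \<open>?A \<subseteq> {..M + 1}\<close> that by blast
    show "M + 1 \<in> ?A" using F by (intro CollectI exI[of _ \<F>]) simp
  qed
  then show "attains_max_frames d L" unfolding attains_max_frames_def using L le by simp
  obtain n where n: "lattice_of_rank n d L" "integral_lattice L" using L by (auto simp: root_lattice_def)
  define S where "S = (\<lambda>a. frame_matrix d (v 0) (v a)) ` ({..<M + 1} - {0})"
  have "0 \<in> {..<M + 1}" by simp
  from MUWM_of_disjoint_frames[OF n v this d]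
  have S: "MUWM d 4 S" "card S = M" "MUWM_from_frames d L S" "finite S" by (simp_all add: S_def)
  then show "\<exists>S. finite S \<and> MUWM_from_frames d L S \<and> card S = M" by blast
  show "max_MUWM d = M"
    unfolding max_MUWM_def
  proof (rule Max_eqI)
    let ?A = "{card S |S. finite S \<and> MUWM d 4 S}"
    have "?A \<subseteq> {..M}" using M by blast
    then show "finite ?A" using finite_subset by blast
    show "a \<le> M" if "a \<in> ?A" for a using \<open>?A \<subseteq> {..M}\<close> that by blast
    show "M \<in> ?A" using S by blast
  qed
qed

lemma max_MUWM_eq_0:
  assumes M: "\<And>S. finite S \<Longrightarrow> MUWM d 4 S \<Longrightarrow> S = {}"
  shows "max_MUWM d = 0"
proof -
  have "MUWM d 4 {}" by (simp add: MUWM_def)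
  then have "{card S |S. finite S \<and> MUWM d 4 S} = {0}" by (auto dest: M intro!: exI[of _ "{}"])
  then show ?thesis by (simp add: max_MUWM_def)
qed

section \<open>Orthogonal sums\<close>

text \<open>Disjointness is expressed through inner products, since equal or opposite roots have
  inner product 2 or -2. In this form it passes to orthogonal sums and can be checked on integer
  tables.\<close>

definition has_frames :: "nat \<Rightarrow> real vec set \<Rightarrow> nat \<Rightarrow> bool" where
  "has_frames d L k \<longleftrightarrow> (\<exists>v. (\<forall>a<k. frame_vectors d L (v a)) \<and>
     (\<forall>a<k. \<forall>b<k. a \<noteq> b \<longrightarrow> (\<forall>i<d. \<forall>j<d. \<bar>v a i \<bullet> v b j\<bar> \<noteq> 2)))"

lemma has_framesE:
  assumes "has_frames d L k"
  obtains v where "\<And>a. a < k \<Longrightarrow> frame_vectors d L (v a)"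
    "\<And>a b i j. a < k \<Longrightarrow> b < k \<Longrightarrow> a \<noteq> b \<Longrightarrow> i < d \<Longrightarrow> j < d \<Longrightarrow> \<bar>v a i \<bullet> v b j\<bar> \<noteq> 2"
proof -
  obtain v where v: "\<forall>a<k. frame_vectors d L (v a)"
    "\<forall>a<k. \<forall>b<k. a \<noteq> b \<longrightarrow> (\<forall>i<d. \<forall>j<d. \<bar>v a i \<bullet> v b j\<bar> \<noteq> 2)"
    using assms unfolding has_frames_def by (elim exE conjE)
  show ?thesis by (rule that[of v]) (use v in simp_all)
qed

lemma has_frames_disjoint:
  assumes "has_frames d L k"
  shows "\<exists>v. disjoint_frame_vectors d L {..<k} v"
proof -
  obtain v where fr: "\<And>a. a < k \<Longrightarrow> frame_vectors d L (v a)"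
    and ip: "\<And>a b i j. a < k \<Longrightarrow> b < k \<Longrightarrow> a \<noteq> b \<Longrightarrow> i < d \<Longrightarrow> j < d \<Longrightarrow> \<bar>v a i \<bullet> v b j\<bar> \<noteq> 2"
    using has_framesE[OF assms] by blast
  have "v a i \<noteq> v b j \<and> v a i \<noteq> - v b j" if "a < k" "b < k" "a \<noteq> b" "i < d" "j < d" for a b i j
  proof -
    have "v b j \<bullet> v b j = 2" using fr[OF that(2)] that(5) by (simp add: frame_vectors_def)
    then show ?thesis using ip[OF that] by auto
  qed
  then show ?thesis using fr by (auto simp: disjoint_frame_vectors_def intro!: exI[of _ v])
qed

lemma has_frames_mono:
  assumes "has_frames d L k" "k' \<le> k"
  shows "has_frames d L k'"
proof -
  obtain v where "\<And>a. a < k \<Longrightarrow> frame_vectors d L (v a)"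
    "\<And>a b i j. a < k \<Longrightarrow> b < k \<Longrightarrow> a \<noteq> b \<Longrightarrow> i < d \<Longrightarrow> j < d \<Longrightarrow> \<bar>v a i \<bullet> v b j\<bar> \<noteq> 2"
    using has_framesE[OF assms(1)] by blast
  then show ?thesis unfolding has_frames_def using assms(2) by (intro exI[of _ v]) simp
qed

text \<open>The a-th frames of the summands are united. Vectors from different summands are
  orthogonal, so a coincidence between two united frames would already occur in one summand.\<close>

lemma has_frames_orth_sum:
  assumes L1: "additive_subgroup n1 L1" and L2: "additive_subgroup n2 L2"
    and f1: "has_frames d1 L1 k" and f2: "has_frames d2 L2 k"
  shows "has_frames (d1 + d2) (L1 \<bottom>\<^sub>L L2) k"
proof -
  obtain u where u: "\<And>a. a < k \<Longrightarrow> frame_vectors d1 L1 (u a)"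
    and u': "\<And>a b i j. a < k \<Longrightarrow> b < k \<Longrightarrow> a \<noteq> b \<Longrightarrow> i < d1 \<Longrightarrow> j < d1 \<Longrightarrow> \<bar>u a i \<bullet> u b j\<bar> \<noteq> 2"
    using has_framesE[OF f1] by blast
  obtain w where w: "\<And>a. a < k \<Longrightarrow> frame_vectors d2 L2 (w a)"
    and w': "\<And>a b i j. a < k \<Longrightarrow> b < k \<Longrightarrow> a \<noteq> b \<Longrightarrow> i < d2 \<Longrightarrow> j < d2 \<Longrightarrow> \<bar>w a i \<bullet> w b j\<bar> \<noteq> 2"
    using has_framesE[OF f2] by blast
  define v where "v = (\<lambda>a i. if i < d1 then u a i @\<^sub>v 0\<^sub>v n2 else 0\<^sub>v n1 @\<^sub>v w a (i - d1))"
  have uL: "u a i \<in> L1" if "a < k" "i < d1" for a i using u[OF that(1)] that(2) by (simp add: frame_vectors_def)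
  have wL: "w a i \<in> L2" if "a < k" "i < d2" for a i using w[OF that(1)] that(2) by (simp add: frame_vectors_def)
  have uC: "u a i \<in> carrier_vec n1" if "a < k" "i < d1" for a i
    using uL[OF that] L1 by (auto simp: additive_subgroup_def)
  have wC: "w a i \<in> carrier_vec n2" if "a < k" "i < d2" for a i
    using wL[OF that] L2 by (auto simp: additive_subgroup_def)
  have ip: "v a i \<bullet> v b j = (if i < d1 then (if j < d1 then u a i \<bullet> u b j else 0)
      else if j < d1 then 0 else w a (i - d1) \<bullet> w b (j - d1))"
    if "a < k" "b < k" "i < d1 + d2" "j < d1 + d2" for a b i j
  proof -
    have "i - d1 < d2" if "\<not> i < d1" using that \<open>i < d1 + d2\<close> by linarith
    moreover have "j - d1 < d2" if "\<not> j < d1" using that \<open>j < d1 + d2\<close> by linarith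
    ultimately show ?thesis using uC wC that
      by (auto simp: v_def scalar_prod_append[of _ n1 _ n2])
  qed
  show ?thesis unfolding has_frames_def
  proof (intro exI[of _ v] conjI allI impI)
    fix a assume a: "a < k"
    have "v a i \<in> L1 \<bottom>\<^sub>L L2" if "i < d1 + d2" for i
    proof (cases "i < d1")
      case True
      then show ?thesis using uL[OF a] L2 by (auto simp: v_def orth_sum_def additive_subgroup_def)
    next
      case False
      then have "i - d1 < d2" using that by linarith
      then show ?thesis using wL[OF a] L1 False by (auto simp: v_def orth_sum_def additive_subgroup_def)
    qed
    moreover have "v a i \<bullet> v a j = (if i = j then 2 else 0)" if "i < d1 + d2" "j < d1 + d2" for i j
    proof -
      have "i - d1 < d2" if "\<not> i < d1" using that \<open>i < d1 + d2\<close> by linarith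
      moreover have "j - d1 < d2" if "\<not> j < d1" using that \<open>j < d1 + d2\<close> by linarith
      ultimately show ?thesis using ip[OF a a that] u[OF a] w[OF a]
        by (auto simp: frame_vectors_def)
    qed
    ultimately show "frame_vectors (d1 + d2) (L1 \<bottom>\<^sub>L L2) (v a)" by (simp add: frame_vectors_def)
  next
    fix a b i j assume ab: "a < k" "b < k" "a \<noteq> b" and ij: "i < d1 + d2" "j < d1 + d2"
    have "i - d1 < d2" if "\<not> i < d1" using that \<open>i < d1 + d2\<close> by linarith
    moreover have "j - d1 < d2" if "\<not> j < d1" using that \<open>j < d1 + d2\<close> by linarith
    ultimately show "\<bar>v a i \<bullet> v b j\<bar> \<noteq> 2"
      using ip[OF ab(1,2) ij] u'[OF ab, of i j] w'[OF ab, of "i - d1" "j - d1"] by auto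
  qed
qed

section \<open>Orthogonal sums of root lattices\<close>

lemma lattice_basis_orth_sum:
  assumes b1: "lattice_basis n1 d1 L1 b1" and b2: "lattice_basis n2 d2 L2 b2"
  defines "b \<equiv> \<lambda>k. if k < d1 then b1 k @\<^sub>v 0\<^sub>v n2 else 0\<^sub>v n1 @\<^sub>v b2 (k - d1)"
  shows "lattice_basis (n1 + n2) (d1 + d2) (L1 \<bottom>\<^sub>L L2) b"
proof -
  have c1: "b1 k \<in> carrier_vec n1" if "k < d1" for k using lattice_basis_carrier[OF b1 that] .
  have c2: "b2 k \<in> carrier_vec n2" if "k < d2" for k using lattice_basis_carrier[OF b2 that] .
  have dim: "\<And>k. k < d1 \<Longrightarrow> dim_vec (b1 k) = n1" "\<And>k. k < d2 \<Longrightarrow> dim_vec (b2 k) = n2"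
    using c1 c2 by auto
  have split: "(\<Sum>k<d1 + d2. f k) = (\<Sum>k<d1. f k) + (\<Sum>k<d2. f (d1 + k))" for f :: "nat \<Rightarrow> real"
    by (induction d2) (auto simp: add.assoc)
  have lo: "(\<Sum>k<d1 + d2. r k * b k $ i) = (\<Sum>k<d1. r k * b1 k $ i)" if "i < n1" for r :: "nat \<Rightarrow> real" and i
  proof -
    have "(\<Sum>k<d1. r k * b k $ i) = (\<Sum>k<d1. r k * b1 k $ i)"
      by (rule sum.cong) (use dim that in \<open>auto simp: b_def\<close>)
    moreover have "(\<Sum>k<d2. r (d1 + k) * b (d1 + k) $ i) = 0"
      by (rule sum.neutral) (use dim that in \<open>auto simp: b_def\<close>)
    ultimately show ?thesis by (simp add: split)
  qed
  have hi: "(\<Sum>k<d1 + d2. r k * b k $ (n1 + i)) = (\<Sum>k<d2. r (d1 + k) * b2 k $ i)" if "i < n2" for r :: "nat \<Rightarrow> real" and i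
  proof -
    have "(\<Sum>k<d1. r k * b k $ (n1 + i)) = 0"
      by (rule sum.neutral) (use dim that in \<open>auto simp: b_def\<close>)
    moreover have "(\<Sum>k<d2. r (d1 + k) * b (d1 + k) $ (n1 + i)) = (\<Sum>k<d2. r (d1 + k) * b2 k $ i)"
      by (rule sum.cong) (use dim that in \<open>auto simp: b_def\<close>)
    ultimately show ?thesis by (simp add: split)
  qed
  have carr: "b k \<in> carrier_vec (n1 + n2)" if "k < d1 + d2" for k
  proof (cases "k < d1")
    case False
    then have "k - d1 < d2" using that by linarith
    then show ?thesis using c2 False by (auto simp: b_def)
  qed (use c1 in \<open>auto simp: b_def\<close>)
  have indep: "r k = 0" if r: "\<forall>i<n1 + n2. (\<Sum>k<d1 + d2. r k * b k $ i) = 0" and k: "k < d1 + d2"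
    for r :: "nat \<Rightarrow> real" and k
  proof (cases "k < d1")
    case True
    have "(\<Sum>k<d1. r k * b1 k $ i) = 0" if "i < n1" for i using r lo[OF that, of r] that by simp
    then show ?thesis using lattice_basis_indep[OF b1, of r k] True by blast
  next
    case False
    then have k': "k - d1 < d2" using k by linarith
    have "(\<Sum>k<d2. r (d1 + k) * b2 k $ i) = 0" if "i < n2" for i using r hi[OF that, of r] that by simp
    then have "r (d1 + (k - d1)) = 0" using lattice_basis_indep[OF b2, of "\<lambda>k. r (d1 + k)" "k - d1"] k' by blast
    then show ?thesis using False by simp
  qed
  have eq: "L1 \<bottom>\<^sub>L L2 = {x \<in> carrier_vec (n1 + n2).
      \<exists>c :: nat \<Rightarrow> int. \<forall>i<n1 + n2. x $ i = (\<Sum>k<d1 + d2. of_int (c k) * b k $ i)}" (is "_ = ?R")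
  proof (intro Set.set_eqI iffI)
    fix z assume "z \<in> L1 \<bottom>\<^sub>L L2"
    then obtain x y where z: "z = x @\<^sub>v y" and x: "x \<in> L1" and y: "y \<in> L2" by (auto simp: orth_sum_def)
    from x have "x \<in> {x \<in> carrier_vec n1. \<exists>c :: nat \<Rightarrow> int. \<forall>i<n1. x $ i = (\<Sum>k<d1. of_int (c k) * b1 k $ i)}"
      using lattice_basis_eq[OF b1] by (rule subst[rotated])
    then obtain c :: "nat \<Rightarrow> int" where xc: "x \<in> carrier_vec n1" and c: "\<forall>i<n1. x $ i = (\<Sum>k<d1. of_int (c k) * b1 k $ i)"
      by blast
    from y have "y \<in> {x \<in> carrier_vec n2. \<exists>c :: nat \<Rightarrow> int. \<forall>i<n2. x $ i = (\<Sum>k<d2. of_int (c k) * b2 k $ i)}"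
      using lattice_basis_eq[OF b2] by (rule subst[rotated])
    then obtain e :: "nat \<Rightarrow> int" where yc: "y \<in> carrier_vec n2" and e: "\<forall>i<n2. y $ i = (\<Sum>k<d2. of_int (e k) * b2 k $ i)"
      by blast
    define f where "f = (\<lambda>k. if k < d1 then c k else e (k - d1))"
    have "z $ i = (\<Sum>k<d1 + d2. of_int (f k) * b k $ i)" if i: "i < n1 + n2" for i
    proof (cases "i < n1")
      case True
      have "(\<Sum>k<d1. of_int (f k) * b1 k $ i) = (\<Sum>k<d1. of_int (c k) * b1 k $ i)"
        by (rule sum.cong) (auto simp: f_def)
      then show ?thesis unfolding lo[OF True] using c True xc yc by (simp add: z)
    next
      case False
      then have i': "i - n1 < n2" using i by linarith
      have "(\<Sum>k<d2. of_int (f (d1 + k)) * b2 k $ (i - n1)) = (\<Sum>k<d2. of_int (e k) * b2 k $ (i - n1))"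
        by (rule sum.cong) (auto simp: f_def)
      then show ?thesis using hi[OF i', of "\<lambda>k. of_int (f k)"] e i' False i xc yc by (simp add: z)
    qed
    then show "z \<in> ?R" using xc yc by (auto simp: z intro!: exI[of _ f])
  next
    fix z assume "z \<in> ?R"
    then obtain c :: "nat \<Rightarrow> int" where zc: "z \<in> carrier_vec (n1 + n2)"
      and c: "\<forall>i<n1 + n2. z $ i = (\<Sum>k<d1 + d2. of_int (c k) * b k $ i)" by blast
    define x where "x = vec n1 (\<lambda>i. z $ i)"
    define y where "y = vec n2 (\<lambda>i. z $ (n1 + i))"
    have z: "z = x @\<^sub>v y" by (rule eq_vecI) (use zc in \<open>auto simp: x_def y_def\<close>)
    have "\<forall>i<n1. x $ i = (\<Sum>k<d1. of_int (c k) * b1 k $ i)"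
      using c lo[of _ "\<lambda>k. of_int (c k)"] by (simp add: x_def)
    then have "x \<in> {x \<in> carrier_vec n1. \<exists>c :: nat \<Rightarrow> int. \<forall>i<n1. x $ i = (\<Sum>k<d1. of_int (c k) * b1 k $ i)}"
      by (intro CollectI conjI exI[of _ c]) (auto simp: x_def)
    then have x: "x \<in> L1" by (subst lattice_basis_eq[OF b1])
    have "\<forall>i<n2. y $ i = (\<Sum>k<d2. of_int (c (d1 + k)) * b2 k $ i)"
      using c hi[of _ "\<lambda>k. of_int (c k)"] by (simp add: y_def)
    then have "y \<in> {x \<in> carrier_vec n2. \<exists>c :: nat \<Rightarrow> int. \<forall>i<n2. x $ i = (\<Sum>k<d2. of_int (c k) * b2 k $ i)}"
      by (intro CollectI conjI exI[of _ "\<lambda>k. c (d1 + k)"]) (auto simp: y_def)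
    then have "y \<in> L2" by (subst lattice_basis_eq[OF b2])
    with x show "z \<in> L1 \<bottom>\<^sub>L L2" unfolding z orth_sum_def by blast
  qed
  show ?thesis unfolding lattice_basis_def
  proof (intro conjI allI impI)
    show "b k \<in> carrier_vec (n1 + n2)" if "k < d1 + d2" for k by (rule carr[OF that])
    show "r k = 0" if "\<forall>i<n1 + n2. (\<Sum>k<d1 + d2. r k * b k $ i) = 0" "k < d1 + d2" for r :: "nat \<Rightarrow> real" and k
      by (rule indep[OF that])
  qed (rule eq)
qed

lemma root_lattice_subgroup:
  assumes "root_lattice d L"
  obtains n where "additive_subgroup n L"
proof -
  obtain n where "lattice_of_rank n d L" using assms by (auto simp: root_lattice_def)
  then obtain b where "lattice_basis n d L b" by (rule lattice_of_rank_basisD)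
  then show ?thesis using that lattice_basis_subgroup(1) by blast
qed

text \<open>The vectors of \<open>L1\<close> that land in the span of the roots of the sum, after
  padding by zeros, come from an additive subgroup containing the roots of \<open>L1\<close>; hence
  they are all of \<open>L1\<close>. The same holds for \<open>L2\<close>.\<close>

lemma root_lattice_orth_sum:
  assumes L1: "root_lattice d1 L1" and L2: "root_lattice d2 L2"
  shows "root_lattice (d1 + d2) (L1 \<bottom>\<^sub>L L2)"
proof -
  obtain n1 b1 where b1: "lattice_basis n1 d1 L1 b1" and i1: "integral_lattice L1" and r1: "L1 = int_span n1 (roots L1)"
    using L1 lattice_of_rank_basisD unfolding root_lattice_def by metis
  obtain n2 b2 where b2: "lattice_basis n2 d2 L2 b2" and i2: "integral_lattice L2" and r2: "L2 = int_span n2 (roots L2)"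
    using L2 lattice_of_rank_basisD unfolding root_lattice_def by metis
  let ?L = "L1 \<bottom>\<^sub>L L2"
  note s1 = lattice_basis_subgroup[OF b1] and s2 = lattice_basis_subgroup[OF b2]
  have C1: "L1 \<subseteq> carrier_vec n1" and z1: "0\<^sub>v n1 \<in> L1" and C2: "L2 \<subseteq> carrier_vec n2" and z2: "0\<^sub>v n2 \<in> L2"
    using s1(1) s2(1) by (auto simp: additive_subgroup_def)
  have ip: "(x @\<^sub>v y) \<bullet> (x' @\<^sub>v y') = x \<bullet> x' + y \<bullet> y'" if "x \<in> L1" "x' \<in> L1" "y \<in> L2" "y' \<in> L2" for x x' y y'
    using scalar_prod_append[of x n1 y n2 x' y'] that C1 C2 by auto
  have int: "integral_lattice ?L"
    unfolding integral_lattice_def orth_sum_def using i1 i2 ip by (auto simp: integral_lattice_def)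
  let ?R = "int_span (n1 + n2) (roots ?L)"
  have RC: "roots ?L \<subseteq> carrier_vec (n1 + n2)" using C1 C2 by (auto simp: roots_def orth_sum_def)
  note R = additive_subgroup_int_span[OF RC]
  have R0: "0\<^sub>v (n1 + n2) \<in> ?R" and Radd: "\<And>x y. x \<in> ?R \<Longrightarrow> y \<in> ?R \<Longrightarrow> x + y \<in> ?R"
    and Rsm: "\<And>x (c::int). x \<in> ?R \<Longrightarrow> of_int c \<cdot>\<^sub>v x \<in> ?R" using R by (auto simp: additive_subgroup_def)
  have sub1: "L1 \<subseteq> {x \<in> carrier_vec n1. x @\<^sub>v 0\<^sub>v n2 \<in> ?R}" (is "_ \<subseteq> ?M")
  proof -
    have "additive_subgroup n1 ?M"
      unfolding additive_subgroup_def
    proof (intro conjI ballI allI)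
      have "0\<^sub>v n1 @\<^sub>v 0\<^sub>v n2 = (0\<^sub>v (n1 + n2) :: real vec)" by (rule eq_vecI) auto
      then show "0\<^sub>v n1 \<in> ?M" using R0 by simp
    next
      fix x y assume x: "x \<in> ?M" and y: "y \<in> ?M"
      have "(x + y) @\<^sub>v 0\<^sub>v n2 = (x @\<^sub>v 0\<^sub>v n2) + (y @\<^sub>v 0\<^sub>v n2)" by (rule eq_vecI) (use x y in auto)
      then show "x + y \<in> ?M" using x y Radd by simp
    next
      fix x and c :: int assume x: "x \<in> ?M"
      have "(of_int c \<cdot>\<^sub>v x) @\<^sub>v 0\<^sub>v n2 = of_int c \<cdot>\<^sub>v (x @\<^sub>v 0\<^sub>v n2)" by (rule eq_vecI) (use x in auto)
      then show "of_int c \<cdot>\<^sub>v x \<in> ?M" using x Rsm by simp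
    qed auto
    moreover have "roots L1 \<subseteq> ?M"
    proof
      fix x assume x: "x \<in> roots L1"
      then have "x @\<^sub>v 0\<^sub>v n2 \<in> roots ?L" using z2 ip[of x x "0\<^sub>v n2" "0\<^sub>v n2"] by (auto simp: roots_def orth_sum_def)
      then show "x \<in> ?M" using x C1 int_span_superset[OF RC] by (auto simp: roots_def)
    qed
    ultimately show ?thesis using int_span_least[of n1 ?M "roots L1"] r1 by simp
  qed
  have sub2: "L2 \<subseteq> {x \<in> carrier_vec n2. 0\<^sub>v n1 @\<^sub>v x \<in> ?R}" (is "_ \<subseteq> ?M")
  proof -
    have "additive_subgroup n2 ?M"
      unfolding additive_subgroup_def
    proof (intro conjI ballI allI)
      have "0\<^sub>v n1 @\<^sub>v 0\<^sub>v n2 = (0\<^sub>v (n1 + n2) :: real vec)" by (rule eq_vecI) auto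
      then show "0\<^sub>v n2 \<in> ?M" using R0 by simp
    next
      fix x y assume x: "x \<in> ?M" and y: "y \<in> ?M"
      have "0\<^sub>v n1 @\<^sub>v (x + y) = (0\<^sub>v n1 @\<^sub>v x) + (0\<^sub>v n1 @\<^sub>v y)" by (rule eq_vecI) (use x y in auto)
      then show "x + y \<in> ?M" using x y Radd by simp
    next
      fix x and c :: int assume x: "x \<in> ?M"
      have "0\<^sub>v n1 @\<^sub>v (of_int c \<cdot>\<^sub>v x) = of_int c \<cdot>\<^sub>v (0\<^sub>v n1 @\<^sub>v x)" by (rule eq_vecI) (use x in auto)
      then show "of_int c \<cdot>\<^sub>v x \<in> ?M" using x Rsm by simp
    qed auto
    moreover have "roots L2 \<subseteq> ?M"
    proof
      fix x assume x: "x \<in> roots L2"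
      then have "0\<^sub>v n1 @\<^sub>v x \<in> roots ?L" using z1 ip[of "0\<^sub>v n1" "0\<^sub>v n1" x x] by (auto simp: roots_def orth_sum_def)
      then show "x \<in> ?M" using x C2 int_span_superset[OF RC] by (auto simp: roots_def)
    qed
    ultimately show ?thesis using int_span_least[of n2 ?M "roots L2"] r2 by simp
  qed
  have gen: "(if k < d1 then b1 k @\<^sub>v 0\<^sub>v n2 else 0\<^sub>v n1 @\<^sub>v b2 (k - d1)) \<in> ?R" if "k < d1 + d2" for k
  proof (cases "k < d1")
    case False
    then have "b2 (k - d1) \<in> L2" using s2(2)[of "k - d1"] that by simp
    then show ?thesis using False sub2 by auto
  qed (use s1(2)[of k] sub1 in auto)
  show ?thesis by (rule root_latticeI[OF lattice_basis_orth_sum[OF b1 b2] int gen])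
qed

lemma root_lattice_zero: "root_lattice 0 {0\<^sub>v 0}"
proof (rule root_latticeI)
  show "lattice_basis 0 0 {0\<^sub>v 0} (\<lambda>_. 0\<^sub>v 0)" by (auto simp: lattice_basis_def)
  show "integral_lattice {0\<^sub>v 0}" by (simp add: integral_lattice_def scalar_prod_def)
qed simp

text \<open>All conditions are vacuous in rank 0, so the empty sum, which ends every
  \<open>orth_sums\<close>, does not restrict the number of frames.\<close>

lemma has_frames_zero: "has_frames 0 L k"
  by (simp add: has_frames_def frame_vectors_def)

text \<open>The two facts needed for the extremal lattices, bundled for a fixed number of frames k
  so that they pass through iterated orthogonal sums together.\<close>

definition root_lattice_with_frames :: "nat \<Rightarrow> nat \<Rightarrow> real vec set \<Rightarrow> bool" where
  "root_lattice_with_frames k d L \<longleftrightarrow> root_lattice d L \<and> has_frames d L k"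

lemma root_lattice_with_frames_mono:
  "root_lattice_with_frames k d L \<Longrightarrow> k' \<le> k \<Longrightarrow> root_lattice_with_frames k' d L"
  using has_frames_mono by (auto simp: root_lattice_with_frames_def)

lemma root_lattice_with_frames_orth_sum:
  assumes "root_lattice_with_frames k d1 L1" "root_lattice_with_frames k d2 L2"
  shows "root_lattice_with_frames k (d1 + d2) (L1 \<bottom>\<^sub>L L2)"
proof -
  obtain n1 n2 where "additive_subgroup n1 L1" "additive_subgroup n2 L2"
    using root_lattice_subgroup assms unfolding root_lattice_with_frames_def by metis
  then show ?thesis
    using assms root_lattice_orth_sum has_frames_orth_sum unfolding root_lattice_with_frames_def by blast
qed

lemma root_lattice_with_frames_orth_sums:
  assumes "\<And>x. x \<in> set xs \<Longrightarrow> root_lattice_with_frames k (r x) (L x)"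
  shows "root_lattice_with_frames k (\<Sum>x\<leftarrow>xs. r x) (orth_sums (map L xs))"
  using assms
proof (induction xs)
  case Nil
  then show ?case by (simp add: orth_sums_def root_lattice_with_frames_def root_lattice_zero[simplified] has_frames_zero)
next
  case (Cons x xs)
  then show ?case using root_lattice_with_frames_orth_sum[of k "r x" "L x"] by (simp add: orth_sums_def)
qed

lemma root_lattice_with_frames_replicate:
  assumes "root_lattice_with_frames k d L"
  shows "root_lattice_with_frames k (m * d) (orth_sums (replicate m L))"
  using root_lattice_with_frames_orth_sums[of "replicate m ()" k "\<lambda>_. d" "\<lambda>_. L"] assms
  by (simp add: map_replicate_const sum_list_replicate)

section \<open>The lattices \<open>D\<^sub>n\<close>, \<open>E\<^sub>7\<close> and \<open>E\<^sub>8\<close>\<close>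

text \<open>Partner of \<open>i\<close> in the \<open>a\<close>-th round of the round-robin tournament on \<open>p + 1\<close> players,
  \<open>p\<close> odd: distinct \<open>i, j < p\<close> meet when \<open>i + j \<equiv> a\<close> modulo \<open>p\<close>, and the remaining player
  meets \<open>p\<close>.\<close>

definition round_robin :: "nat \<Rightarrow> nat \<Rightarrow> nat \<Rightarrow> nat" where
  "round_robin p a i = (if i = p then (if even a then a div 2 else (a + p) div 2)
     else if 2 * i = a \<or> 2 * i = a + p then p else if i \<le> a then a - i else a + p - i)"

text \<open>For odd p the congruence 2 i = a modulo p has exactly one solution below p; that player
  is left over and meets p. Each round is thus an involution without fixed points.\<close>

lemma round_robin:
  assumes p: "odd p" and a: "a < p" and i: "i \<le> p"
  shows "round_robin p a i \<le> p" "round_robin p a i \<noteq> i" "round_robin p a (round_robin p a i) = i"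
proof -
  obtain m where m: "p = 2 * m + 1" using p by (auto elim: oddE)
  show "round_robin p a i \<le> p" using a i m by (auto simp: round_robin_def)
  show "round_robin p a i \<noteq> i" using a i m by (auto simp: round_robin_def)
  show "round_robin p a (round_robin p a i) = i"
  proof (cases "i = p")
    case True
    then show ?thesis using a m by (auto simp: round_robin_def elim!: oddE)
  next
    case False
    then show ?thesis using a i m by (auto simp: round_robin_def) presburger+
  qed
qed

text \<open>The partner determines the round: a is the residue modulo p of i + j, or of 2 i if the
  partner is p.\<close>

lemma round_robin_distinct:
  assumes p: "odd p" and a: "a < p" and b: "b < p" and i: "i \<le> p" and eq: "round_robin p a i = round_robin p b i"
  shows "a = b"
proof -
  obtain m where m: "p = 2 * m + 1" using p by (auto elim: oddE)
  show ?thesis using a b i eq unfolding round_robin_def m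
    by (auto split: if_splits elim!: oddE evenE)
qed

lemma scalar_prod_lessThan: "y \<in> carrier_vec n \<Longrightarrow> x \<bullet> y = (\<Sum>l<n. x $ l * y $ l)"
  by (simp add: scalar_prod_def atLeast0LessThan)

text \<open>In round a each pair {i, j} of partners with i < j contributes e_i + e_j and e_j - e_i.
  Pairs from different rounds share at most one point, so the inner products between different
  frames are 0, 1 or -1.\<close>

lemma has_frames_D:
  assumes n: "even n" "n \<ge> 2"
  shows "has_frames n (D_lattice n) (n - 1)"
proof -
  define p where "p = n - 1"
  have p: "odd p" and np: "n = Suc p" using n by (auto simp: p_def)
  define \<sigma> where "\<sigma> = round_robin p"
  have \<sigma>n: "\<sigma> a i < n" and \<sigma>ne: "\<sigma> a i \<noteq> i" "i \<noteq> \<sigma> a i" and \<sigma>\<sigma>: "\<sigma> a (\<sigma> a i) = i" if "a < p" "i < n" for a i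
    using round_robin[OF p that(1), of i] that(2) np by (auto simp: \<sigma>_def less_Suc_eq_le)
  have \<sigma>inj: "\<sigma> a i \<noteq> \<sigma> b i" if "a < p" "b < p" "a \<noteq> b" "i < n" for a b i
    using round_robin_distinct[OF p that(1,2), of i] that np by (auto simp: \<sigma>_def)
  define s :: "nat \<Rightarrow> nat \<Rightarrow> real" where "s = (\<lambda>a i. if i < \<sigma> a i then 1 else -1)"
  define v where "v = (\<lambda>a i. vec n (\<lambda>l. if l = i then 1 else if l = \<sigma> a i then s a i else 0))"
  have s1: "s a i = 1 \<or> s a i = -1" for a i by (auto simp: s_def)
  have ip: "v a i \<bullet> y = y $ i + s a i * y $ (\<sigma> a i)" if "a < p" "i < n" "y \<in> carrier_vec n" for a i y
  proof -
    have "v a i \<bullet> y = (\<Sum>l<n. (if l = i then y $ i else 0) + (if l = \<sigma> a i then s a i * y $ (\<sigma> a i) else 0))"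
      unfolding scalar_prod_lessThan[OF that(3)]
      by (rule sum.cong) (use \<sigma>ne[OF that(1,2)] in \<open>auto simp: v_def\<close>)
    then show ?thesis using that \<sigma>n[OF that(1,2)] by (simp add: sum.distrib)
  qed
  have vv: "v a i \<bullet> v b j = (if i = j then 1 else if i = \<sigma> b j then s b j else 0)
      + s a i * (if \<sigma> a i = j then 1 else if \<sigma> a i = \<sigma> b j then s b j else 0)"
    if "a < p" "i < n" "b < p" "j < n" for a i b j
    using ip[of a i "v b j"] that \<sigma>n[of a i] by (simp add: v_def)
  show ?thesis unfolding has_frames_def p_def[symmetric]
  proof (intro exI[of _ v] conjI allI impI)
    fix a assume a: "a < p"
    have "v a i \<in> D_lattice n" if i: "i < n" for i
    proof -
      have "(\<Sum>l<n. v a i $ l) = (\<Sum>l<n. (if l = i then 1 else 0) + (if l = \<sigma> a i then s a i else 0))"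
        by (rule sum.cong) (use i \<sigma>ne[OF a i] in \<open>auto simp: v_def\<close>)
      also have "\<dots> = 1 + s a i" using i \<sigma>n[OF a i] by (simp add: sum.distrib)
      also have "\<dots> = 2 * of_int (if i < \<sigma> a i then 1 else 0)" by (simp add: s_def)
      finally have "\<exists>m::int. (\<Sum>l<n. v a i $ l) = 2 * of_int m" by blast
      then show ?thesis by (auto simp: D_lattice_def v_def s_def)
    qed
    moreover have "v a i \<bullet> v a j = (if i = j then 2 else 0)" if ij: "i < n" "j < n" for i j
    proof (cases "i = j")
      case True
      then show ?thesis using vv[OF a ij(1) a ij(2)] \<sigma>ne[OF a ij(2)] s1[of a j] by auto
    next
      case False
      have "\<sigma> a i \<noteq> \<sigma> a j" using \<sigma>\<sigma>[OF a ij(1)] \<sigma>\<sigma>[OF a ij(2)] False by metis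
      moreover have "i = \<sigma> a j \<longleftrightarrow> \<sigma> a i = j" using \<sigma>\<sigma>[OF a ij(1)] \<sigma>\<sigma>[OF a ij(2)] by metis
      ultimately show ?thesis using vv[OF a ij(1) a ij(2)] False by (auto simp: s_def)
    qed
    ultimately show "frame_vectors n (D_lattice n) (v a)" by (simp add: frame_vectors_def)
  next
    fix a b i j assume ab: "a < p" "b < p" "a \<noteq> b" and ij: "i < n" "j < n"
    show "\<bar>v a i \<bullet> v b j\<bar> \<noteq> 2"
    proof (cases "i = j")
      case True
      then show ?thesis
        using vv[OF ab(1) ij(1) ab(2) ij(2)] \<sigma>ne[OF ab(1) ij(2)] \<sigma>inj[OF ab ij(2)] by simp
    next
      case False
      have "\<sigma> a i \<noteq> j \<and> \<sigma> a i \<noteq> \<sigma> b j" if "i = \<sigma> b j"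
        using that \<sigma>\<sigma>[OF ab(2) ij(2)] \<sigma>inj[OF ab ij(1)] \<sigma>ne[OF ab(1) ij(1)] by metis
      then show ?thesis
        using vv[OF ab(1) ij(1) ab(2) ij(2)] False s1[of a i] s1[of b j] by (cases "i = \<sigma> b j") auto
    qed
  qed
qed

section \<open>Integrality, and \<open>D_lattice\<close> as a root lattice\<close>

lemma lattice_basis_integral:
  assumes b: "lattice_basis n d L b" and int: "\<And>k l. k < d \<Longrightarrow> l < d \<Longrightarrow> b k \<bullet> b l \<in> \<int>"
  shows "integral_lattice L"
  unfolding integral_lattice_def
proof (intro ballI)
  fix x y assume x: "x \<in> L" and y: "y \<in> L"
  have bC: "b k \<in> carrier_vec n" if "k < d" for k using lattice_basis_carrier[OF b that] .
  have ex: "\<exists>c :: nat \<Rightarrow> int. z \<in> carrier_vec n \<and> (\<forall>i<n. z $ i = (\<Sum>k<d. of_int (c k) * b k $ i))" if z: "z \<in> L" for z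
  proof -
    have "z \<in> {x \<in> carrier_vec n. \<exists>c :: nat \<Rightarrow> int. \<forall>i<n. x $ i = (\<Sum>k<d. of_int (c k) * b k $ i)}"
      using z lattice_basis_eq[OF b] by (rule subst[rotated])
    then show ?thesis by blast
  qed
  obtain c where c: "x \<in> carrier_vec n" "\<forall>i<n. x $ i = (\<Sum>k<d. of_int (c k) * b k $ i)" using ex[OF x] by blast
  obtain e where e: "y \<in> carrier_vec n" "\<forall>i<n. y $ i = (\<Sum>k<d. of_int (e k) * b k $ i)" using ex[OF y] by blast
  have "x \<bullet> y = (\<Sum>k<d. of_int (c k) * (b k \<bullet> y))" by (rule scalar_prod_sum_left) (use c e bC in auto)
  also have "\<dots> = (\<Sum>k<d. of_int (c k) * (y \<bullet> b k))"
    by (rule sum.cong) (use comm_scalar_prod bC e in auto)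
  also have "\<dots> = (\<Sum>k<d. of_int (c k) * (\<Sum>l<d. of_int (e l) * (b l \<bullet> b k)))"
  proof (rule sum.cong)
    fix k assume "k \<in> {..<d}"
    then have "y \<bullet> b k = (\<Sum>l<d. of_int (e l) * (b l \<bullet> b k))"
      by (intro scalar_prod_sum_left) (use e bC in auto)
    then show "of_int (c k) * (y \<bullet> b k) = of_int (c k) * (\<Sum>l<d. of_int (e l) * (b l \<bullet> b k))" by simp
  qed simp
  also have "\<dots> \<in> \<int>" using int by (auto intro!: Ints_sum Ints_mult)
  finally show "x \<bullet> y \<in> \<int>" .
qed

lemma root_lattice_D:
  assumes n: "n \<ge> 2"
  shows "root_lattice n (D_lattice n)"
proof -
  \<comment> \<open>The basis is 2 e_0 together with e_0 + e_k for 0 < k < n.\<close>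
  define b where "b = (\<lambda>k. vec n (\<lambda>i. if i = 0 then (if k = 0 then 2 else 1) else if i = k then 1 else 0 :: real))"
  have bi: "b k $ i = (if i = 0 then (if k = 0 then 2 else 1) else if i = k then 1 else 0)" if "i < n" for k i
    using that by (simp add: b_def)
  have sum_b: "(\<Sum>k<n. r k * b k $ i) = (if i = 0 then r 0 + (\<Sum>k<n. r k) else r i)" if i: "i < n" for r :: "nat \<Rightarrow> real" and i
  proof (cases "i = 0")
    case True
    have "(\<Sum>k<n. r k * b k $ i) = (\<Sum>k<n. (if k = 0 then r 0 else 0) + r k)"
      by (rule sum.cong) (use i True in \<open>auto simp: bi\<close>)
    then show ?thesis using n True by (simp add: sum.distrib)
  next
    case False
    have "(\<Sum>k<n. r k * b k $ i) = (\<Sum>k<n. if k = i then r i else 0)"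
      by (rule sum.cong) (use i False in \<open>auto simp: bi\<close>)
    then show ?thesis using i False by simp
  qed
  have n0: "0 < n" using n by simp
  have split0: "(\<Sum>i<n. f i) = f 0 + (\<Sum>i\<in>{..<n} - {0}. f i)" for f :: "nat \<Rightarrow> real"
    using n0 by (simp add: sum.remove)
  have indep: "r k = 0" if r: "\<forall>i<n. (\<Sum>k<n. r k * b k $ i) = 0" and k: "k < n" for r :: "nat \<Rightarrow> real" and k
  proof -
    have pos: "r i = 0" if "i < n" "i \<noteq> 0" for i using r sum_b[OF that(1), of r] that by auto
    then have "(\<Sum>k<n. r k) = r 0" by (simp add: split0)
    then have "r 0 = 0" using r sum_b[OF n0, of r] n0 by simp
    then show ?thesis using pos k by (cases "k = 0") auto
  qed
  have eq: "D_lattice n = {x \<in> carrier_vec n. \<exists>c :: nat \<Rightarrow> int. \<forall>i<n. x $ i = (\<Sum>k<n. of_int (c k) * b k $ i)}" (is "_ = ?R")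
  proof (intro Set.set_eqI iffI)
    fix x assume x: "x \<in> D_lattice n"
    then obtain m :: int where xc: "x \<in> carrier_vec n" and xi: "\<And>i. i < n \<Longrightarrow> x $ i \<in> \<int>"
      and m: "(\<Sum>i<n. x $ i) = 2 * of_int m" by (auto simp: D_lattice_def)
    \<comment> \<open>Coordinate 0 reads x_0 = 2 c_0 + (2 m - x_0), where 2 m is the sum of all
      coordinates; so c_0 = x_0 - m.\<close>
    define c where "c = (\<lambda>k. if k = 0 then \<lfloor>x $ 0\<rfloor> - m else \<lfloor>x $ k\<rfloor>)"
    have fl: "of_int \<lfloor>x $ i\<rfloor> = x $ i" if "i < n" for i using xi[OF that] by (auto elim: Ints_cases)
    have c: "of_int (c k) = x $ k - (if k = 0 then of_int m else 0)" if "k < n" for k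
      using fl[OF that] by (auto simp: c_def)
    have "(\<Sum>k<n. of_int (c k)) = (\<Sum>k<n. x $ k - (if k = 0 then of_int m else 0 :: real))"
      by (rule sum.cong) (use c in auto)
    also have "\<dots> = of_int m" using m n0 by (simp add: sum_subtractf)
    finally have "(\<Sum>k<n. of_int (c k) :: real) = of_int m" .
    then have "x $ i = (\<Sum>k<n. of_int (c k) * b k $ i)" if "i < n" for i
      using sum_b[OF that, of "\<lambda>k. of_int (c k)"] c[OF that] c[OF n0] by auto
    then show "x \<in> ?R" using xc by blast
  next
    fix x assume "x \<in> ?R"
    then obtain c :: "nat \<Rightarrow> int" where xc: "x \<in> carrier_vec n"
      and c: "\<forall>i<n. x $ i = (\<Sum>k<n. of_int (c k) * b k $ i)" by blast
    have x: "x $ i = (if i = 0 then of_int (c 0) + (\<Sum>k<n. of_int (c k)) else of_int (c i))" if "i < n" for i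
      using c sum_b[OF that, of "\<lambda>k. of_int (c k)"] that by simp
    have "x $ i \<in> \<int>" if "i < n" for i using x[OF that] by (auto intro!: Ints_add Ints_sum)
    moreover have "(\<Sum>i<n. x $ i) = 2 * of_int (\<Sum>k<n. c k)"
    proof -
      have "(\<Sum>i\<in>{..<n} - {0}. x $ i) = (\<Sum>i\<in>{..<n} - {0}. of_int (c i))"
        by (rule sum.cong) (use x in auto)
      then show ?thesis using x[OF n0] split0[of "\<lambda>i. x $ i"] split0[of "\<lambda>i. of_int (c i)"] by simp
    qed
    then have "\<exists>m::int. (\<Sum>i<n. x $ i) = 2 * of_int m" by blast
    ultimately show "x \<in> D_lattice n" using xc by (auto simp: D_lattice_def)
  qed
  have basis: "lattice_basis n n (D_lattice n) b" unfolding lattice_basis_def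
  proof (intro conjI allI impI)
    show "r k = 0" if "\<forall>i<n. (\<Sum>k<n. r k * b k $ i) = 0" "k < n" for r :: "nat \<Rightarrow> real" and k
      by (rule indep[OF that])
  qed (simp add: b_def, rule eq)
  have int: "integral_lattice (D_lattice n)"
    by (auto simp: integral_lattice_def D_lattice_def scalar_prod_def intro!: Ints_sum Ints_mult)
  let ?R = "int_span n (roots (D_lattice n))"
  have RC: "roots (D_lattice n) \<subseteq> carrier_vec n" by (auto simp: roots_def D_lattice_def)
  note R = additive_subgroup_int_span[OF RC]
  have bD: "b k \<in> D_lattice n" if "k < n" for k using lattice_basis_subgroup(2)[OF basis that] .
  have root: "b k \<in> ?R" if k: "k < n" "k \<noteq> 0" for k
  proof -
    have "b k \<bullet> b k = (\<Sum>i<n. (if i = 0 then 1 else 0) + (if i = k then 1 else 0))"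
      by (subst scalar_prod_lessThan[of _ n], simp add: b_def, rule sum.cong) (use k in \<open>auto simp: b_def\<close>)
    also have "\<dots> = 2" using k n0 by (simp add: sum.distrib)
    finally show ?thesis using bD[OF k(1)] int_span_superset[OF RC] by (auto simp: roots_def)
  qed
  \<comment> \<open>The basis vector 2 e_0 has norm 4; it is the sum of the roots e_0 + e_1 and u =
    e_0 - e_1.\<close>
  define u where "u = vec n (\<lambda>i. if i = 0 then 1 else if i = 1 then -1 else 0 :: real)"
  have u: "u \<in> ?R"
  proof -
    have "(\<Sum>i<n. u $ i) = (\<Sum>i<n. (if i = 0 then 1 else 0) + (if i = 1 then -1 else 0))"
      by (rule sum.cong) (auto simp: u_def)
    also have "\<dots> = 0" using n by (simp add: sum.distrib)
    finally have "u \<in> D_lattice n" by (auto simp: D_lattice_def u_def intro!: exI[of _ "0::int"])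
    moreover have "u \<bullet> u = (\<Sum>i<n. (if i = 0 then 1 else 0) + (if i = 1 then 1 else 0))"
      by (subst scalar_prod_lessThan[of _ n], simp add: u_def, rule sum.cong) (auto simp: u_def)
    then have "u \<bullet> u = 2" using n by (simp add: sum.distrib)
    ultimately show ?thesis using int_span_superset[OF RC] by (auto simp: roots_def)
  qed
  have "b 0 = b 1 + u" by (rule eq_vecI) (auto simp: b_def u_def)
  then have "b 0 \<in> ?R" using root[of 1] u R n by (auto simp: additive_subgroup_def)
  then have "b k \<in> ?R" if "k < n" for k using root that by (cases "k = 0") auto
  then show ?thesis by (rule root_latticeI[OF basis int])
qed

section \<open>The lattice E_8\<close>

lemma sum_lessThan_8: "(\<Sum>i<8. f i) = f 0 + f 1 + f 2 + f 3 + f 4 + f 5 + f 6 + f (7 :: nat)"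
  by (simp add: eval_nat_numeral)

lemma sum_lessThan_7: "(\<Sum>i<7. f i) = f 0 + f 1 + f 2 + f 3 + f 4 + f 5 + f (6 :: nat)"
  by (simp add: eval_nat_numeral)

lemma all_less_8: "(\<forall>i<8. P i) \<longleftrightarrow> P 0 \<and> P 1 \<and> P 2 \<and> P 3 \<and> P 4 \<and> P 5 \<and> P 6 \<and> P (7 :: nat)"
  by (auto simp: numeral_eq_Suc All_less_Suc)

lemma all_less_7: "(\<forall>i<7. P i) \<longleftrightarrow> P 0 \<and> P 1 \<and> P 2 \<and> P 3 \<and> P 4 \<and> P 5 \<and> P (6 :: nat)"
  by (auto simp: numeral_eq_Suc All_less_Suc)

text \<open>The shift e treats integral and half-odd vectors alike, so that coefficients in a basis
  can be computed without splitting each coordinate.\<close>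

lemma E8_lattice_iff:
  "x \<in> E8_lattice \<longleftrightarrow> x \<in> carrier_vec 8 \<and>
    (\<exists>z :: nat \<Rightarrow> int. \<exists>e \<in> {0, 1 / 2}. \<exists>m :: int. (\<forall>i<8. x $ i = of_int (z i) - e) \<and> (\<Sum>i<8. x $ i) = 2 * of_int m)"
proof -
  have "(\<forall>i<8. x $ i \<in> \<int>) \<longleftrightarrow> (\<exists>z :: nat \<Rightarrow> int. \<forall>i<8. x $ i = of_int (z i) - 0)"
  proof
    assume "\<forall>i<8. x $ i \<in> \<int>"
    then show "\<exists>z :: nat \<Rightarrow> int. \<forall>i<8. x $ i = of_int (z i) - 0"
      by (intro exI[of _ "\<lambda>i. \<lfloor>x $ i\<rfloor>"]) (auto elim: Ints_cases)
  qed auto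
  moreover have "(\<forall>i<8. x $ i + 1 / 2 \<in> \<int>) \<longleftrightarrow> (\<exists>z :: nat \<Rightarrow> int. \<forall>i<8. x $ i = of_int (z i) - 1 / 2)"
  proof
    assume h: "\<forall>i<8. x $ i + 1 / 2 \<in> \<int>"
    have "x $ i = of_int \<lfloor>x $ i + 1 / 2\<rfloor> - 1 / 2" if "i < 8" for i
    proof -
      have "of_int \<lfloor>x $ i + 1 / 2\<rfloor> = x $ i + 1 / 2" using h that by (metis floor_of_int Ints_cases)
      then show ?thesis by linarith
    qed
    then show "\<exists>z :: nat \<Rightarrow> int. \<forall>i<8. x $ i = of_int (z i) - 1 / 2" by (intro exI[of _ "\<lambda>i. \<lfloor>x $ i + 1 / 2\<rfloor>"]) simp
  qed auto
  ultimately have eq: "((\<forall>i<8. x $ i \<in> \<int>) \<or> (\<forall>i<8. x $ i + 1 / 2 \<in> \<int>)) \<longleftrightarrow>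
      (\<exists>z :: nat \<Rightarrow> int. \<exists>e \<in> {0, 1 / 2}. \<forall>i<8. x $ i = of_int (z i) - e)"
    by (simp only: bex_simps ex_disj_distrib simp_thms)
  show ?thesis unfolding E8_lattice_def mem_Collect_eq eq by blast
qed

lemma E8_lattice_subset: "E8_lattice \<subseteq> carrier_vec 8"
  by (auto simp: E8_lattice_def)

text \<open>The vectors are (1/2, ..., 1/2), e_0 + e_k for k = 1, ..., 6, and 2 e_0. Coordinate 7 is
  nonzero only in the first of them and coordinates 1 to 6 then determine the next six coefficients,
  so the system is triangular.\<close>

definition E8_basis :: "nat \<Rightarrow> real vec" where
  "E8_basis k = vec 8 (\<lambda>i. if k = 0 then 1 / 2 else if k = 7 then (if i = 0 then 2 else 0)
     else if i = 0 \<or> i = k then 1 else 0)"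

lemma E8_basis_index:
  "i < 8 \<Longrightarrow> E8_basis k $ i = (if k = 0 then 1 / 2 else if k = 7 then (if i = 0 then 2 else 0)
     else if i = 0 \<or> i = k then 1 else 0)"
  by (simp add: E8_basis_def)

lemma sum_E8_basis:
  assumes "i < 8"
  shows "(\<Sum>k<8. r k * E8_basis k $ i) = r 0 / 2 +
    (if i = 0 then r 1 + r 2 + r 3 + r 4 + r 5 + r 6 + 2 * r 7 else if i = 7 then 0 else r i)"
proof -
  have "\<forall>i<8. (\<Sum>k<8. r k * E8_basis k $ i) = r 0 / 2 +
    (if i = 0 then r 1 + r 2 + r 3 + r 4 + r 5 + r 6 + 2 * r 7 else if i = 7 then 0 else r i)"
    unfolding all_less_8 sum_lessThan_8 by (simp add: E8_basis_index)
  then show ?thesis using assms by blast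
qed

lemma lattice_basis_E8: "lattice_basis 8 8 E8_lattice E8_basis"
  unfolding lattice_basis_def
proof (intro conjI allI impI)
  show "E8_basis k \<in> carrier_vec 8" if "k < 8" for k by (simp add: E8_basis_def)
next
  fix r :: "nat \<Rightarrow> real" and k :: nat
  assume r: "\<forall>i<8. (\<Sum>k<8. r k * E8_basis k $ i) = 0" and k: "k < 8"
  have r': "r 0 / 2 + (if i = 0 then r 1 + r 2 + r 3 + r 4 + r 5 + r 6 + 2 * r 7 else if i = 7 then 0 else r i) = 0"
    if "i < 8" for i using r sum_E8_basis[OF that, of r] that by simp
  have r0: "r 0 = 0" using r'[of 7] by simp
  have mid: "r j = 0" if "j < 7" for j using r'[of j] r0 that by (cases "j = 0") auto
  have "r 7 = 0" using r'[of 0] mid[of 0] mid[of 1] mid[of 2] mid[of 3] mid[of 4] mid[of 5] mid[of 6] by simp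
  then show "r k = 0" using mid[of k] k by (cases "k = 7") auto
next
  show "E8_lattice = {x \<in> carrier_vec 8. \<exists>c :: nat \<Rightarrow> int. \<forall>i<8. x $ i = (\<Sum>k<8. of_int (c k) * E8_basis k $ i)}" (is "_ = ?R")
  proof (intro Set.set_eqI iffI)
    fix x assume "x \<in> E8_lattice"
    then obtain z :: "nat \<Rightarrow> int" and e m where xc: "x \<in> carrier_vec 8" and e: "e \<in> {0, 1 / 2}"
      and z: "\<forall>i<8. x $ i = of_int (z i) - e" and m: "(\<Sum>i<8. x $ i) = 2 * of_int m"
      unfolding E8_lattice_iff by blast
    \<comment> \<open>Solving from coordinate 7 gives c_0 = 2 x_7, then c_k = x_k - x_7, and
      coordinate 0 with the sum 2 m gives c_7 = x_0 + 3 x_7 - m.\<close>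
    define c where "c = (\<lambda>k. if k = 0 then 2 * z 7 - (if e = 0 then 0 else 1)
      else if k = 7 then z 0 + 3 * z 7 - m - (if e = 0 then 0 else 2) else z k - z 7)"
    have "(\<Sum>i<8. of_int (z i) - e) = 2 * of_int m" using z m by (simp cong: sum.cong_simp)
    then have m': "of_int (z 0) + of_int (z 1) + of_int (z 2) + of_int (z 3) + of_int (z 4) + of_int (z 5)
        + of_int (z 6) + of_int (z 7) - 8 * e = 2 * of_int m"
      by (simp add: sum_lessThan_8)
    have c0: "of_int (c 0) / 2 = of_int (z 7) - e" using e by (auto simp: c_def field_simps)
    have ck: "of_int (c k) = (of_int (z k) - of_int (z 7) :: real)" if "k \<noteq> 0" "k \<noteq> 7" for k using that by (simp add: c_def)
    have c7: "of_int (c 7) = of_int (z 0) + 3 * of_int (z 7) - of_int m - 4 * e" using e by (auto simp: c_def)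
    have "x $ i = (\<Sum>k<8. of_int (c k) * E8_basis k $ i)" if i: "i < 8" for i
      unfolding sum_E8_basis[OF i] c0 c7 using z i m' ck[of i] ck[of 1] ck[of 2] ck[of 3] ck[of 4] ck[of 5] ck[of 6]
      by (cases "i = 0"; cases "i = 7") simp_all
    then show "x \<in> ?R" using xc by blast
  next
    fix x assume "x \<in> ?R"
    then obtain c :: "nat \<Rightarrow> int" where xc: "x \<in> carrier_vec 8"
      and c: "\<forall>i<8. x $ i = (\<Sum>k<8. of_int (c k) * E8_basis k $ i)" by blast
    \<comment> \<open>q is half of c 0 rounded up, and e is the amount added by rounding.\<close>
    define q where "q = (c 0 + 1) div 2"
    define e :: real where "e = (if even (c 0) then 0 else 1 / 2)"
    have q: "of_int (c 0) / 2 = of_int q - e"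
      by (cases "even (c 0)") (auto simp: q_def e_def elim!: evenE oddE)
    define z where "z = (\<lambda>i. if i = 0 then q + c 1 + c 2 + c 3 + c 4 + c 5 + c 6 + 2 * c 7
      else if i = 7 then q else q + c i)"
    have "\<forall>i<8. x $ i = of_int (z i) - e"
      using c q by (auto simp: sum_E8_basis z_def)
    moreover have "(\<Sum>i<8. x $ i) = 2 * of_int (2 * c 0 + c 1 + c 2 + c 3 + c 4 + c 5 + c 6 + c 7)"
      unfolding sum_lessThan_8 using c by (simp add: sum_E8_basis)
    moreover have "e \<in> {0, 1 / 2}" by (simp add: e_def)
    ultimately show "x \<in> E8_lattice" unfolding E8_lattice_iff using xc by blast
  qed
qed

lemma scalar_prod_8: "y \<in> carrier_vec 8 \<Longrightarrow> x \<bullet> y = x $ 0 * y $ 0 + x $ 1 * y $ 1 + x $ 2 * y $ 2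
    + x $ 3 * y $ 3 + x $ 4 * y $ 4 + x $ 5 * y $ 5 + x $ 6 * y $ 6 + x $ 7 * y $ 7"
  by (simp only: scalar_prod_lessThan sum_lessThan_8)

lemma integral_E8: "integral_lattice E8_lattice"
proof (rule lattice_basis_integral[OF lattice_basis_E8])
  fix k l :: nat assume kl: "k < 8" "l < 8"
  have "\<forall>k<8. \<forall>l<8. E8_basis k \<bullet> E8_basis l \<in> \<int>"
    unfolding all_less_8
    by (simp add: scalar_prod_8[OF lattice_basis_carrier[OF lattice_basis_E8]] E8_basis_index)
  then show "E8_basis k \<bullet> E8_basis l \<in> \<int>" using kl by blast
qed

lemma root_lattice_E8: "root_lattice 8 E8_lattice"
proof (rule root_latticeI[OF lattice_basis_E8 integral_E8])
  let ?R = "int_span 8 (roots E8_lattice)"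
  have RC: "roots E8_lattice \<subseteq> carrier_vec 8" using E8_lattice_subset by (auto simp: roots_def)
  note R = additive_subgroup_int_span[OF RC]
  have "\<forall>k<7. E8_basis k \<bullet> E8_basis k = 2"
    unfolding all_less_7
    by (simp add: scalar_prod_8[OF lattice_basis_carrier[OF lattice_basis_E8]] E8_basis_index)
  then have root: "E8_basis k \<in> ?R" if "k < 7" for k
    using that lattice_basis_subgroup(2)[OF lattice_basis_E8, of k] int_span_superset[OF RC] by (auto simp: roots_def)
  \<comment> \<open>Only 2 e_0 fails to be a root among the basis vectors; it equals (e_0 + e_1) +
    (e_0 - e_1).\<close>
  define u :: "real vec" where "u = vec 8 (\<lambda>i. if i = 0 then 1 else if i = 1 then -1 else 0)"
  have uc: "u \<in> carrier_vec 8" by (simp add: u_def)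
  have "u \<in> E8_lattice"
    by (auto simp: E8_lattice_def u_def sum_lessThan_8)
  moreover have "u \<bullet> u = 2" unfolding scalar_prod_8[OF uc] by (simp add: u_def)
  ultimately have "u \<in> ?R" using int_span_superset[OF RC] by (auto simp: roots_def)
  moreover have "E8_basis 7 = E8_basis 1 + u" by (rule eq_vecI) (auto simp: E8_basis_def u_def)
  ultimately have "E8_basis 7 \<in> ?R" using root[of 1] R by (auto simp: additive_subgroup_def)
  then show "E8_basis k \<in> ?R" if "k < 8" for k
    using root[of k] that by (cases "k = 7") auto
qed

section \<open>The lattice E_7\<close>

lemma E7_lattice_iff: "x \<in> E7_lattice \<longleftrightarrow> x \<in> E8_lattice \<and> (\<Sum>i<8. x $ i) = 0"
proof -
  have "x \<bullet> vec 8 (\<lambda>_. 1 / 2) = (\<Sum>i<8. x $ i) / 2"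
    by (subst scalar_prod_lessThan[of _ 8]) (auto simp: sum_divide_distrib)
  then show ?thesis by (auto simp: E7_lattice_def)
qed

text \<open>A root with four entries 1/2 and four entries -1/2, and the roots e_k - e_0 for k = 1,
  ..., 6. Again only the first vector is nonzero in coordinate 7; all seven vectors have norm
  2.\<close>

definition E7_basis :: "nat \<Rightarrow> real vec" where
  "E7_basis k = vec 8 (\<lambda>i. if k = 0 then (if i < 4 then 1 / 2 else - 1 / 2)
     else if i = 0 then - 1 else if i = k then 1 else 0)"

lemma E7_basis_index:
  "i < 8 \<Longrightarrow> E7_basis k $ i = (if k = 0 then (if i < 4 then 1 / 2 else - 1 / 2)
     else if i = 0 then - 1 else if i = k then 1 else 0)"
  by (simp add: E7_basis_def)

lemma sum_E7_basis:
  assumes "i < 8"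
  shows "(\<Sum>k<7. r k * E7_basis k $ i) = (if i < 4 then r 0 / 2 else - (r 0 / 2)) +
    (if i = 0 then - (r 1 + r 2 + r 3 + r 4 + r 5 + r 6) else if i = 7 then 0 else r i)"
proof -
  have "\<forall>i<8. (\<Sum>k<7. r k * E7_basis k $ i) = (if i < 4 then r 0 / 2 else - (r 0 / 2)) +
    (if i = 0 then - (r 1 + r 2 + r 3 + r 4 + r 5 + r 6) else if i = 7 then 0 else r i)"
    unfolding all_less_8 sum_lessThan_7 by (simp add: E7_basis_index)
  then show ?thesis using assms by blast
qed

lemma lattice_basis_E7: "lattice_basis 8 7 E7_lattice E7_basis"
  unfolding lattice_basis_def
proof (intro conjI allI impI)
  show "E7_basis k \<in> carrier_vec 8" if "k < 7" for k by (simp add: E7_basis_def)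
next
  fix r :: "nat \<Rightarrow> real" and k :: nat
  assume r: "\<forall>i<8. (\<Sum>k<7. r k * E7_basis k $ i) = 0" and k: "k < 7"
  have r': "(if i < 4 then r 0 / 2 else - (r 0 / 2)) +
      (if i = 0 then - (r 1 + r 2 + r 3 + r 4 + r 5 + r 6) else if i = 7 then 0 else r i) = 0"
    if "i < 8" for i using r sum_E7_basis[OF that, of r] that by simp
  have r0: "r 0 = 0" using r'[of 7] by simp
  then show "r k = 0" using r'[of k] k by (cases "k = 0") (auto split: if_splits)
next
  show "E7_lattice = {x \<in> carrier_vec 8. \<exists>c :: nat \<Rightarrow> int. \<forall>i<8. x $ i = (\<Sum>k<7. of_int (c k) * E7_basis k $ i)}" (is "_ = ?R")
  proof (intro Set.set_eqI iffI)
    fix x assume "x \<in> E7_lattice"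
    then have x8: "x \<in> E8_lattice" and x0: "(\<Sum>i<8. x $ i) = 0" by (auto simp: E7_lattice_iff)
    then obtain z :: "nat \<Rightarrow> int" and e where xc: "x \<in> carrier_vec 8" and e: "e \<in> {0, 1 / 2}"
      and z: "\<forall>i<8. x $ i = of_int (z i) - e"
      unfolding E8_lattice_iff by blast
    \<comment> \<open>Coordinate 7 gives c_0 = -2 x_7. The other coefficients are x_k + x_7 for k <
      4 and x_k - x_7 from 4 on, and coordinate 0 is then right because the coordinates sum to
      0.\<close>
    define c where "c = (\<lambda>k. if k = 0 then (if e = 0 then 0 else 1) - 2 * z 7
      else if k < 4 then z k + z 7 - (if e = 0 then 0 else 1) else z k - z 7)"
    have "(\<Sum>i<8. of_int (z i) - e) = 0" using z x0 by (simp cong: sum.cong_simp)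
    then have x0': "of_int (z 0) + of_int (z 1) + of_int (z 2) + of_int (z 3) + of_int (z 4) + of_int (z 5)
        + of_int (z 6) + of_int (z 7) - 8 * e = 0"
      by (simp add: sum_lessThan_8)
    have c0: "of_int (c 0) / 2 = e - of_int (z 7)" using e by (auto simp: c_def field_simps)
    have lo: "of_int (c k) = of_int (z k) + of_int (z 7) - 2 * e" if "k \<noteq> 0" "k < 4" for k using that e by (auto simp: c_def)
    have hi: "of_int (c k) = (of_int (z k) - of_int (z 7) :: real)" if "\<not> k < 4" for k using that by (simp add: c_def)
    have "x $ i = (\<Sum>k<7. of_int (c k) * E7_basis k $ i)" if i: "i < 8" for i
      unfolding sum_E7_basis[OF i] c0 using z i x0' lo[of i] hi[of i] lo[of 1] lo[of 2] lo[of 3] hi[of 4] hi[of 5] hi[of 6]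
      by (cases "i = 0"; cases "i = 7"; cases "i < 4") simp_all
    then show "x \<in> ?R" using xc by blast
  next
    fix x assume "x \<in> ?R"
    then obtain c :: "nat \<Rightarrow> int" where xc: "x \<in> carrier_vec 8"
      and c: "\<forall>i<8. x $ i = (\<Sum>k<7. of_int (c k) * E7_basis k $ i)" by blast
    define q where "q = (c 0 + 1) div 2"
    define e :: real where "e = (if even (c 0) then 0 else 1 / 2)"
    have q: "of_int (c 0) / 2 = of_int q - e"
      by (cases "even (c 0)") (auto simp: q_def e_def elim!: evenE oddE)
    have q': "- (of_int (c 0) / 2) = of_int (q - c 0) - e"
      by (cases "even (c 0)") (auto simp: q_def e_def field_simps elim!: evenE oddE)
    define z where "z = (\<lambda>i. if i = 0 then q - (c 1 + c 2 + c 3 + c 4 + c 5 + c 6)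
      else if i = 7 then q - c 0 else if i < 4 then q + c i else q - c 0 + c i)"
    have "\<forall>i<8. x $ i = of_int (z i) - e"
      using c q q' by (auto simp: sum_E7_basis z_def)
    moreover have x0: "(\<Sum>i<8. x $ i) = 0"
      unfolding sum_lessThan_8 using c by (simp add: sum_E7_basis)
    then have "(\<Sum>i<8. x $ i) = 2 * of_int 0" by simp
    moreover have "e \<in> {0, 1 / 2}" by (simp add: e_def)
    ultimately show "x \<in> E7_lattice" unfolding E7_lattice_iff E8_lattice_iff using xc x0 by blast
  qed
qed

lemma root_lattice_E7: "root_lattice 7 E7_lattice"
proof (rule root_latticeI[OF lattice_basis_E7])
  have sub: "E7_lattice \<subseteq> E8_lattice" by (auto simp: E7_lattice_def)
  then show "integral_lattice E7_lattice" using integral_E8 by (auto simp: integral_lattice_def)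
  have RC: "roots E7_lattice \<subseteq> carrier_vec 8" using sub E8_lattice_subset by (auto simp: roots_def)
  have "\<forall>k<7. E7_basis k \<bullet> E7_basis k = 2"
    unfolding all_less_7
    by (simp add: scalar_prod_8[OF lattice_basis_carrier[OF lattice_basis_E7]] E7_basis_index)
  then show "E7_basis k \<in> int_span 8 (roots E7_lattice)" if "k < 7" for k
    using that lattice_basis_subgroup(2)[OF lattice_basis_E7, of k] int_span_superset[OF RC] by (auto simp: roots_def)
qed

section \<open>Frames from integer tables\<close>

definition dot_list :: "int list \<Rightarrow> int list \<Rightarrow> int" where
  "dot_list xs ys = sum_list (map2 (*) xs ys)"

definition cyclic_shift7 :: "nat \<Rightarrow> int list \<Rightarrow> int list" where
  "cyclic_shift7 a xs = rotate a (take 7 xs) @ drop 7 xs"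

text \<open>Doubled coordinates of nine frames that partition the 63 pairs of roots of \<open>E\<^sub>7\<close>, found by
  computer among the partitions invariant under the cyclic shift of the first seven
  coordinates.\<close>

definition E7_table :: "int list list list" where
  "E7_table = map (\<lambda>a. map (cyclic_shift7 a)
      [[2, -2, 0, 0, 0, 0, 0, 0], [1, 1, -1, 1, -1, 1, -1, -1], [1, 1, -1, -1, 1, -1, -1, 1],
       [0, 0, 2, 0, 0, 0, -2, 0], [0, 0, 0, 2, 0, -2, 0, 0], [0, 0, 0, 0, 2, 0, 0, -2],
       [1, 1, 1, -1, -1, -1, 1, -1]]) [0..<7] @
    map (\<lambda>xs. map (\<lambda>a. cyclic_shift7 a xs) [0..<7])
      [[1, 1, -1, 1, -1, -1, 1, -1], [1, 1, -1, 1, -1, -1, -1, 1]]"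

text \<open>Doubled coordinates again: each frame is the Sylvester Hadamard matrix of order 8 (the affine
  sign functions on the cube up to sign) twisted by the signs of one of the eight quadratic forms without
  square terms in three bits, that is, a coset of the first order Reed-Muller code of length 8.\<close>

definition E8_spin_table :: "int list list list" where
  "E8_spin_table = map (\<lambda>s. map (map2 (*) s)
      [[1, 1, 1, 1, 1, 1, 1, 1], [1, -1, 1, -1, 1, -1, 1, -1],
       [1, 1, -1, -1, 1, 1, -1, -1], [1, -1, -1, 1, 1, -1, -1, 1],
       [1, 1, 1, 1, -1, -1, -1, -1], [1, -1, 1, -1, -1, 1, -1, 1],
       [1, 1, -1, -1, -1, -1, 1, 1], [1, -1, -1, 1, -1, 1, 1, -1]])
      [[1, 1, 1, 1, 1, 1, 1, 1], [1, 1, 1, -1, 1, 1, 1, -1],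
       [1, 1, 1, 1, 1, -1, 1, -1], [1, 1, 1, -1, 1, -1, 1, 1],
       [1, 1, 1, 1, 1, 1, -1, -1], [1, 1, 1, -1, 1, 1, -1, 1],
       [1, 1, 1, 1, 1, -1, -1, 1], [1, 1, 1, -1, 1, -1, -1, -1]]"

text \<open>Doubling the coordinates multiplies inner products by 4, so norm 2 becomes 8.\<close>

definition frame_table :: "nat \<Rightarrow> int list list list \<Rightarrow> bool" where
  "frame_table d T \<longleftrightarrow> (\<forall>F\<in>set T. length F = d \<and> (\<forall>xs\<in>set F. length xs = 8) \<and>
       (\<forall>i<d. \<forall>j<d. dot_list (F ! i) (F ! j) = (if i = j then 8 else 0))) \<and>
     (\<forall>a<length T. \<forall>b<length T. a \<noteq> b \<longrightarrow> (\<forall>xs\<in>set (T ! a). \<forall>ys\<in>set (T ! b). \<bar>dot_list xs ys\<bar> \<noteq> 8))"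


text \<open>Uniform parity and sum 0 are what puts the halved vectors into E_8 and makes them
  orthogonal to (1/2, ..., 1/2).\<close>

lemma E7_table_frames:
  "frame_table 7 E7_table \<and> length E7_table = 9 \<and> (\<forall>F\<in>set E7_table. \<forall>xs\<in>set F. sum_list xs = 0 \<and>
     ((\<forall>x\<in>set xs. even x) \<or> (\<forall>x\<in>set xs. odd x)))"
  by code_simp

text \<open>Different cosets of the first order Reed-Muller code have no common word, even up to
  sign, as the code contains the all-one word. All words have even weight w in the second order
  code, so the coordinate sum 8 - 2 w is divisible by 4.\<close>

lemma E8_spin_table_frames:
  "frame_table 8 E8_spin_table \<and> length E8_spin_table = 8 \<and>
   (\<forall>F\<in>set E8_spin_table. \<forall>xs\<in>set F. 4 dvd sum_list xs \<and> (\<forall>x\<in>set xs. odd x))"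
  by code_simp

definition half_vec :: "int list \<Rightarrow> real vec" where
  "half_vec xs = vec 8 (\<lambda>i. of_int (xs ! i) / 2)"

lemma half_vec_index: "i < 8 \<Longrightarrow> half_vec xs $ i = of_int (xs ! i) / 2"
  by (simp add: half_vec_def)

lemma half_vec_carrier: "half_vec xs \<in> carrier_vec 8"
  by (simp add: half_vec_def)

lemma scalar_prod_half_vec:
  assumes "length xs = 8" "length ys = 8"
  shows "half_vec xs \<bullet> half_vec ys = of_int (dot_list xs ys) / 4"
proof -
  have "dot_list xs ys = (\<Sum>i<8. xs ! i * ys ! i)"
    using assms by (simp add: dot_list_def sum_list_sum_nth atLeast0LessThan)
  then show ?thesis unfolding scalar_prod_lessThan[OF half_vec_carrier]
    by (simp add: half_vec_index sum_divide_distrib)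
qed

text \<open>Halving turns a uniform parity into integral or half-odd coordinates, and a sum
  divisible by 4 into an even one.\<close>

lemma half_vec_in_E8:
  assumes len: "length xs = 8" and par: "(\<forall>x\<in>set xs. even x) \<or> (\<forall>x\<in>set xs. odd x)" and s: "4 dvd sum_list xs"
  shows "half_vec xs \<in> E8_lattice"
proof -
  have nth: "xs ! i \<in> set xs" if "i < 8" for i using that len by simp
  have "(\<forall>i<8. half_vec xs $ i \<in> \<int>) \<or> (\<forall>i<8. half_vec xs $ i + 1 / 2 \<in> \<int>)"
  proof (rule disj_forward[OF par])
    assume ev: "\<forall>x\<in>set xs. even x"
    show "\<forall>i<8. half_vec xs $ i \<in> \<int>"
    proof (intro allI impI)
      fix i :: nat assume i: "i < 8"
      obtain z where "xs ! i = 2 * z" using ev nth[OF i] by (auto elim!: evenE)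
      then show "half_vec xs $ i \<in> \<int>" using i by (simp add: half_vec_index)
    qed
  next
    assume od: "\<forall>x\<in>set xs. odd x"
    show "\<forall>i<8. half_vec xs $ i + 1 / 2 \<in> \<int>"
    proof (intro allI impI)
      fix i :: nat assume i: "i < 8"
      obtain z where "xs ! i = 2 * z + 1" using od nth[OF i] by (auto elim!: oddE)
      then have "half_vec xs $ i + 1 / 2 = of_int (z + 1)" using i by (simp add: half_vec_index field_simps)
      then show "half_vec xs $ i + 1 / 2 \<in> \<int>" by simp
    qed
  qed
  moreover have "(\<Sum>i<8. half_vec xs $ i) = of_int (sum_list xs) / 2"
    using len by (simp add: half_vec_index sum_list_sum_nth atLeast0LessThan sum_divide_distrib)
  then have "\<exists>m::int. (\<Sum>i<8. half_vec xs $ i) = 2 * of_int m"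
    using s by (auto elim!: dvdE)
  ultimately show ?thesis using half_vec_carrier by (simp add: E8_lattice_def)
qed

lemma frame_table_vectors:
  assumes T: "frame_table d T" and L: "\<forall>F\<in>set T. \<forall>xs\<in>set F. half_vec xs \<in> L"
  defines "v \<equiv> \<lambda>a i. half_vec (T ! a ! i)"
  shows "\<And>a. a < length T \<Longrightarrow> frame_vectors d L (v a)"
    "\<And>a b i j. a < length T \<Longrightarrow> b < length T \<Longrightarrow> a \<noteq> b \<Longrightarrow> i < d \<Longrightarrow> j < d \<Longrightarrow> \<bar>v a i \<bullet> v b j\<bar> \<noteq> 2"
proof -
  have cross: "\<forall>a<length T. \<forall>b<length T. a \<noteq> b \<longrightarrow> (\<forall>xs\<in>set (T ! a). \<forall>ys\<in>set (T ! b). \<bar>dot_list xs ys\<bar> \<noteq> 8)"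
    using T by (simp add: frame_table_def)
  have F: "length (T ! a) = d" "\<And>xs. xs \<in> set (T ! a) \<Longrightarrow> length xs = 8"
    "\<And>i j. i < d \<Longrightarrow> j < d \<Longrightarrow> dot_list (T ! a ! i) (T ! a ! j) = (if i = j then 8 else 0)" if "a < length T" for a
    using T nth_mem[OF that] unfolding frame_table_def by blast+
  have mem: "T ! a ! i \<in> set (T ! a)" if "a < length T" "i < d" for a i using F(1)[OF that(1)] that(2) by simp
  have ip: "v a i \<bullet> v b j = of_int (dot_list (T ! a ! i) (T ! b ! j)) / 4"
    if "a < length T" "b < length T" "i < d" "j < d" for a b i j
    unfolding v_def by (rule scalar_prod_half_vec) (use F(2) mem that in blast)+
  show "frame_vectors d L (v a)" if a: "a < length T" for a
    unfolding frame_vectors_def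
  proof (intro conjI allI impI)
    show "v a i \<in> L" if "i < d" for i unfolding v_def using L nth_mem[OF a] mem[OF a that] by blast
    show "v a i \<bullet> v a j = (if i = j then 2 else 0)" if "i < d" "j < d" for i j
      using ip[OF a a that] F(3)[OF a that] by (cases "i = j") simp_all
  qed
  show "\<bar>v a i \<bullet> v b j\<bar> \<noteq> 2" if ab: "a < length T" "b < length T" "a \<noteq> b" "i < d" "j < d" for a b i j
  proof -
    have "\<bar>dot_list (T ! a ! i) (T ! b ! j)\<bar> \<noteq> 8"
      using cross ab(1-3) mem[OF ab(1,4)] mem[OF ab(2,5)] by blast
    then show ?thesis unfolding ip[OF ab(1,2,4,5)] by linarith
  qed
qed

lemma has_frames_E7: "has_frames 7 E7_lattice 9"
proof -
  have T: "frame_table 7 E7_table" and len: "length E7_table = 9"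
    and tab: "\<And>F xs. F \<in> set E7_table \<Longrightarrow> xs \<in> set F \<Longrightarrow>
      sum_list xs = 0 \<and> ((\<forall>x\<in>set xs. even x) \<or> (\<forall>x\<in>set xs. odd x))"
    using E7_table_frames by blast+
  have "half_vec xs \<in> E7_lattice" if F: "F \<in> set E7_table" "xs \<in> set F" for F xs
  proof -
    have l8: "length xs = 8" using T F by (auto simp: frame_table_def)
    then have "half_vec xs \<in> E8_lattice" using tab[OF F] by (intro half_vec_in_E8) auto
    moreover have "(\<Sum>i<8. half_vec xs $ i) = of_int (sum_list xs) / 2"
      using l8 by (simp add: half_vec_index sum_list_sum_nth atLeast0LessThan sum_divide_distrib)
    ultimately show ?thesis using tab[OF F] by (simp add: E7_lattice_iff)
  qed
  then have "\<forall>F\<in>set E7_table. \<forall>xs\<in>set F. half_vec xs \<in> E7_lattice" by blast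
  note fr = frame_table_vectors[OF T this]
  show ?thesis unfolding has_frames_def
  proof (intro exI[of _ "\<lambda>a i. half_vec (E7_table ! a ! i)"] conjI allI impI)
    show "frame_vectors 7 E7_lattice (\<lambda>i. half_vec (E7_table ! a ! i))" if "a < 9" for a
      using fr(1)[of a] that len by simp
    show "\<bar>half_vec (E7_table ! a ! i) \<bullet> half_vec (E7_table ! b ! j)\<bar> \<noteq> 2"
      if "a < 9" "b < 9" "a \<noteq> b" "i < 7" "j < 7" for a b i j
      using fr(2)[of a b i j] that len by simp
  qed
qed

lemma D8_subset_E8: "D_lattice 8 \<subseteq> E8_lattice"
  by (auto simp: D_lattice_def E8_lattice_def)

text \<open>Seven of the fifteen frames come from \<open>D\<^sub>8\<close>; the vectors of the other eight have
  half-odd coordinates, so no vector can occur in a frame of each kind.\<close>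

lemma has_frames_E8: "has_frames 8 E8_lattice 15"
proof -
  have T: "frame_table 8 E8_spin_table" and len: "length E8_spin_table = 8"
    and tab: "\<And>F xs. F \<in> set E8_spin_table \<Longrightarrow> xs \<in> set F \<Longrightarrow> 4 dvd sum_list xs \<and> (\<forall>x\<in>set xs. odd x)"
    using E8_spin_table_frames by blast+
  have "half_vec xs \<in> E8_lattice" if F: "F \<in> set E8_spin_table" "xs \<in> set F" for F xs
  proof -
    have "length xs = 8" using T F by (auto simp: frame_table_def)
    then show ?thesis using tab[OF F] by (intro half_vec_in_E8) auto
  qed
  then have "\<forall>F\<in>set E8_spin_table. \<forall>xs\<in>set F. half_vec xs \<in> E8_lattice" by blast
  note wt = frame_table_vectors[OF T this, unfolded len]
  define w where "w = (\<lambda>a i. half_vec (E8_spin_table ! a ! i))"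
  have "has_frames 8 (D_lattice 8) 7" using has_frames_D[of 8] by simp
  then obtain u :: "nat \<Rightarrow> nat \<Rightarrow> real vec" where u: "\<And>a. a < 7 \<Longrightarrow> frame_vectors 8 (D_lattice 8) (u a)"
    and u': "\<And>a b i j. a < 7 \<Longrightarrow> b < 7 \<Longrightarrow> a \<noteq> b \<Longrightarrow> i < 8 \<Longrightarrow> j < 8 \<Longrightarrow> \<bar>u a i \<bullet> u b j\<bar> \<noteq> 2"
    using has_framesE by blast
  have w: "frame_vectors 8 E8_lattice (w a)" if "a < 8" for a
    unfolding w_def by (rule wt(1)[OF that])
  have w': "\<bar>w a i \<bullet> w b j\<bar> \<noteq> 2" if "a < 8" "b < 8" "a \<noteq> b" "i < 8" "j < 8" for a b i j
    unfolding w_def by (rule wt(2)[OF that])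
  \<comment> \<open>Both vectors are roots of the integral lattice E_8, so it remains to tell them
    apart up to sign, which coordinate 0 does.\<close>
  have mixed: "u a i \<bullet> w b j \<in> {-1, 0, 1}" if ab: "a < 7" "b < 8" "i < 8" "j < 8" for a b i j
  proof (rule roots_scalar_prod_trichotomy)
    have uD: "u a i \<in> D_lattice 8" using u[OF ab(1)] ab(3) by (simp add: frame_vectors_def)
    have wE: "w b j \<in> E8_lattice" using w[OF ab(2)] ab(4) by (simp add: frame_vectors_def)
    show "u a i \<in> carrier_vec 8" "w b j \<in> carrier_vec 8" using uD wE by (auto simp: D_lattice_def E8_lattice_def)
    show "u a i \<bullet> w b j \<in> \<int>" using integral_E8 uD wE D8_subset_E8 by (auto simp: integral_lattice_def)
    show "u a i \<bullet> u a i = 2" "w b j \<bullet> w b j = 2" using u[OF ab(1)] w[OF ab(2)] ab by (auto simp: frame_vectors_def)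
    have "E8_spin_table ! b \<in> set E8_spin_table" using len ab by simp
    moreover have "E8_spin_table ! b ! j \<in> set (E8_spin_table ! b)" "length (E8_spin_table ! b ! j) = 8"
      using T calculation ab(4) unfolding frame_table_def by auto
    ultimately have "odd (E8_spin_table ! b ! j ! 0)" using tab by (metis nth_mem zero_less_numeral)
    then obtain z where "E8_spin_table ! b ! j ! 0 = 2 * z + 1" by (auto elim: oddE)
    then have w0: "w b j $ 0 = of_int z + 1 / 2" by (simp add: w_def half_vec_index field_simps)
    have "u a i $ 0 \<in> \<int>" using uD by (simp add: D_lattice_def)
    then obtain y where y: "u a i $ 0 = of_int y" by (auto elim: Ints_cases)
    show "u a i \<noteq> w b j"
    proof
      assume "u a i = w b j"
      then have "of_int (2 * y) = (of_int (2 * z + 1) :: real)" using w0 y by simp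
      then have "2 * y = 2 * z + 1" by (simp only: of_int_eq_iff)
      then show False by presburger
    qed
    show "u a i \<noteq> - w b j"
    proof
      assume "u a i = - w b j"
      then have "u a i $ 0 = - (w b j $ 0)" using wE E8_lattice_subset by auto
      then have "of_int (2 * y) = (of_int (- 2 * z - 1) :: real)" using w0 y by simp
      then have "2 * y = - 2 * z - 1" by (simp only: of_int_eq_iff)
      then show False by presburger
    qed
  qed
  define v where "v = (\<lambda>a. if a < 7 then u a else w (a - 7))"
  show ?thesis unfolding has_frames_def
  proof (intro exI[of _ v] conjI allI impI)
    fix a :: nat assume a: "a < 15"
    show "frame_vectors 8 E8_lattice (v a)"
    proof (cases "a < 7")
      case True
      then show ?thesis using u[of a] D8_subset_E8 by (auto simp: v_def frame_vectors_def)
    next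
      case False
      then show ?thesis using w[of "a - 7"] a by (simp add: v_def)
    qed
  next
    fix a b i j :: nat assume ab: "a < 15" "b < 15" "a \<noteq> b" "i < 8" "j < 8"
    have sym: "w c k \<bullet> u e l = u e l \<bullet> w c k" if "c < 8" "k < 8" "e < 7" "l < 8" for c k e l
    proof (rule comm_scalar_prod[of _ 8])
      show "w c k \<in> carrier_vec 8" by (simp add: w_def half_vec_carrier)
      show "u e l \<in> carrier_vec 8" using u[OF that(3)] that(4) by (auto simp: frame_vectors_def D_lattice_def)
    qed
    consider "a < 7" "b < 7" | "a < 7" "b - 7 < 8" "\<not> b < 7" | "a - 7 < 8" "\<not> a < 7" "b < 7"
      | "a - 7 < 8" "\<not> a < 7" "b - 7 < 8" "\<not> b < 7" "a - 7 \<noteq> b - 7"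
      using ab(1-3) by linarith
    then show "\<bar>v a i \<bullet> v b j\<bar> \<noteq> 2"
    proof cases
      case 1
      then show ?thesis using u'[of a b i j] ab by (simp add: v_def)
    next
      case 2
      then show ?thesis using mixed[of a "b - 7" i j] ab by (auto simp: v_def)
    next
      case 3
      then show ?thesis using mixed[of b "a - 7" j i] sym[of "a - 7" i b j] ab by (auto simp: v_def)
    next
      case 4
      then show ?thesis using w'[of "a - 7" "b - 7" i j] ab by (simp add: v_def)
    qed
  qed
qed

section \<open>The extremal lattices\<close>

lemma E7_with_frames: "root_lattice_with_frames 9 7 E7_lattice"
  by (simp add: root_lattice_with_frames_def root_lattice_E7 has_frames_E7)

lemma E8_with_frames: "root_lattice_with_frames 15 8 E8_lattice"
  by (simp add: root_lattice_with_frames_def root_lattice_E8 has_frames_E8)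

lemma D_with_frames: "even n \<Longrightarrow> n \<ge> 2 \<Longrightarrow> root_lattice_with_frames (n - 1) n (D_lattice n)"
  unfolding root_lattice_with_frames_def by (intro conjI root_lattice_D has_frames_D)

lemma max_frames_and_max_MUWM_with_frames:
  assumes L: "root_lattice_with_frames (M + 1) d L" and d: "d > 0"
    and M: "\<And>S. finite S \<Longrightarrow> MUWM d 4 S \<Longrightarrow> card S \<le> M"
  shows "attains_max_frames d L" "max_disjoint_frames d L = M + 1" "max_MUWM d = M"
    "\<exists>S. finite S \<and> MUWM_from_frames d L S \<and> card S = M"
proof -
  have R: "root_lattice d L" and "has_frames d L (M + 1)"
    using L by (auto simp: root_lattice_with_frames_def)
  then obtain v where "disjoint_frame_vectors d L {..<M + 1} v" using has_frames_disjoint by blast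
  note max = max_frames_and_max_MUWM[OF R d M this]
  show "attains_max_frames d L" "max_disjoint_frames d L = M + 1" "max_MUWM d = M"
    "\<exists>S. finite S \<and> MUWM_from_frames d L S \<and> card S = M"
    using max by blast+
qed

lemma D_max:
  assumes "even d" "d \<ge> 4" "d \<noteq> 8"
  shows "attains_max_frames d (D_lattice d)" "max_MUWM d = d - 2"
proof -
  have fr: "root_lattice_with_frames (d - 2 + 1) d (D_lattice d)"
  proof -
    have "d - 2 + 1 = d - 1" using assms by simp
    then show ?thesis using D_with_frames[of d] assms by simp
  qed
  have "d > 0" using assms by simp
  note max = max_frames_and_max_MUWM_with_frames[OF fr this card_MUWM_even[OF _ _ assms]]
  show "attains_max_frames d (D_lattice d)" "max_MUWM d = d - 2" using max by blast+
qed

lemma E8_max: "attains_max_frames 8 E8_lattice" "max_MUWM 8 = 14"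
proof -
  have fr: "root_lattice_with_frames (14 + 1) 8 E8_lattice" using E8_with_frames by simp
  note max = max_frames_and_max_MUWM_with_frames[OF fr _ card_MUWM_8]
  show "attains_max_frames 8 E8_lattice" "max_MUWM 8 = 14" using max by simp_all
qed

text \<open>The 15 frames of each summand match the even bound 16 - 2 = 14 for matrices.\<close>

lemma E8_E8_max: "attains_max_frames 16 (E8_lattice \<bottom>\<^sub>L E8_lattice)"
proof -
  have fr: "root_lattice_with_frames (14 + 1) 16 (E8_lattice \<bottom>\<^sub>L E8_lattice)"
    using root_lattice_with_frames_orth_sum[OF E8_with_frames E8_with_frames] by simp
  have "card S \<le> 14" if "finite S" "MUWM 16 4 S" for S using card_MUWM_even[OF that] by simp
  from max_frames_and_max_MUWM_with_frames(1)[OF fr _ this] show ?thesis by simp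
qed

lemma card_MUWM_odd_le_8:
  assumes "odd d" "finite S" "MUWM d 4 S"
  shows "card S \<le> 8"
  using card_MUWM_odd(3)[OF assms(2,3) _ assms(1)] by (cases "S = {}") auto

lemma odd_max:
  assumes d: "odd d" and L: "root_lattice_with_frames 9 d L"
  shows "attains_max_frames d L" "max_disjoint_frames d L = 9" "max_MUWM d = 8"
    "\<exists>S. finite S \<and> MUWM_from_frames d L S \<and> card S = 8"
proof -
  have "root_lattice_with_frames (8 + 1) d L" "d > 0" using L d by (simp_all add: odd_pos)
  note max = max_frames_and_max_MUWM_with_frames[OF this card_MUWM_odd_le_8[OF d]]
  show "attains_max_frames d L" "max_disjoint_frames d L = 9" "max_MUWM d = 8"
    "\<exists>S. finite S \<and> MUWM_from_frames d L S \<and> card S = 8"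
    using max by simp_all
qed

text \<open>The summand D_n with its n - 1 = 3 or 5 frames is the bottleneck next to nine frames of
  E_7, and the odd bound d - 9 equals n - 2 for d = n + 7.\<close>

lemma D_E7_max:
  assumes "n = 4 \<or> n = 6"
  shows "attains_max_frames (n + 7) (D_lattice n \<bottom>\<^sub>L E7_lattice)" "max_MUWM (n + 7) = n - 2"
proof -
  have "root_lattice_with_frames (n - 1) (n + 7) (D_lattice n \<bottom>\<^sub>L E7_lattice)"
    using assms by (intro root_lattice_with_frames_orth_sum D_with_frames
      root_lattice_with_frames_mono[OF E7_with_frames]) auto
  moreover have "n - 1 = n - 2 + 1" using assms by auto
  ultimately have fr: "root_lattice_with_frames (n - 2 + 1) (n + 7) (D_lattice n \<bottom>\<^sub>L E7_lattice)" by simp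
  have "card S \<le> n - 2" if "finite S" "MUWM (n + 7) 4 S" for S
    using card_MUWM_odd(4)[OF that] assms by (cases "S = {}") auto
  note max = max_frames_and_max_MUWM_with_frames[OF fr _ this]
  show "attains_max_frames (n + 7) (D_lattice n \<bottom>\<^sub>L E7_lattice)" "max_MUWM (n + 7) = n - 2" using max by simp_all
qed

text \<open>The condition m \<ge> 10 ensures m - 1 \<ge> 9 frames in each D_m, so every summand
  supplies the nine frames of E_7.\<close>

lemma E7_E8_D_with_frames:
  assumes "\<forall>(t, m) \<in> set tds. even m \<and> m \<ge> 10"
  shows "root_lattice_with_frames 9 (7 * a + 8 * b + (\<Sum>(t, m) \<leftarrow> tds. t * m))
     (orth_sums (replicate a E7_lattice) \<bottom>\<^sub>L
      orth_sums (replicate b E8_lattice) \<bottom>\<^sub>L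
      orth_sums (map (\<lambda>(t, m). orth_sums (replicate t (D_lattice m))) tds))"
proof -
  have "root_lattice_with_frames 9 (\<Sum>x\<leftarrow>tds. case x of (t, m) \<Rightarrow> t * m)
    (orth_sums (map (\<lambda>x. case x of (t, m) \<Rightarrow> orth_sums (replicate t (D_lattice m))) tds))"
  proof (rule root_lattice_with_frames_orth_sums)
    fix x assume "x \<in> set tds"
    moreover obtain t m where x: "x = (t, m)" by fastforce
    ultimately have "even m" "m \<ge> 10" using assms by auto
    then have "root_lattice_with_frames 9 m (D_lattice m)"
      using root_lattice_with_frames_mono[OF D_with_frames[of m], of 9] by simp
    then show "root_lattice_with_frames 9 (case x of (t, m) \<Rightarrow> t * m)
        (case x of (t, m) \<Rightarrow> orth_sums (replicate t (D_lattice m)))"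
      using root_lattice_with_frames_replicate by (simp add: x)
  qed
  moreover have "root_lattice_with_frames 9 (a * 7) (orth_sums (replicate a E7_lattice))"
    by (rule root_lattice_with_frames_replicate[OF E7_with_frames])
  moreover have "root_lattice_with_frames 9 (b * 8) (orth_sums (replicate b E8_lattice))"
    by (rule root_lattice_with_frames_replicate[OF root_lattice_with_frames_mono[OF E8_with_frames]]) simp
  ultimately have "root_lattice_with_frames 9 (a * 7 + (b * 8 + (\<Sum>(t, m) \<leftarrow> tds. t * m)))
     (orth_sums (replicate a E7_lattice) \<bottom>\<^sub>L
      orth_sums (replicate b E8_lattice) \<bottom>\<^sub>L
      orth_sums (map (\<lambda>(t, m). orth_sums (replicate t (D_lattice m))) tds))"
    by (intro root_lattice_with_frames_orth_sum)
  then show ?thesis by (simp add: ac_simps)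
qed

lemma E7_D_with_frames:
  assumes "odd d" "d \<ge> 17"
  shows "root_lattice_with_frames 9 d (E7_lattice \<bottom>\<^sub>L D_lattice (d - 7))"
proof -
  have "root_lattice_with_frames 9 (7 + (d - 7)) (E7_lattice \<bottom>\<^sub>L D_lattice (d - 7))"
    by (intro root_lattice_with_frames_orth_sum E7_with_frames
      root_lattice_with_frames_mono[OF D_with_frames]) (use assms in auto)
  then show ?thesis using assms by simp
qed

lemma max_MUWM_odd:
  assumes "d = 7 \<or> odd d \<and> d \<ge> 15"
  shows "max_MUWM d = 8"
proof -
  \<comment> \<open>Order 15 is separate: D_8 comes with seven frames from the tournament, so E_8
    takes its place beside E_7.\<close>
  have "d = 7 \<or> d = 15 \<or> odd d \<and> d \<ge> 17" using assms by presburger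
  then consider "d = 7" | "d = 15" | "odd d" "d \<ge> 17" by blast
  then show ?thesis
  proof cases
    case 1
    then show ?thesis using odd_max(3)[OF _ E7_with_frames] by simp
  next
    case 2
    have "root_lattice_with_frames 9 (7 + 8) (E7_lattice \<bottom>\<^sub>L E8_lattice)"
      by (intro root_lattice_with_frames_orth_sum E7_with_frames root_lattice_with_frames_mono[OF E8_with_frames]) simp
    then show ?thesis using odd_max(3)[of d] 2 by simp
  next
    case 3
    then show ?thesis using odd_max(3) E7_D_with_frames by blast
  qed
qed

theorem theorem6p1:
  shows
    "(max_MUWM 5 = 0 \<and> max_MUWM 8 = 14 \<and> max_MUWM 9 = 0 \<and> max_MUWM 11 = 2 \<and> max_MUWM 13 = 4) \<and>
     (\<forall>d. even d \<and> d \<ge> 4 \<and> d \<noteq> 8 \<longrightarrow> max_MUWM d = d - 2) \<and>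
     (\<forall>d. d = 7 \<or> odd d \<and> d \<ge> 15 \<longrightarrow> max_MUWM d = 8) \<and>
     attains_max_frames 8 E8_lattice \<and>
     attains_max_frames 11 (D_lattice 4 \<bottom>\<^sub>L E7_lattice) \<and>
     attains_max_frames 13 (D_lattice 6 \<bottom>\<^sub>L E7_lattice) \<and>
     (\<forall>d. even d \<and> d \<ge> 4 \<and> d \<noteq> 8 \<longrightarrow> attains_max_frames d (D_lattice d)) \<and>
     attains_max_frames 16 (E8_lattice \<bottom>\<^sub>L E8_lattice) \<and>
     (\<forall>d a b (tds :: (nat \<times> nat) list).
        (d = 7 \<or> odd d \<and> d \<ge> 15) \<and> a \<noteq> 0 \<and>
        (\<forall>(t, m) \<in> set tds. even m \<and> m \<ge> 10) \<and>
        d = 7 * a + 8 * b + (\<Sum>(t, m) \<leftarrow> tds. t * m) \<longrightarrow>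
        attains_max_frames d
          (orth_sums (replicate a E7_lattice) \<bottom>\<^sub>L
           orth_sums (replicate b E8_lattice) \<bottom>\<^sub>L
           orth_sums (map (\<lambda>(t, m). orth_sums (replicate t (D_lattice m))) tds))) \<and>
     (\<forall>d. odd d \<and> d \<ge> 17 \<longrightarrow>
        attains_max_frames d (E7_lattice \<bottom>\<^sub>L D_lattice (d - 7)) \<and>
        max_disjoint_frames d (E7_lattice \<bottom>\<^sub>L D_lattice (d - 7)) = max_MUWM d + 1 \<and>
        (\<exists>S. finite S \<and> MUWM_from_frames d (E7_lattice \<bottom>\<^sub>L D_lattice (d - 7)) S \<and>
             card S = max_MUWM d) \<and>
        max_MUWM d = 8)"
proof (intro conjI allI impI)
  have empty: "S = {}" if "finite S" "MUWM d 4 S" "d = 5 \<or> d = 9" for S and d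
    using card_MUWM_odd(1,2)[OF that(1,2)] that(3) by force
  show "max_MUWM 5 = 0" "max_MUWM 9 = 0" by (rule max_MUWM_eq_0, rule empty, auto)+
  show "max_MUWM 8 = 14" "attains_max_frames 8 E8_lattice" by (rule E8_max)+
  show "max_MUWM 11 = 2" "max_MUWM 13 = 4" "attains_max_frames 11 (D_lattice 4 \<bottom>\<^sub>L E7_lattice)"
    "attains_max_frames 13 (D_lattice 6 \<bottom>\<^sub>L E7_lattice)"
    using D_E7_max[of 4] D_E7_max[of 6] by simp_all
  show "attains_max_frames 16 (E8_lattice \<bottom>\<^sub>L E8_lattice)" by (rule E8_E8_max)
next
  fix d :: nat assume "even d \<and> 4 \<le> d \<and> d \<noteq> 8"
  then show "max_MUWM d = d - 2" "attains_max_frames d (D_lattice d)" using D_max by auto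
next
  fix d :: nat assume "d = 7 \<or> odd d \<and> 15 \<le> d"
  then show "max_MUWM d = 8" by (rule max_MUWM_odd)
next
  fix d a b and tds :: "(nat \<times> nat) list"
  assume h: "(d = 7 \<or> odd d \<and> 15 \<le> d) \<and> a \<noteq> 0 \<and> (\<forall>(t, m)\<in>set tds. even m \<and> 10 \<le> m) \<and>
    d = 7 * a + 8 * b + (\<Sum>(t, m)\<leftarrow>tds. t * m)"
  then have "d = 7 \<or> odd d \<and> 15 \<le> d" by blast
  then have "odd d" by auto
  moreover have "root_lattice_with_frames 9 d (orth_sums (replicate a E7_lattice) \<bottom>\<^sub>L
      orth_sums (replicate b E8_lattice) \<bottom>\<^sub>L
      orth_sums (map (\<lambda>(t, m). orth_sums (replicate t (D_lattice m))) tds))"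
  proof -
    have tds: "\<forall>(t, m)\<in>set tds. even m \<and> 10 \<le> m" and "d = 7 * a + 8 * b + (\<Sum>(t, m)\<leftarrow>tds. t * m)"
      using h by blast+
    then show ?thesis using E7_E8_D_with_frames[OF tds] by simp
  qed
  ultimately show "attains_max_frames d (orth_sums (replicate a E7_lattice) \<bottom>\<^sub>L
      orth_sums (replicate b E8_lattice) \<bottom>\<^sub>L
      orth_sums (map (\<lambda>(t, m). orth_sums (replicate t (D_lattice m))) tds))"
    by (rule odd_max)
next
  fix d :: nat assume "odd d \<and> 17 \<le> d"
  then have d: "odd d" "d \<ge> 17" by auto
  note max = odd_max[OF d(1) E7_D_with_frames[OF d]]
  show "attains_max_frames d (E7_lattice \<bottom>\<^sub>L D_lattice (d - 7))" by (rule max)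
  show "max_MUWM d = 8" by (rule max)
  then show "max_disjoint_frames d (E7_lattice \<bottom>\<^sub>L D_lattice (d - 7)) = max_MUWM d + 1" using max(2) by simp
  show "\<exists>S. finite S \<and> MUWM_from_frames d (E7_lattice \<bottom>\<^sub>L D_lattice (d - 7)) S \<and> card S = max_MUWM d"
    using max(3,4) by simp
qed

end
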